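(* Let $(M,g)$ be a Riemannian manifold of finite dimension, let $\Delta=\Delta_g$ be its Laplace–Beltrami operator, let $d\mu$ be the Riemannian volume form, and let $V$ be a continuous nonnegative potential on $M$. Assume: 1. There exists a sequence $(\lambda_n,u_n)$ of quasi-eigenvalues and associated quasimodes for the Schrödinger operator $-\Delta+V$, that is, $$\lim_{n\to+\infty}\|(-\Delta+V-\lambda_n)u_n\|_{L^2(M)}=0,\qquad \|u_n\|_{L^2(M)}=1 .$$ 2. The sequence of measures $|u_n(x)|^2\,d\mu$ tends to a measure $\nu$ for the weak* topology, that is, for any continuous function $f$ on $M$ vanishing at infinity, $$\lim_{n\to+\infty}\int_M f(x)\,|u_n(x)|^2\,d\mu=\int_M f(x)\,d\nu ,$$ and $\nu$ is not absolutely continuous with respect to $\mu$. Then there exists a sequence $(W_k)$ of smooth bounded potentials on $M$ such that $$\|W_k\|_{L^\infty(M)}\le 1,$$ $$\forall p\in[1,+\infty),\quad \lim_{k\to+\infty}\|W_k\|_{L^p(M)}=0,$$ $$\forall t>0,\quad \liminf_{k\to+\infty}\left\|e^{-it(-\Delta+V+W_k)}-e^{-it(-\Delta+V)}\right\|_{\mathcal L(L^2(M))}>0 .$$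
   Context: Potentials are real-valued functions on $M$, acting by multiplication. $L^p(M)$ is taken with respect to the Riemannian volume measure $\mu$. The operators $-\Delta+V$ and $-\Delta+V+W_k$ are regarded as self-adjoint operators on $L^2(M)$ with the common domain $\{u\in L^2(M):\ \Delta u\in L^2(M),\ Vu\in L^2(M)\}$; the quasimodes $u_n$ belong to this domain and $\lambda_n\in\mathbb R$. For such a self-adjoint operator $H$, $e^{-itH}$ denotes the associated unitary group (evolution operator of the Schrödinger equation). $\mathcal L(L^2(M))$ is the space of bounded linear operators on $L^2(M)$ with the operator norm. *)

theory Defs
  imports "HOL-Analysis.Analysis" "HOL-Probability.Essential_Supremum"
begin

section \<open>Smooth functions on open subsets of Euclidean space\<close>

definition partial :: "'n::finite \<Rightarrow> (real^'n \<Rightarrow> 'b::real_normed_vector) \<Rightarrow> real^'n \<Rightarrow> 'b" where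
  "partial i f y = frechet_derivative f (at y) (axis i 1)"

text \<open>Only meaningful for open \<open>S\<close>.\<close>

primrec Ck_on :: "nat \<Rightarrow> (real^'n::finite \<Rightarrow> 'b::real_normed_vector) \<Rightarrow> (real^'n) set \<Rightarrow> bool" where
  "Ck_on 0 f S \<longleftrightarrow> continuous_on S f"
| "Ck_on (Suc k) f S \<longleftrightarrow> f differentiable_on S \<and> (\<forall>i. Ck_on k (partial i f) S)"

definition smooth_on :: "(real^'n::finite \<Rightarrow> 'b::real_normed_vector) \<Rightarrow> (real^'n) set \<Rightarrow> bool" where
  "smooth_on f S \<longleftrightarrow> (\<forall>k. Ck_on k f S)"


section \<open>Riemannian manifolds\<close>

text \<open>
  The manifold is the whole type \<open>'a\<close>, a second countable Hausdorff space, with a smooth atlas of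
  charts into \<open>real^'n\<close>. A chart is a pair \<open>(U, \<phi>)\<close>; the values of \<open>\<phi>\<close> outside \<open>U\<close> are irrelevant.
  The atlas need not be maximal.
\<close>

type_synonym ('a, 'n) chart = "'a set \<times> ('a \<Rightarrow> real^'n)"

definition chart_inv :: "('a, 'n::finite) chart \<Rightarrow> real^'n \<Rightarrow> 'a" where
  "chart_inv c = inv_into (fst c) (snd c)"

definition chart_image :: "('a, 'n::finite) chart \<Rightarrow> (real^'n) set" where
  "chart_image c = snd c ` fst c"

definition is_chart :: "('a::topological_space, 'n::finite) chart \<Rightarrow> bool" where
  "is_chart c \<longleftrightarrow> open (fst c) \<and> open (chart_image c) \<and>
     homeomorphism (fst c) (chart_image c) (snd c) (chart_inv c)"

definition smooth_atlas :: "('a::topological_space, 'n::finite) chart set \<Rightarrow> bool" where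
  "smooth_atlas A \<longleftrightarrow> (\<forall>c\<in>A. is_chart c) \<and> (\<Union>c\<in>A. fst c) = UNIV \<and>
     (\<forall>c\<in>A. \<forall>d\<in>A. smooth_on (snd d \<circ> chart_inv c) (snd c ` (fst c \<inter> fst d)))"

definition smooth_fun :: "('a::topological_space, 'n::finite) chart set \<Rightarrow> ('a \<Rightarrow> real) \<Rightarrow> bool" where
  "smooth_fun A f \<longleftrightarrow> (\<forall>c\<in>A. smooth_on (f \<circ> chart_inv c) (chart_image c))"

text \<open>
  A metric is a symmetric positive definite covariant 2-tensor field: \<open>g c p\<close> is its Gram matrix
  \<open>(g\<^sub>i\<^sub>j)\<close> at \<open>p\<close> in the coordinates of the chart \<open>c\<close>; the last conjunct is the tensor
  transformation law.
\<close>

type_synonym ('a, 'n) metric = "('a, 'n) chart \<Rightarrow> 'a \<Rightarrow> real^'n^'n"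

definition riemannian_metric ::
  "('a::topological_space, 'n::finite) chart set \<Rightarrow> ('a, 'n) metric \<Rightarrow> bool" where
  "riemannian_metric A g \<longleftrightarrow>
     (\<forall>c\<in>A. smooth_on (g c \<circ> chart_inv c) (chart_image c)) \<and>
     (\<forall>c\<in>A. \<forall>p\<in>fst c. transpose (g c p) = g c p \<and> (\<forall>v. v \<noteq> 0 \<longrightarrow> v \<bullet> (g c p *v v) > 0)) \<and>
     (\<forall>c\<in>A. \<forall>d\<in>A. \<forall>p\<in>fst c \<inter> fst d.
        let J = matrix (frechet_derivative (snd d \<circ> chart_inv c) (at (snd c p)))
        in g c p = transpose J ** g d p ** J)"

definition riemannian_manifold ::
  "('a::{t2_space, second_countable_topology}, 'n::finite) chart set \<Rightarrow> ('a, 'n) metric \<Rightarrow> bool" where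
  "riemannian_manifold A g \<longleftrightarrow> smooth_atlas A \<and> riemannian_metric A g"

definition volume_density :: "('a, 'n::finite) metric \<Rightarrow> ('a, 'n) chart \<Rightarrow> real^'n \<Rightarrow> real" where
  "volume_density g c y = sqrt (det (g c (chart_inv c y)))"

text \<open>This determines the Borel measure \<open>\<mu>\<close> uniquely, as countably many charts cover the manifold.\<close>

definition riemannian_volume ::
  "('a::topological_space, 'n::finite) chart set \<Rightarrow> ('a, 'n) metric \<Rightarrow> 'a measure \<Rightarrow> bool" where
  "riemannian_volume A g \<mu> \<longleftrightarrow> sets \<mu> = sets borel \<and>
     (\<forall>c\<in>A. \<forall>B\<in>sets borel. B \<subseteq> fst c \<longrightarrow>
        emeasure \<mu> B = (\<integral>\<^sup>+y\<in>snd c ` B. ennreal (volume_density g c y) \<partial>lborel))"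

text \<open>
  \<open>\<Delta>f = (det g)\<^bsup>-1/2\<^esup> \<Sum>\<^sub>i \<partial>\<^sub>i ((det g)\<^bsup>1/2\<^esup> \<Sum>\<^sub>j g\<^bsup>ij\<^esup> \<partial>\<^sub>j f)\<close> for smooth \<open>f\<close>; the value does not
  depend on the chart chosen around the point.
\<close>

definition laplace_in_chart ::
  "('a, 'n::finite) metric \<Rightarrow> ('a, 'n) chart \<Rightarrow> ('a \<Rightarrow> real) \<Rightarrow> real^'n \<Rightarrow> real" where
  "laplace_in_chart g c f y =
     (\<Sum>i\<in>UNIV. partial i (\<lambda>z. volume_density g c z *
        (\<Sum>j\<in>UNIV. matrix_inv (g c (chart_inv c z)) $ i $ j * partial j (f \<circ> chart_inv c) z)) y)
     / volume_density g c y"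

definition laplace_beltrami ::
  "('a, 'n::finite) chart set \<Rightarrow> ('a, 'n) metric \<Rightarrow> ('a \<Rightarrow> real) \<Rightarrow> 'a \<Rightarrow> real" where
  "laplace_beltrami A g f p =
     (let c = (SOME c. c \<in> A \<and> p \<in> fst c) in laplace_in_chart g c f (snd c p))"

definition test_function :: "('a::topological_space, 'n::finite) chart set \<Rightarrow> ('a \<Rightarrow> real) \<Rightarrow> bool" where
  "test_function A f \<longleftrightarrow> smooth_fun A f \<and> compact (closure {x. f x \<noteq> 0})"


section \<open>Lebesgue spaces and operators on \<open>L\<^sup>2\<close>\<close>

text \<open>
  Elements of \<open>L\<^sup>p\<close> are represented by measurable functions, and equality in \<open>L\<^sup>p\<close> is
  equality almost everywhere. Norms take values in \<open>[0,\<infinity>]\<close>.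
\<close>

definition Lp_norm :: "'a measure \<Rightarrow> real \<Rightarrow> ('a \<Rightarrow> 'b::real_normed_vector) \<Rightarrow> ennreal" where
  "Lp_norm \<mu> p f = (let I = (\<integral>\<^sup>+x. ennreal (norm (f x) powr p) \<partial>\<mu>)
     in if I = \<infinity> then \<infinity> else ennreal (enn2real I powr (1 / p)))"

definition Linf_norm :: "'a measure \<Rightarrow> ('a \<Rightarrow> 'b::real_normed_vector) \<Rightarrow> ereal" where
  "Linf_norm \<mu> f = esssup \<mu> (\<lambda>x. ereal (norm (f x)))"

definition L2 :: "'a measure \<Rightarrow> ('a \<Rightarrow> complex) set" where
  "L2 \<mu> = {u \<in> borel_measurable \<mu>. Lp_norm \<mu> 2 u < \<infinity>}"

definition L2_inner :: "'a measure \<Rightarrow> ('a \<Rightarrow> complex) \<Rightarrow> ('a \<Rightarrow> complex) \<Rightarrow> complex" where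
  "L2_inner \<mu> u v = (\<integral>x. u x * cnj (v x) \<partial>\<mu>)"

definition L2_linear_on :: "'a measure \<Rightarrow> ('a \<Rightarrow> complex) set \<Rightarrow> (('a \<Rightarrow> complex) \<Rightarrow> 'a \<Rightarrow> complex) \<Rightarrow> bool" where
  "L2_linear_on \<mu> D T \<longleftrightarrow>
     (\<forall>u\<in>D. \<forall>v\<in>D. \<forall>a b. AE x in \<mu>. T (\<lambda>x. a * u x + b * v x) x = a * T u x + b * T v x)"

definition op_norm :: "'a measure \<Rightarrow> (('a \<Rightarrow> complex) \<Rightarrow> 'a \<Rightarrow> complex) \<Rightarrow> ennreal" where
  "op_norm \<mu> T = (SUP u\<in>{u \<in> L2 \<mu>. Lp_norm \<mu> 2 u \<le> 1}. Lp_norm \<mu> 2 (T u))"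

text \<open>An unbounded operator is a pair of its domain and its action.\<close>

type_synonym 'a operator = "('a \<Rightarrow> complex) set \<times> (('a \<Rightarrow> complex) \<Rightarrow> 'a \<Rightarrow> complex)"

definition densely_defined :: "'a measure \<Rightarrow> 'a operator \<Rightarrow> bool" where
  "densely_defined \<mu> H \<longleftrightarrow> fst H \<subseteq> L2 \<mu> \<and>
     (\<forall>u\<in>fst H. \<forall>v\<in>fst H. \<forall>a b. (\<lambda>x. a * u x + b * v x) \<in> fst H) \<and>
     (\<forall>u\<in>fst H. snd H u \<in> L2 \<mu>) \<and> L2_linear_on \<mu> (fst H) (snd H) \<and>
     (\<forall>u\<in>L2 \<mu>. \<forall>e>0. \<exists>v\<in>fst H. Lp_norm \<mu> 2 (\<lambda>x. u x - v x) < e)"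

text \<open>Equality of \<open>H\<close> with its adjoint, including equality of the domains.\<close>

definition self_adjoint :: "'a measure \<Rightarrow> 'a operator \<Rightarrow> bool" where
  "self_adjoint \<mu> H \<longleftrightarrow> densely_defined \<mu> H \<and>
     (\<forall>u\<in>L2 \<mu>. \<forall>f\<in>L2 \<mu>.
        (\<forall>v\<in>fst H. L2_inner \<mu> (snd H v) u = L2_inner \<mu> v f) \<longleftrightarrow>
        (u \<in> fst H \<and> (AE x in \<mu>. snd H u x = f x)))"

text \<open>Surjectivity of each \<open>U t\<close>, hence unitarity, follows from the group law.\<close>

definition unitary_group :: "'a measure \<Rightarrow> (real \<Rightarrow> ('a \<Rightarrow> complex) \<Rightarrow> 'a \<Rightarrow> complex) \<Rightarrow> bool" where
  "unitary_group \<mu> U \<longleftrightarrow>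
     (\<forall>t. \<forall>u\<in>L2 \<mu>. U t u \<in> L2 \<mu> \<and> Lp_norm \<mu> 2 (U t u) = Lp_norm \<mu> 2 u) \<and>
     (\<forall>t. L2_linear_on \<mu> (L2 \<mu>) (U t)) \<and>
     (\<forall>u\<in>L2 \<mu>. AE x in \<mu>. U 0 u x = u x) \<and>
     (\<forall>s t. \<forall>u\<in>L2 \<mu>. AE x in \<mu>. U (s + t) u x = U s (U t u) x) \<and>
     (\<forall>u\<in>L2 \<mu>. ((\<lambda>t. Lp_norm \<mu> 2 (\<lambda>x. U t u x - u x)) \<longlongrightarrow> 0) (at 0))"

text \<open>The infinitesimal generator of \<open>U\<close>, with its full domain, is \<open>-iH\<close>.\<close>

definition generated_by ::
  "'a measure \<Rightarrow> (real \<Rightarrow> ('a \<Rightarrow> complex) \<Rightarrow> 'a \<Rightarrow> complex) \<Rightarrow> 'a operator \<Rightarrow> bool" where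
  "generated_by \<mu> U H \<longleftrightarrow>
     (\<forall>u\<in>L2 \<mu>. \<forall>f\<in>L2 \<mu>.
        ((\<lambda>t. Lp_norm \<mu> 2 (\<lambda>x. (U t u x - u x) / complex_of_real t - f x)) \<longlongrightarrow> 0) (at 0) \<longleftrightarrow>
        (u \<in> fst H \<and> (AE x in \<mu>. f x = - \<i> * snd H u x)))"

text \<open>
  \<open>evolution \<mu> H t\<close> is \<open>e\<^bsup>-itH\<^esup>\<close> for self-adjoint \<open>H\<close>. By Stone's theorem the group exists and is unique
  up to equality almost everywhere; the choice only fixes representatives.
\<close>

definition evolution :: "'a measure \<Rightarrow> 'a operator \<Rightarrow> real \<Rightarrow> ('a \<Rightarrow> complex) \<Rightarrow> 'a \<Rightarrow> complex" where
  "evolution \<mu> H = (SOME U. unitary_group \<mu> U \<and> generated_by \<mu> U H)"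


section \<open>Schroedinger operators\<close>

text \<open>\<open>\<Delta>u = w\<close> in the sense of distributions.\<close>

definition distributional_laplacian ::
  "('a::topological_space, 'n::finite) chart set \<Rightarrow> ('a, 'n) metric \<Rightarrow> 'a measure \<Rightarrow>
   ('a \<Rightarrow> complex) \<Rightarrow> ('a \<Rightarrow> complex) \<Rightarrow> bool" where
  "distributional_laplacian A g \<mu> u w \<longleftrightarrow>
     (\<forall>f. test_function A f \<longrightarrow>
        (\<integral>x. u x * complex_of_real (laplace_beltrami A g f x) \<partial>\<mu>) =
        (\<integral>x. w x * complex_of_real (f x) \<partial>\<mu>))"

text \<open>
  \<open>\<Delta>u\<close> for those \<open>u\<close> whose distributional Laplacian is in \<open>L\<^sup>2\<close>; it is determined up to equality
  almost everywhere.
\<close>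

definition L2_laplacian ::
  "('a::topological_space, 'n::finite) chart set \<Rightarrow> ('a, 'n) metric \<Rightarrow> 'a measure \<Rightarrow>
   ('a \<Rightarrow> complex) \<Rightarrow> 'a \<Rightarrow> complex" where
  "L2_laplacian A g \<mu> u = (SOME w. w \<in> L2 \<mu> \<and> distributional_laplacian A g \<mu> u w)"

definition schroedinger ::
  "('a::topological_space, 'n::finite) chart set \<Rightarrow> ('a, 'n) metric \<Rightarrow> 'a measure \<Rightarrow>
   ('a \<Rightarrow> real) \<Rightarrow> 'a operator" where
  "schroedinger A g \<mu> V =
     ({u \<in> L2 \<mu>. (\<exists>w\<in>L2 \<mu>. distributional_laplacian A g \<mu> u w) \<and>
        (\<lambda>x. complex_of_real (V x) * u x) \<in> L2 \<mu>},
      \<lambda>u x. - L2_laplacian A g \<mu> u x + complex_of_real (V x) * u x)"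

text \<open>\<open>H + W\<close> with the domain of \<open>H\<close>.\<close>

definition add_potential :: "'a operator \<Rightarrow> ('a \<Rightarrow> real) \<Rightarrow> 'a operator" where
  "add_potential H W = (fst H, \<lambda>u x. snd H u x + complex_of_real (W x) * u x)"

definition vanishes_at_infinity :: "('a::topological_space \<Rightarrow> real) \<Rightarrow> bool" where
  "vanishes_at_infinity f \<longleftrightarrow> (\<forall>e>0. \<exists>K. compact K \<and> (\<forall>x. x \<notin> K \<longrightarrow> \<bar>f x\<bar> < e))"

end

theory Submission
  imports Defs "HOL-Library.Function_Algebras" "HOL-Computational_Algebra.Polynomial"
begin

text \<open>
  Let \<open>u\<close> be a normalised quasimode, \<open>(H - \<lambda>) u = r\<close>, and put \<open>K = H + W - \<lambda>\<close>. A second order expansion in \<open>t\<close>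
  gives \<open>|\<langle>e\<^bsup>-itK\<^esup> u - u, u\<rangle>| \<ge> t Re \<langle>K u, u\<rangle> - t\<^sup>2 \<parallel>K u\<parallel>\<^sup>2\<close>, while \<open>e\<^bsup>-itH\<^esup> u\<close> stays within \<open>t \<parallel>r\<parallel>\<close> of
  \<open>e\<^bsup>-it\<lambda>\<^esup> u\<close>. Hence the two evolutions differ on \<open>u\<close> as soon as \<open>0 \<le> W \<le> s\<close> and \<open>\<integral> W |u|\<^sup>2 \<ge> c s\<close> with \<open>s t\<close>
  small compared with \<open>c\<close>. A fixed amplitude \<open>s\<close> handles only bounded times, and amplitudes tending to zero give no
  uniform lower bound; so \<open>W\<^sub>k\<close> carries the amplitudes \<open>1/2, 1/4, 1/8, \<dots>\<close> simultaneously, at different scales around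
  a compact \<open>\<mu>\<close>-null set charged by \<open>\<nu>\<close>. The larger amplitudes sit at the finer scales, which a quasimode
  concentrated at a coarser scale does not see.

  The unitary groups are obtained as the limits of \<open>(1 + itH/N)\<^bsup>-N\<^esup>\<close>, \<open>N = 2\<^sup>k\<close>.
\<close>

section \<open>Semi-inner product spaces\<close>

text \<open>Failure of absolute continuity enters as a clash of iterated limits. Let the bumps
  \<open>w i\<close> shrink to the null compact set. For fixed i the integral of w_i |u_n|^2 tends
  to at least c0 > 0 as n grows, by weak* convergence; for fixed n it tends to 0 as i grows, by
  dominated convergence. So every scale is seen by some quasimode and every quasimode is blind to
  fine enough scales, which lets the layers of W_k be tested one at a time. The gain from a layer of
  amplitude s is of order t s c0, the quadratic loss of order t^2 s^2, so the layer used at time t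
  has s below a multiple of c0/t.

  The quasi-eigenvalues may be unbounded, hence the estimates are made for the group multiplied by
  the phase e^(it\<lambda>), in which only the residual and W appear. Since \<open>evolution\<close>
  is a choice, existence of the group has to precede every estimate. Since elements of L^2 are
  functions, \<open>nrm\<close> is only a seminorm there; the Hilbert space arguments run on a
  linear complement of the null functions.\<close>

locale semi_inner_space = vector_space sc
  for sc :: "complex \<Rightarrow> 'v::ab_group_add \<Rightarrow> 'v" (infixr "\<odot>" 75) +
  fixes X :: "'v set" and ip :: "'v \<Rightarrow> 'v \<Rightarrow> complex"
  assumes X_subspace: "subspace X"
    and ip_add_left: "\<lbrakk>x \<in> X; y \<in> X; z \<in> X\<rbrakk> \<Longrightarrow> ip (x + y) z = ip x z + ip y z"
    and ip_scale_left: "\<lbrakk>x \<in> X; z \<in> X\<rbrakk> \<Longrightarrow> ip (c \<odot> x) z = c * ip x z"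
    and ip_commute: "\<lbrakk>x \<in> X; y \<in> X\<rbrakk> \<Longrightarrow> ip x y = cnj (ip y x)"
    and ip_nonneg: "x \<in> X \<Longrightarrow> 0 \<le> Re (ip x x)"
begin

definition nrm :: "'v \<Rightarrow> real" where "nrm x = sqrt (Re (ip x x))"

lemma X_closed [simp, intro]:
  "0 \<in> X" "\<lbrakk>x \<in> X; y \<in> X\<rbrakk> \<Longrightarrow> x + y \<in> X" "\<lbrakk>x \<in> X; y \<in> X\<rbrakk> \<Longrightarrow> x - y \<in> X"
  "x \<in> X \<Longrightarrow> - x \<in> X" "x \<in> X \<Longrightarrow> c \<odot> x \<in> X"
  using X_subspace
  by (auto intro: subspace_0 subspace_add subspace_diff subspace_neg subspace_scale)

lemma ip_add_right: "\<lbrakk>x \<in> X; y \<in> X; z \<in> X\<rbrakk> \<Longrightarrow> ip z (x + y) = ip z x + ip z y"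
  by (metis X_closed(2) complex_cnj_add ip_add_left ip_commute)

lemma ip_scale_right: "\<lbrakk>x \<in> X; z \<in> X\<rbrakk> \<Longrightarrow> ip z (c \<odot> x) = cnj c * ip z x"
  by (metis X_closed(5) complex_cnj_mult ip_commute ip_scale_left)

lemma ip_minus_left: "\<lbrakk>x \<in> X; z \<in> X\<rbrakk> \<Longrightarrow> ip (- x) z = - ip x z"
  using ip_scale_left[of x z "-1"] by simp

lemma ip_minus_right: "\<lbrakk>x \<in> X; z \<in> X\<rbrakk> \<Longrightarrow> ip z (- x) = - ip z x"
  using ip_scale_right[of x z "-1"] by simp

lemma ip_diff_left: "\<lbrakk>x \<in> X; y \<in> X; z \<in> X\<rbrakk> \<Longrightarrow> ip (x - y) z = ip x z - ip y z"
  using ip_add_left[of x "- y" z] by (simp add: ip_minus_left)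

lemma ip_diff_right: "\<lbrakk>x \<in> X; y \<in> X; z \<in> X\<rbrakk> \<Longrightarrow> ip z (x - y) = ip z x - ip z y"
  using ip_add_right[of x "- y" z] by (simp add: ip_minus_right)

lemma ip_zero [simp]: "z \<in> X \<Longrightarrow> ip 0 z = 0" "z \<in> X \<Longrightarrow> ip z 0 = 0"
  using ip_diff_left[of z z z] ip_diff_right[of z z z] by auto

lemmas ip_simps = ip_add_left ip_add_right ip_diff_left ip_diff_right
  ip_scale_left ip_scale_right ip_minus_left ip_minus_right

lemma nrm_nonneg [simp]: "x \<in> X \<Longrightarrow> 0 \<le> nrm x"
  by (simp add: nrm_def ip_nonneg)

lemma nrm_sq: "x \<in> X \<Longrightarrow> (nrm x)\<^sup>2 = Re (ip x x)"
  by (simp add: nrm_def ip_nonneg)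

lemma ip_self: "x \<in> X \<Longrightarrow> ip x x = complex_of_real ((nrm x)\<^sup>2)"
  using ip_commute[of x x] by (simp add: nrm_sq complex_eq_iff)

lemma nrm_zero [simp]: "nrm 0 = 0"
  by (simp add: nrm_def)

lemma nrm_add_sq:
  "\<lbrakk>x \<in> X; y \<in> X\<rbrakk> \<Longrightarrow> (nrm (x + y))\<^sup>2 = (nrm x)\<^sup>2 + (nrm y)\<^sup>2 + 2 * Re (ip x y)"
  using ip_commute[of x y] by (simp add: nrm_sq ip_simps)

lemma nrm_diff_sq:
  "\<lbrakk>x \<in> X; y \<in> X\<rbrakk> \<Longrightarrow> (nrm (x - y))\<^sup>2 = (nrm x)\<^sup>2 + (nrm y)\<^sup>2 - 2 * Re (ip x y)"
  using ip_commute[of x y] by (simp add: nrm_sq ip_simps)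

lemma nrm_scale: "x \<in> X \<Longrightarrow> nrm (c \<odot> x) = cmod c * nrm x"
proof -
  assume x: "x \<in> X"
  have "cnj c * c = complex_of_real ((cmod c)\<^sup>2)"
    by (simp only: complex_norm_square mult.commute)
  then have "ip (c \<odot> x) (c \<odot> x) = complex_of_real ((cmod c)\<^sup>2 * (nrm x)\<^sup>2)"
    using ip_self[OF x] by (simp add: ip_scale_left ip_scale_right x mult.assoc[symmetric])
  then have "(nrm (c \<odot> x))\<^sup>2 = (cmod c * nrm x)\<^sup>2"
    using x by (simp only: nrm_sq X_closed power_mult_distrib Re_complex_of_real)
  then show ?thesis
    using x by (simp add: power2_eq_iff_nonneg)
qed

lemma nrm_minus: "x \<in> X \<Longrightarrow> nrm (- x) = nrm x"
  using nrm_scale[of x "-1"] by simp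

lemma nrm_diff_commute: "\<lbrakk>x \<in> X; y \<in> X\<rbrakk> \<Longrightarrow> nrm (x - y) = nrm (y - x)"
  using nrm_minus[of "x - y"] by simp

lemma Cauchy_Schwarz: 
  assumes x: "x \<in> X" and y: "y \<in> X"
  shows "cmod (ip x y) \<le> nrm x * nrm y"
proof -
  define a where "a = ip x y"
  define A where "A = (cmod a)\<^sup>2"
  have aa: "a * cnj a = complex_of_real A"
    by (simp only: A_def complex_norm_square)
  have ayx: "ip y x = cnj a"
    using ip_commute[of y x] x y by (simp add: a_def)
  have key: "0 \<le> (nrm x)\<^sup>2 - 2 * s * A + s\<^sup>2 * A * (nrm y)\<^sup>2" for s :: real
  proof -
    let ?c = "complex_of_real s * a"
    have "ip (x - ?c \<odot> y) (x - ?c \<odot> y)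
        = ip x x - cnj ?c * a - ?c * cnj a + ?c * cnj ?c * ip y y"
      using x y ayx
      by (simp add: ip_diff_left ip_diff_right ip_scale_left ip_scale_right a_def[symmetric]
          right_diff_distrib mult_ac)
    also have "\<dots> = complex_of_real ((nrm x)\<^sup>2 - 2 * s * A + s\<^sup>2 * A * (nrm y)\<^sup>2)"
    proof -
      have "cnj ?c * a = complex_of_real (s * A)" "?c * cnj a = complex_of_real (s * A)"
        "?c * cnj ?c = complex_of_real (s\<^sup>2 * A)"
        using aa by (simp_all add: power2_eq_square algebra_simps)
      then show ?thesis
        using x y by (simp add: ip_self)
    qed
    finally show ?thesis
      using ip_nonneg[of "x - ?c \<odot> y"] x y by simp
  qed
  have "A \<le> (nrm x)\<^sup>2 * (nrm y)\<^sup>2"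
  \<comment> \<open>For nrm y > 0 the minimising s is 1 / (nrm y)^2. The other case is genuine,
    since nrm y = 0 does not give y = 0 here: \<open>key\<close> is then affine in s with slope -2
    A, so A > 0 would make it negative for large s.\<close>
  proof (cases "nrm y = 0")
    case False
    then have pos: "0 < (nrm y)\<^sup>2" by simp
    have "(1 / (nrm y)\<^sup>2)\<^sup>2 * A * (nrm y)\<^sup>2 = A / (nrm y)\<^sup>2"
      using False by (simp add: power2_eq_square)
    with key[of "1 / (nrm y)\<^sup>2"] have "A / (nrm y)\<^sup>2 \<le> (nrm x)\<^sup>2"
      by simp
    then show ?thesis
      using pos by (simp add: pos_divide_le_eq)
  next
    case True
    have "\<not> 0 < A"
    proof
      assume "0 < A"
      then have "2 * (((nrm x)\<^sup>2 + 1) / (2 * A)) * A = (nrm x)\<^sup>2 + 1"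
        by simp
      then show False
        using key[of "((nrm x)\<^sup>2 + 1) / (2 * A)"] True by simp
    qed
    then show ?thesis using True by simp
  qed
  then have "(cmod a)\<^sup>2 \<le> (nrm x * nrm y)\<^sup>2"
    by (simp add: A_def power_mult_distrib)
  then show ?thesis
    using power2_le_imp_le x y unfolding a_def by auto
qed

lemma nrm_triangle: "\<lbrakk>x \<in> X; y \<in> X\<rbrakk> \<Longrightarrow> nrm (x + y) \<le> nrm x + nrm y"
proof -
  assume xy: "x \<in> X" "y \<in> X"
  have "Re (ip x y) \<le> nrm x * nrm y"
    using Cauchy_Schwarz[OF xy] complex_Re_le_cmod[of "ip x y"] by linarith
  then have "(nrm (x + y))\<^sup>2 \<le> (nrm x + nrm y)\<^sup>2"
    using xy by (simp add: nrm_add_sq power2_sum)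
  then show ?thesis
    using power2_le_imp_le xy by auto
qed

lemma nrm_triangle_mid: "\<lbrakk>x \<in> X; y \<in> X; z \<in> X\<rbrakk> \<Longrightarrow> nrm (x - z) \<le> nrm (x - y) + nrm (y - z)"
  using nrm_triangle[of "x - y" "y - z"] by simp

lemma nrm_triangle_sub: "\<lbrakk>x \<in> X; y \<in> X\<rbrakk> \<Longrightarrow> nrm x \<le> nrm y + nrm (x - y)"
  using nrm_triangle[of "y" "x - y"] by simp

lemma nrm_diff_abs: "\<lbrakk>x \<in> X; y \<in> X\<rbrakk> \<Longrightarrow> \<bar>nrm x - nrm y\<bar> \<le> nrm (x - y)"
  using nrm_triangle_sub[of x y] nrm_triangle_sub[of y x] nrm_diff_commute[of x y] by auto

lemma tendsto_ip:
  assumes "\<And>n. s n \<in> X" "\<And>n. r n \<in> X" "x \<in> X" "y \<in> X"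
    and s: "((\<lambda>n. nrm (s n - x)) \<longlongrightarrow> 0) F" and r: "((\<lambda>n. nrm (r n - y)) \<longlongrightarrow> 0) F"
  shows "((\<lambda>n. ip (s n) (r n)) \<longlongrightarrow> ip x y) F"
proof -
  have "((\<lambda>n. ip (s n) (r n) - ip x y) \<longlongrightarrow> 0) F"
  proof (rule Lim_null_comparison)
    show "((\<lambda>n. nrm (s n - x) * nrm (r n - y) + nrm (s n - x) * nrm y + nrm x * nrm (r n - y)) \<longlongrightarrow> 0) F"
      using tendsto_add[OF tendsto_add[OF tendsto_mult[OF s r] tendsto_mult_left_zero[OF s, of "nrm y"]]
          tendsto_mult_right_zero[OF r, of "nrm x"]] by simp
    have "cmod (ip (s n) (r n) - ip x y)
        \<le> nrm (s n - x) * nrm (r n - y) + nrm (s n - x) * nrm y + nrm x * nrm (r n - y)" for n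
    proof -
      have "ip (s n) (r n) - ip x y
          = ip (s n - x) (r n - y) + ip (s n - x) y + ip x (r n - y)"
        using assms(1-4) by (simp add: ip_simps)
      also have "cmod \<dots> \<le> cmod (ip (s n - x) (r n - y)) + cmod (ip (s n - x) y) + cmod (ip x (r n - y))"
        by (intro norm_triangle_le add_right_mono norm_triangle_ineq)
      also have "\<dots> \<le> nrm (s n - x) * nrm (r n - y) + nrm (s n - x) * nrm y + nrm x * nrm (r n - y)"
        using assms(1-4) by (intro add_mono Cauchy_Schwarz) auto
      finally show ?thesis .
    qed
    then show "\<forall>\<^sub>F n in F. cmod (ip (s n) (r n) - ip x y)
        \<le> nrm (s n - x) * nrm (r n - y) + nrm (s n - x) * nrm y + nrm x * nrm (r n - y)"
      by simp
  qed
  then show ?thesis by (simp add: LIM_zero_iff)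
qed

lemma tendsto_nrm:
  assumes "\<And>n. s n \<in> X" "x \<in> X" "((\<lambda>n. nrm (s n - x)) \<longlongrightarrow> 0) F"
  shows "((\<lambda>n. nrm (s n)) \<longlongrightarrow> nrm x) F"
  unfolding nrm_def using tendsto_ip[OF assms(1,1,2,2,3,3)]
  by (intro tendsto_real_sqrt tendsto_Re)

text \<open>Polarization: norms of sums determine the real parts, and replacing \<open>x\<close> by
  \<open>\<i> \<odot> x\<close> turns imaginary parts into real ones.\<close>

lemma ip_isometry:
  assumes T: "\<And>x. x \<in> X \<Longrightarrow> T x \<in> X" "\<And>x. x \<in> X \<Longrightarrow> nrm (T x) = nrm x"
    and lin: "\<And>c x y. \<lbrakk>x \<in> X; y \<in> X\<rbrakk> \<Longrightarrow> T (c \<odot> x + y) = c \<odot> T x + T y"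
    and x: "x \<in> X" and y: "y \<in> X"
  shows "ip (T x) (T y) = ip x y"
proof -
  have re: "Re (ip (T u) (T v)) = Re (ip u v)" if "u \<in> X" "v \<in> X" for u v
  proof -
    have "(nrm (T u + T v))\<^sup>2 = (nrm (u + v))\<^sup>2"
      using lin[of u v 1] T(2)[of "u + v"] that by simp
    then show ?thesis
      using that T by (simp add: nrm_add_sq)
  qed
  have "T 0 + T 0 = T 0"
    using lin[of 0 0 1] by simp
  then have T0: "T 0 = 0"
    by simp
  have "Re (ip (T (\<i> \<odot> x)) (T y)) = Re (ip (\<i> \<odot> x) y)"
    using x y by (intro re) auto
  moreover have "T (\<i> \<odot> x) = \<i> \<odot> T x"
    using lin[of x 0 "\<i>"] x T0 by simp
  ultimately have "Im (ip (T x) (T y)) = Im (ip x y)"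
    using x y T by (simp add: ip_simps)
  with re[OF x y] show ?thesis by (simp add: complex_eq_iff)
qed

end

section \<open>Resolvents of self-adjoint operators\<close>

text \<open>\<open>X\<close> sits inside a larger vector space because it will be a set of
  functions. Completeness is phrased by Cauchy sequences for \<open>nrm\<close>, the ambient type
  being a bare abelian group.\<close>

locale hilbert_subspace = semi_inner_space sc X ip
  for sc :: "complex \<Rightarrow> 'v::ab_group_add \<Rightarrow> 'v" (infixr "\<odot>" 75) and X ip +
  assumes definite: "\<lbrakk>x \<in> X; nrm x = 0\<rbrakk> \<Longrightarrow> x = 0"
    and complete: "\<lbrakk>\<And>n. s n \<in> X; \<And>e. 0 < e \<Longrightarrow> \<exists>N::nat. \<forall>m\<ge>N. \<forall>n\<ge>N. nrm (s m - s n) < e\<rbrakk>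
      \<Longrightarrow> \<exists>l\<in>X. (\<lambda>n. nrm (s n - l)) \<longlonglongrightarrow> 0"
begin

lemma nrm_tendsto_unique:
  assumes "\<And>n. s n \<in> X" "x \<in> X" "y \<in> X" "F \<noteq> bot"
    and sx: "((\<lambda>n. nrm (s n - x)) \<longlongrightarrow> 0) F" and sy: "((\<lambda>n. nrm (s n - y)) \<longlongrightarrow> 0) F"
  shows "x = y"
proof -
  have "nrm (x - y) \<le> nrm (s n - x) + nrm (s n - y)" for n
    using nrm_triangle_mid[of x "s n" y] nrm_diff_commute[of x "s n"] assms(1-3) by simp
  moreover have "((\<lambda>n. nrm (s n - x) + nrm (s n - y)) \<longlongrightarrow> 0) F"
    using tendsto_add[OF sx sy] by simp
  ultimately have "nrm (x - y) \<le> 0"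
    using assms(4) by (intro tendsto_lowerbound) auto
  then have "nrm (x - y) = 0"
    using nrm_nonneg[of "x - y"] assms(2,3) by (simp add: order_antisym)
  then show ?thesis
    using definite[of "x - y"] assms(2,3) by simp
qed

text \<open>Moving \<open>r\<close> along \<open>y\<close> by the small multiple
  \<open>s * ip r y\<close> gains 2 s |ip r y|^2 to first order; minimality forces this below the
  second-order term.\<close>

lemma orthogonal_if_minimal:
  assumes r: "r \<in> X" and y: "y \<in> X" and min: "\<And>c. nrm r \<le> nrm (r - c \<odot> y)"
  shows "ip y r = 0"
proof -
  define a where "a = ip r y"
  \<comment> \<open>The added 1 covers nrm y = 0 and keeps s (nrm y)^2 below 1, so that the
    second-order term is at most half of the first-order one.\<close>
  define s where "s = 1 / ((nrm y)\<^sup>2 + 1)"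
  have s: "0 < s" "s * (nrm y)\<^sup>2 < 1"
    by (simp_all add: s_def add_nonneg_pos divide_simps)
  let ?c = "complex_of_real s * a"
  have "(nrm r)\<^sup>2 \<le> (nrm (r - ?c \<odot> y))\<^sup>2"
    using min[of ?c] r by (intro power_mono) auto
  also have "\<dots> = (nrm r)\<^sup>2 + (cmod ?c * nrm y)\<^sup>2 - 2 * Re (cnj ?c * a)"
    using r y by (simp add: nrm_diff_sq nrm_scale ip_scale_right a_def)
  also have "Re (cnj ?c * a) = s * (cmod a)\<^sup>2"
    unfolding cmod_power2 by (simp add: power2_eq_square algebra_simps)
  also have "(cmod ?c * nrm y)\<^sup>2 = s * (cmod a)\<^sup>2 * (s * (nrm y)\<^sup>2)"
    using s by (simp add: norm_mult power2_eq_square)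
  finally have "2 * (s * (cmod a)\<^sup>2) \<le> s * (cmod a)\<^sup>2 * (s * (nrm y)\<^sup>2)"
    by simp
  also have "\<dots> \<le> s * (cmod a)\<^sup>2 * 1"
    using s by (intro mult_left_mono) auto
  finally have "s * (cmod a)\<^sup>2 \<le> 0" by simp
  then have "a = 0"
    using s by (simp add: mult_le_0_iff)
  then show ?thesis
    using ip_commute[OF y r] by (simp add: a_def)
qed

section \<open>Linear contractions and their powers\<close>

definition contraction :: "('v \<Rightarrow> 'v) \<Rightarrow> bool" where
  "contraction T \<longleftrightarrow> (\<forall>x\<in>X. T x \<in> X \<and> nrm (T x) \<le> nrm x) \<and>
     (\<forall>c. \<forall>x\<in>X. \<forall>y\<in>X. T (c \<odot> x + y) = c \<odot> T x + T y)"

lemma contractionD: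
  assumes "contraction T"
  shows "x \<in> X \<Longrightarrow> T x \<in> X" "x \<in> X \<Longrightarrow> nrm (T x) \<le> nrm x"
    "\<lbrakk>x \<in> X; y \<in> X\<rbrakk> \<Longrightarrow> T (c \<odot> x + y) = c \<odot> T x + T y"
    "\<lbrakk>x \<in> X; y \<in> X\<rbrakk> \<Longrightarrow> T (x + y) = T x + T y"
    "\<lbrakk>x \<in> X; y \<in> X\<rbrakk> \<Longrightarrow> T (x - y) = T x - T y"
    "x \<in> X \<Longrightarrow> T (c \<odot> x) = c \<odot> T x"
proof -
  show 1: "x \<in> X \<Longrightarrow> T x \<in> X" "x \<in> X \<Longrightarrow> nrm (T x) \<le> nrm x" for x
    using assms by (auto simp: contraction_def)
  show 2: "\<lbrakk>x \<in> X; y \<in> X\<rbrakk> \<Longrightarrow> T (c \<odot> x + y) = c \<odot> T x + T y" for c x y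
    using assms by (auto simp: contraction_def)
  show "\<lbrakk>x \<in> X; y \<in> X\<rbrakk> \<Longrightarrow> T (x + y) = T x + T y"
    using 2[of x y 1] by simp
  show "\<lbrakk>x \<in> X; y \<in> X\<rbrakk> \<Longrightarrow> T (x - y) = T x - T y"
    using 2[of y x "-1"] by simp
  have "T 0 = 0"
    using 2[of 0 0 1] by simp
  then show "x \<in> X \<Longrightarrow> T (c \<odot> x) = c \<odot> T x"
    using 2[of x 0 c] by simp
qed

lemma contraction_id: "contraction id"
  by (simp add: contraction_def)

lemma contraction_comp:
  assumes A: "contraction A" and B: "contraction B"
  shows "contraction (A \<circ> B)"
proof -
  have "nrm (A (B x)) \<le> nrm x" if "x \<in> X" for x
    using contractionD(2)[OF A, of "B x"] contractionD(1,2)[OF B that] by linarith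
  then show ?thesis
    using A B by (simp add: contraction_def)
qed

lemma contraction_funpow: "contraction A \<Longrightarrow> contraction (A ^^ n)"
  by (induction n) (auto simp: contraction_id contraction_comp simp flip: id_def)

lemma contraction_diff_le:
  "\<lbrakk>contraction A; x \<in> X; y \<in> X\<rbrakk> \<Longrightarrow> nrm (A x - A y) \<le> nrm (x - y)"
  using contractionD(2,5) by (metis X_closed(3))

lemma funpow_commute_on:
  assumes "contraction A" "contraction B" and AB: "\<And>x. x \<in> X \<Longrightarrow> A (B x) = B (A x)" and "x \<in> X"
  shows "(A ^^ n) (B x) = B ((A ^^ n) x)"
proof (induction n)
  case (Suc n)
  then show ?case
    using AB contractionD(1)[OF contraction_funpow[OF assms(1)] \<open>x \<in> X\<close>] by simp
qed simp

lemma funpow_comp_on: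
  assumes "contraction A" "contraction B" and AB: "\<And>x. x \<in> X \<Longrightarrow> A (B x) = B (A x)" and "x \<in> X"
  shows "((A \<circ> B) ^^ n) x = (A ^^ n) ((B ^^ n) x)"
proof (induction n)
  case (Suc n)
  have "(B ^^ n) x \<in> X"
    using contractionD(1)[OF contraction_funpow] assms by blast
  then have "(A ^^ n) (B ((B ^^ n) x)) = B ((A ^^ n) ((B ^^ n) x))"
    using funpow_commute_on assms(1-3) by blast
  then show ?case
    using Suc by simp
qed simp

text \<open>Telescoping in which errors do not grow, both maps being contractions. Commutation turns
  A^n (B u) into B (A^n u), so only the one-step error at \<open>u\<close> itself enters.\<close>

lemma funpow_diff_le:
  assumes A: "contraction A" and B: "contraction B"
    and AB: "\<And>x. x \<in> X \<Longrightarrow> A (B x) = B (A x)" and u: "u \<in> X"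
  shows "nrm ((A ^^ n) u - (B ^^ n) u) \<le> real n * nrm (A u - B u)"
proof (induction n)
  case (Suc n)
  note An = contraction_funpow[OF A, of n]
  have X: "A u \<in> X" "B u \<in> X" "(A ^^ n) u \<in> X" "(B ^^ n) u \<in> X"
    using A B u by (auto intro: contractionD contraction_funpow)
  have "nrm ((A ^^ Suc n) u - (B ^^ Suc n) u)
      = nrm (((A ^^ n) (A u) - (A ^^ n) (B u)) + (B ((A ^^ n) u) - B ((B ^^ n) u)))"
    using funpow_commute_on[OF A B AB u, of n] by (simp add: funpow_swap1)
  also have "\<dots> \<le> nrm ((A ^^ n) (A u) - (A ^^ n) (B u)) + nrm (B ((A ^^ n) u) - B ((B ^^ n) u))"
    using X contractionD(1)[OF An] contractionD(1)[OF B] by (intro nrm_triangle) auto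
  also have "\<dots> \<le> nrm (A u - B u) + real n * nrm (A u - B u)"
    using contraction_diff_le[OF An X(1,2)] contraction_diff_le[OF B X(3,4)] Suc by linarith
  finally show ?case by (simp add: algebra_simps)
qed simp

end

locale self_adjoint_operator = hilbert_subspace sc X ip
  for sc :: "complex \<Rightarrow> 'v::ab_group_add \<Rightarrow> 'v" (infixr "\<odot>" 75) and X ip +
  fixes D :: "'v set" and H :: "'v \<Rightarrow> 'v"
  assumes D_subspace: "subspace D" and D_X: "D \<subseteq> X" and H_X: "u \<in> D \<Longrightarrow> H u \<in> X"
    and H_lin: "\<lbrakk>u \<in> D; v \<in> D\<rbrakk> \<Longrightarrow> H (c \<odot> u + v) = c \<odot> H u + H v"
    and D_dense: "\<lbrakk>u \<in> X; 0 < e\<rbrakk> \<Longrightarrow> \<exists>v\<in>D. nrm (u - v) < e"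
    and H_self_adjoint: "\<lbrakk>u \<in> X; f \<in> X\<rbrakk>
      \<Longrightarrow> (\<forall>v\<in>D. ip (H v) u = ip v f) \<longleftrightarrow> u \<in> D \<and> H u = f"
begin

lemma D_closed [simp, intro]:
  "0 \<in> D" "\<lbrakk>x \<in> D; y \<in> D\<rbrakk> \<Longrightarrow> x + y \<in> D" "\<lbrakk>x \<in> D; y \<in> D\<rbrakk> \<Longrightarrow> x - y \<in> D"
  "x \<in> D \<Longrightarrow> c \<odot> x \<in> D" "x \<in> D \<Longrightarrow> x \<in> X" "x \<in> D \<Longrightarrow> H x \<in> X"
  using D_subspace D_X H_X
  by (auto intro: subspace_0 subspace_add subspace_diff subspace_scale)

lemma H_add: "\<lbrakk>u \<in> D; v \<in> D\<rbrakk> \<Longrightarrow> H (u + v) = H u + H v"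
  using H_lin[of u v 1] by simp

lemma H_diff: "\<lbrakk>u \<in> D; v \<in> D\<rbrakk> \<Longrightarrow> H (u - v) = H u - H v"
  using H_lin[of v u "-1"] by simp

lemma H_zero: "H 0 = 0"
  using H_diff[of 0 0] by simp

lemma H_scale: "u \<in> D \<Longrightarrow> H (c \<odot> u) = c \<odot> H u"
  using H_lin[of u 0 c] by (simp add: H_zero)

lemma H_symmetric: "\<lbrakk>u \<in> D; v \<in> D\<rbrakk> \<Longrightarrow> ip (H u) v = ip u (H v)"
  using H_self_adjoint[of v "H v"] by blast

lemma Im_ip_H: "u \<in> D \<Longrightarrow> Im (ip u (H u)) = 0"
proof -
  assume u: "u \<in> D"
  then have "ip u (H u) = cnj (ip u (H u))"
    using H_symmetric[of u u] ip_commute[of u "H u"] by simp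
  from arg_cong[OF this, of Im] show ?thesis by simp
qed

abbreviation R :: "real \<Rightarrow> 'v \<Rightarrow> 'v" where
  "R t u \<equiv> u + (\<i> * complex_of_real t) \<odot> H u"

text \<open>\<open>ip u (H u)\<close> is real, so the cross term is purely imaginary. For t \<noteq>
  0 this identity makes \<open>R t\<close> injective with closed range and its inverse a
  contraction.\<close>

lemma nrm_R: "u \<in> D \<Longrightarrow> (nrm (R t u))\<^sup>2 = (nrm u)\<^sup>2 + t\<^sup>2 * (nrm (H u))\<^sup>2"
  using Im_ip_H[of u]
  by (simp add: nrm_add_sq nrm_scale ip_scale_right norm_mult power_mult_distrib)

lemma nrm_le_nrm_R: "u \<in> D \<Longrightarrow> nrm u \<le> nrm (R t u)"
  by (rule power2_le_imp_le) (auto simp: nrm_R)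

lemma nrm_H_le_nrm_R: "u \<in> D \<Longrightarrow> \<bar>t\<bar> * nrm (H u) \<le> nrm (R t u)"
  by (rule power2_le_imp_le) (auto simp: nrm_R power_mult_distrib)

lemma R_diff: "\<lbrakk>u \<in> D; v \<in> D\<rbrakk> \<Longrightarrow> R t (u - v) = R t u - R t v"
  by (simp add: H_diff algebra_simps)

text \<open>\<open>H\<close> equals its adjoint, and the equation that defines the adjoint survives
  the limits of \<open>s n\<close> and of \<open>H (s n)\<close>.\<close>

lemma H_closed:
  assumes s: "\<And>n::nat. s n \<in> D" and x: "x \<in> X" and y: "y \<in> X"
    and sx: "(\<lambda>n. nrm (s n - x)) \<longlonglongrightarrow> 0" and sy: "(\<lambda>n. nrm (H (s n) - y)) \<longlonglongrightarrow> 0"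
  shows "x \<in> D \<and> H x = y"
proof -
  have "ip (H v) x = ip v y" if v: "v \<in> D" for v
  proof -
    have "(\<lambda>n. ip (H v) (s n)) \<longlonglongrightarrow> ip (H v) x"
      using s x v sx by (intro tendsto_ip) auto
    moreover have "(\<lambda>n. ip v (H (s n))) \<longlonglongrightarrow> ip v y"
      using s y v sy by (intro tendsto_ip) auto
    ultimately show ?thesis
      using H_symmetric[OF v s] LIMSEQ_unique by simp
  qed
  then show ?thesis using H_self_adjoint[OF x y] by blast
qed

text \<open>The point of the range closest to \<open>f\<close> exists because the range is complete; the residual is
  orthogonal to the range, hence an eigenvector of \<open>H\<close> with an imaginary eigenvalue, hence zero.\<close>

lemma R_surj:
  assumes t: "t \<noteq> 0" and f: "f \<in> X"
  shows "\<exists>u\<in>D. R t u = f"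
proof -
  define d where "d = (INF u\<in>D. nrm (R t u - f))"
  have bdd: "bdd_below ((\<lambda>u. nrm (R t u - f)) ` D)"
    using f by (intro bdd_belowI2[of _ 0]) auto
  have d_le: "d \<le> nrm (R t u - f)" if "u \<in> D" for u
    unfolding d_def using bdd that by (rule cINF_lower)
  have d0: "0 \<le> d"
    unfolding d_def using f by (intro cINF_greatest) auto
  have "\<exists>u\<in>D. nrm (R t u - f) < d + e" if "0 < e" for e
  proof -
    have "Inf ((\<lambda>u. nrm (R t u - f)) ` D) < d + e"
      using that by (simp add: d_def)
    then show ?thesis
      using cINF_less_iff[OF _ bdd, of "d + e"] D_closed(1) by blast
  qed
  then have "\<forall>n. \<exists>u. u \<in> D \<and> nrm (R t u - f) < d + inverse (real (Suc n))"
    by (metis inverse_positive_iff_positive of_nat_0_less_iff zero_less_Suc)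
  then obtain s where s: "\<And>n. s n \<in> D" "\<And>n. nrm (R t (s n) - f) < d + inverse (real (Suc n))"
    by metis
  \<comment> \<open>The midpoint of \<open>s m\<close> and \<open>s n\<close> lies in
    \<open>D\<close>, so the residual there is at least \<open>d\<close>. The parallelogram identity
    then bounds the squared distance of the two residuals by 4 (d + e)^2 - (2 d)^2.\<close>
  have parallelogram: "(nrm (R t (s m - s n)))\<^sup>2 \<le> 8 * d * e + 4 * e\<^sup>2"
    if e: "inverse (real (Suc m)) \<le> e" "inverse (real (Suc n)) \<le> e" for m n e
  proof -
    define a where "a = R t (s m) - f"
    define b where "b = R t (s n) - f"
    have ab: "a \<in> X" "b \<in> X"
      using s(1) f by (auto simp: a_def b_def)
    have "a + b = 2 \<odot> (R t ((1/2) \<odot> (s m + s n)) - f)"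
      using s(1) scale_left_distrib[of 1 1 f]
      by (simp add: a_def b_def H_scale H_add scale_right_distrib scale_right_diff_distrib)
    then have "nrm (a + b) = 2 * nrm (R t ((1/2) \<odot> (s m + s n)) - f)"
      using s(1) f nrm_scale[of "R t ((1/2) \<odot> (s m + s n)) - f" 2] by simp
    then have "2 * d \<le> nrm (a + b)"
      using d_le[of "(1/2) \<odot> (s m + s n)"] s(1) by simp
    then have 1: "(2 * d)\<^sup>2 \<le> (nrm (a + b))\<^sup>2"
      using d0 by (intro power_mono) auto
    have "nrm a \<le> d + e" "nrm b \<le> d + e"
      using s(2)[of m] s(2)[of n] e by (auto simp: a_def b_def)
    then have 2: "(nrm a)\<^sup>2 \<le> (d + e)\<^sup>2" "(nrm b)\<^sup>2 \<le> (d + e)\<^sup>2"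
      using ab by (auto intro!: power_mono)
    have "R t (s m - s n) = a - b"
      using s(1) by (simp add: R_diff a_def b_def)
    then have "(nrm (R t (s m - s n)))\<^sup>2 = 2 * (nrm a)\<^sup>2 + 2 * (nrm b)\<^sup>2 - (nrm (a + b))\<^sup>2"
      using ab by (simp add: nrm_diff_sq nrm_add_sq)
    also have "\<dots> \<le> 4 * (d + e)\<^sup>2 - (2 * d)\<^sup>2"
      using 1 2 by linarith
    also have "\<dots> = 8 * d * e + 4 * e\<^sup>2"
      by (simp add: power2_eq_square algebra_simps)
    finally show ?thesis .
  qed
  have cauchy: "\<exists>N. \<forall>m\<ge>N. \<forall>n\<ge>N. nrm (R t (s m - s n)) < e" if e: "0 < e" for e
  proof -
    have "(\<lambda>k. 8 * d * inverse (real (Suc k)) + 4 * (inverse (real (Suc k)))\<^sup>2) \<longlonglongrightarrow> 8 * d * 0 + 4 * 0\<^sup>2"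
      by (intro tendsto_intros LIMSEQ_inverse_real_of_nat)
    then have "\<forall>\<^sub>F k in sequentially. 8 * d * inverse (real (Suc k)) + 4 * (inverse (real (Suc k)))\<^sup>2 < e\<^sup>2"
      by (rule order_tendstoD) (use e in simp)
    then obtain N where N: "8 * d * inverse (real (Suc N)) + 4 * (inverse (real (Suc N)))\<^sup>2 < e\<^sup>2"
      by (meson eventually_sequentially order_refl)
    have "nrm (R t (s m - s n)) < e" if "N \<le> m" "N \<le> n" for m n
    proof (rule power2_less_imp_less)
      show "(nrm (R t (s m - s n)))\<^sup>2 < e\<^sup>2"
        using parallelogram[of m "inverse (real (Suc N))" n] N that by (simp add: le_imp_inverse_le)
    qed (use e in simp)
    then show ?thesis by blast
  qed
  \<comment> \<open>\<open>nrm (R t v)\<close> dominates both nrm v and |t| nrm (H v), so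
    \<open>s n\<close> and \<open>H (s n)\<close> are Cauchy separately, and closedness of
    \<open>H\<close> puts the limit into \<open>D\<close>.\<close>
  have "\<exists>N. \<forall>m\<ge>N. \<forall>n\<ge>N. nrm (s m - s n) < e" if "0 < e" for e
    using cauchy[OF that] nrm_le_nrm_R[of "s _ - s _" t] s(1) by (meson D_closed(3) order_le_less_trans)
  then obtain x where x: "x \<in> X" "(\<lambda>n. nrm (s n - x)) \<longlonglongrightarrow> 0"
    using complete[of s] s(1) by blast
  have "\<exists>N. \<forall>m\<ge>N. \<forall>n\<ge>N. nrm (H (s m) - H (s n)) < e" if "0 < e" for e
  proof -
    obtain N where N: "\<And>m n. \<lbrakk>N \<le> m; N \<le> n\<rbrakk> \<Longrightarrow> nrm (R t (s m - s n)) < \<bar>t\<bar> * e"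
      using cauchy[of "\<bar>t\<bar> * e"] \<open>0 < e\<close> t by auto
    have "\<bar>t\<bar> * nrm (H (s m) - H (s n)) < \<bar>t\<bar> * e" if "N \<le> m" "N \<le> n" for m n
      using N[OF that] nrm_H_le_nrm_R[of "s m - s n" t] s(1) by (simp add: H_diff)
    then show ?thesis
      using t by auto
  qed
  then obtain y where y: "y \<in> X" "(\<lambda>n. nrm (H (s n) - y)) \<longlonglongrightarrow> 0"
    using complete[of "\<lambda>n. H (s n)"] s(1) by blast
  have xD: "x \<in> D" and Hx: "H x = y"
    using H_closed[of s x y] s x y by auto
  define r where "r = f - R t x"
  have r: "r \<in> X"
    using xD f by (auto simp: r_def)
  have "nrm r \<le> d"
  proof (rule tendsto_lowerbound)
    show "(\<lambda>n. d + inverse (real (Suc n)) + nrm (s n - x) + \<bar>t\<bar> * nrm (H (s n) - y)) \<longlonglongrightarrow> d"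
      using tendsto_add[OF tendsto_add[OF tendsto_add[OF tendsto_const[of d] LIMSEQ_inverse_real_of_nat] x(2)]
        tendsto_mult_right_zero[OF y(2), of "\<bar>t\<bar>"]] by simp
    have "nrm r \<le> d + inverse (real (Suc n)) + nrm (s n - x) + \<bar>t\<bar> * nrm (H (s n) - y)" for n
    proof -
      have "r = (f - R t (s n)) + ((s n - x) + (\<i> * complex_of_real t) \<odot> (H (s n) - y))"
        by (simp add: r_def Hx scale_right_diff_distrib)
      also have "nrm \<dots> \<le> nrm (f - R t (s n)) + nrm ((s n - x) + (\<i> * complex_of_real t) \<odot> (H (s n) - y))"
        using s(1) f x(1) y(1) by (intro nrm_triangle) auto
      also have "\<dots> \<le> nrm (f - R t (s n)) + (nrm (s n - x) + nrm ((\<i> * complex_of_real t) \<odot> (H (s n) - y)))"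
        using s(1) x(1) y(1) by (intro add_left_mono nrm_triangle) auto
      also have "nrm (f - R t (s n)) = nrm (R t (s n) - f)"
        using s(1) f by (intro nrm_diff_commute) auto
      also have "nrm ((\<i> * complex_of_real t) \<odot> (H (s n) - y)) = \<bar>t\<bar> * nrm (H (s n) - y)"
        using s(1) y(1) by (simp add: nrm_scale norm_mult)
      finally show ?thesis
        using s(2)[of n] by linarith
    qed
    then show "\<forall>\<^sub>F n in sequentially. nrm r \<le> d + inverse (real (Suc n)) + nrm (s n - x) + \<bar>t\<bar> * nrm (H (s n) - y)"
      by simp
  qed simp
  have orth: "ip (R t v) r = 0" if v: "v \<in> D" for v
  proof (rule orthogonal_if_minimal)
    fix c
    have "nrm r \<le> nrm (R t (x + c \<odot> v) - f)"
      using \<open>nrm r \<le> d\<close> d_le[of "x + c \<odot> v"] xD v by simp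
    also have "R t (x + c \<odot> v) - f = - (r - c \<odot> R t v)"
      using xD v by (simp add: r_def H_add H_scale scale_right_distrib mult.commute)
    also have "nrm \<dots> = nrm (r - c \<odot> R t v)"
      using r v by (intro nrm_minus) auto
    finally show "nrm r \<le> nrm (r - c \<odot> R t v)" .
  qed (use r v in auto)
  \<comment> \<open>Orthogonality to the range reads ip v r + i t ip (H v) r = 0. The number k
    satisfies cnj k = i / t, which moves the factor into the second argument.\<close>
  define k where "k = - \<i> / complex_of_real t"
  have "ip (H v) r = ip v (k \<odot> r)" if v: "v \<in> D" for v
  proof -
    have "ip v r + \<i> * complex_of_real t * ip (H v) r = 0"
      using orth[OF v] v r by (simp add: ip_add_left ip_scale_left)
    moreover have "ip (H v) r = - (\<i> / complex_of_real t) * (\<i> * complex_of_real t * ip (H v) r)"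
      using t by simp
    ultimately have "ip (H v) r = \<i> / complex_of_real t * ip v r"
      by (metis add_eq_0_iff minus_mult_minus)
    moreover have "cnj k = \<i> / complex_of_real t"
      by (simp add: k_def)
    ultimately show ?thesis
      using v r by (simp only: ip_scale_right D_closed)
  qed
  then have rD: "r \<in> D" and Hr: "H r = k \<odot> r"
    using H_self_adjoint[of r "k \<odot> r"] r by auto
  \<comment> \<open>This number is ip r (H r), real by symmetry, while k is imaginary and
    nonzero.\<close>
  have "Im (cnj k * complex_of_real ((nrm r)\<^sup>2)) = 0"
    using Im_ip_H[OF rD] r by (simp only: Hr ip_scale_right ip_self)
  then have "nrm r = 0"
    using t by (simp add: k_def)
  then have "f = R t x"
    using definite[OF r] by (simp add: r_def)
  then show ?thesis using xD by blast
qed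

end

section \<open>The unitary group of a self-adjoint operator\<close>

context self_adjoint_operator
begin

section \<open>Resolvents, the inverses of 1 + itH\<close>

lemma R_inj: "\<lbrakk>u \<in> D; v \<in> D; R t u = R t v\<rbrakk> \<Longrightarrow> u = v"
  using nrm_le_nrm_R[of "u - v" t] definite[of "u - v"] nrm_nonneg[of "u - v"]
  by (simp add: R_diff order_antisym del: nrm_nonneg)

text \<open>\<open>R 0\<close> is the identity on \<open>D\<close> and reaches only
  \<open>D\<close>, so at t = 0 the identity of \<open>X\<close> is put in by hand; this makes
  \<open>J t\<close> act on all of \<open>X\<close> for every real t.\<close>

definition J :: "real \<Rightarrow> 'v \<Rightarrow> 'v" where
  "J t f = (if t = 0 then f else SOME u. u \<in> D \<and> R t u = f)"

lemma J_zero [simp]: "J 0 f = f"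
  by (simp add: J_def)

lemma J_D_R:
  assumes "t \<noteq> 0" "f \<in> X"
  shows "J t f \<in> D" "R t (J t f) = f"
proof -
  have "\<exists>u. u \<in> D \<and> R t u = f"
    using R_surj[OF assms] by blast
  from someI_ex[OF this] show "J t f \<in> D" "R t (J t f) = f"
    using assms by (auto simp: J_def)
qed

lemma J_X [simp]: "f \<in> X \<Longrightarrow> J t f \<in> X"
  using J_D_R by (cases "t = 0") auto

lemma J_D [simp]: "u \<in> D \<Longrightarrow> J t u \<in> D"
  using J_D_R by (cases "t = 0") auto

lemma J_R: "u \<in> D \<Longrightarrow> J t (R t u) = u"
  using J_D_R[of t "R t u"] R_inj[of "J t (R t u)" u t] by (cases "t = 0") auto

lemma contraction_J: "contraction (J t)"
proof (cases "t = 0")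
  case True
  then show ?thesis by (simp add: contraction_def)
next
  case False
  show ?thesis
    unfolding contraction_def
  proof (intro conjI ballI allI)
    fix x assume x: "x \<in> X"
    then show "J t x \<in> X" by simp
    show "nrm (J t x) \<le> nrm x"
      using nrm_le_nrm_R[of "J t x" t] J_D_R[OF False x] by simp
  next
    fix c x y assume x: "x \<in> X" and y: "y \<in> X"
    have "R t (c \<odot> J t x + J t y) = c \<odot> R t (J t x) + R t (J t y)"
      using J_D_R(1)[OF False x] J_D_R(1)[OF False y]
      by (simp only: H_lin scale_right_distrib scale_scale mult.commute add.assoc add.left_commute)
    also have "\<dots> = c \<odot> x + y"
      using J_D_R[OF False x] J_D_R[OF False y] by (simp only:)
    finally have "R t (c \<odot> J t x + J t y) = c \<odot> x + y" .
    then show "J t (c \<odot> x + y) = c \<odot> J t x + J t y"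
      using J_R[of "c \<odot> J t x + J t y" t] J_D_R[OF False x] J_D_R[OF False y] by simp
  qed
qed

lemmas J_contr = contractionD[OF contraction_J]

text \<open>For w = J t u the vector H w is a multiple of u - w, hence again in \<open>D\<close>, so
  \<open>H\<close> may be applied to the equation R t w = u.\<close>

lemma H_J: "u \<in> D \<Longrightarrow> H (J t u) = J t (H u)"
proof (cases "t = 0")
  case False
  assume u: "u \<in> D"
  define w where "w = J t u"
  have w: "w \<in> D" "R t w = u"
    using J_D_R[OF False, of u] u by (auto simp: w_def)
  then have "(\<i> * complex_of_real t) \<odot> H w = u - w"
    by (simp add: eq_diff_eq add.commute)
  then have "(1 / (\<i> * complex_of_real t)) \<odot> ((\<i> * complex_of_real t) \<odot> H w) = (1 / (\<i> * complex_of_real t)) \<odot> (u - w)"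
    by simp
  then have "H w = (1 / (\<i> * complex_of_real t)) \<odot> (u - w)"
    using False by (subst (asm) scale_scale) simp
  then have HwD: "H w \<in> D"
    using u w by simp
  have "R t (H w) = H (R t w)"
    using HwD w(1) by (simp add: H_add H_scale)
  then have "R t (H w) = H u"
    using w by simp
  then show ?thesis
    using J_R[OF HwD, of t] by (simp add: w_def)
qed simp

lemma J_diff_id: "u \<in> D \<Longrightarrow> u - J t u = (\<i> * complex_of_real t) \<odot> J t (H u)"
  using J_D_R(2)[of t u] H_J[of u t] by (cases "t = 0") (auto simp: algebra_simps)

text \<open>\<open>J a\<close> commutes with \<open>H\<close>, hence with \<open>R b\<close>, hence
  with the inverse of \<open>R b\<close>.\<close>

lemma J_commute: "f \<in> X \<Longrightarrow> J a (J b f) = J b (J a f)"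
proof (cases "b = 0")
  case False
  assume f: "f \<in> X"
  have D: "J b f \<in> D" and f_eq: "R b (J b f) = f"
    using J_D_R[OF False f] by auto
  have "J a f = J a (R b (J b f))"
    using f_eq by simp
  also have "\<dots> = R b (J a (J b f))"
    using D by (simp add: J_contr(4) J_contr(6) H_J)
  finally show ?thesis
    using J_R[of "J a (J b f)" b] D by simp
qed simp

text \<open>The product of \<open>R b\<close> and \<open>R a\<close> differs from
  \<open>R (a + b)\<close> by -ab H^2. Two resolvent steps therefore differ from the merged step by
  a quantity of second order on the domain of H^2.\<close>

lemma J_step:
  assumes u: "u \<in> D" "H u \<in> D"
  shows "nrm (J a (J b u) - J (a + b) u) \<le> \<bar>a * b\<bar> * nrm (H (H u))"
proof -
  define z where "z = J (a + b) u"
  have z: "z \<in> D" "H z \<in> D" "H (H z) = J (a + b) (H (H u))"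
    using u by (auto simp: z_def H_J)
  have u_eq: "u = R (a + b) z"
    using J_D_R(2)[of "a + b" u] u by (cases "a + b = 0") (auto simp: z_def)
  define w where "w = complex_of_real (a * b) \<odot> H (H z)"
  have w: "w \<in> X"
    using z(1,2) by (simp add: w_def)
  have "R b (R a z) = u - w"
    using z by (simp add: u_eq w_def H_add H_scale scale_left_distrib algebra_simps)
  then have "J a (J b (u - w)) = z"
    using J_R[of "R a z" b] J_R[of z a] z by simp
  then have "J a (J b u) - z = J a (J b w)"
    using u w by (simp add: J_contr(5) algebra_simps)
  also have "nrm \<dots> \<le> nrm w"
    using w by (meson J_X J_contr(2) order_trans)
  also have "\<dots> = \<bar>a * b\<bar> * nrm (J (a + b) (H (H u)))"
    using z(1,2) unfolding w_def z(3)[symmetric] by (simp add: nrm_scale norm_mult abs_mult)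
  also have "\<dots> \<le> \<bar>a * b\<bar> * nrm (H (H u))"
    using u by (intro mult_left_mono J_contr) auto
  finally show ?thesis by (simp add: z_def)
qed

lemma J_id_le: "u \<in> D \<Longrightarrow> nrm (J t u - u) \<le> \<bar>t\<bar> * nrm (H u)"
proof -
  assume u: "u \<in> D"
  have "nrm (J t u - u) = nrm (u - J t u)"
    using u by (intro nrm_diff_commute) auto
  also have "\<dots> = \<bar>t\<bar> * nrm (J t (H u))"
    using u by (simp add: J_diff_id nrm_scale norm_mult)
  also have "\<dots> \<le> \<bar>t\<bar> * nrm (H u)"
    using u by (intro mult_left_mono J_contr) auto
  finally show ?thesis .
qed

text \<open>A Lipschitz bound on the dense domain extends to continuity at 0 on all of
  \<open>X\<close> because contractions do not enlarge the approximation error. Stated for a family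
  \<open>T\<close> to serve both \<open>J\<close> and \<open>U\<close>.\<close>

lemma contraction_continuous:
  assumes T: "\<And>t. contraction (T t)" and T_le: "\<And>t v. v \<in> D \<Longrightarrow> nrm (T t v - v) \<le> \<bar>t\<bar> * nrm (H v)"
    and u: "u \<in> X"
  shows "((\<lambda>t. nrm (T t u - u)) \<longlongrightarrow> 0) (at 0)"
proof (rule tendstoI)
  fix e :: real assume e: "0 < e"
  obtain v where v: "v \<in> D" "nrm (u - v) < e / 4"
    using D_dense[OF u, of "e / 4"] e by auto
  have "((\<lambda>t. \<bar>t\<bar> * nrm (H v)) \<longlongrightarrow> \<bar>0\<bar> * nrm (H v)) (at 0)"
    by (intro tendsto_intros)
  then have "\<forall>\<^sub>F t in at 0. \<bar>t\<bar> * nrm (H v) < e / 2"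
    by (rule order_tendstoD) (use e in simp)
  then show "\<forall>\<^sub>F t in at 0. dist (nrm (T t u - u)) 0 < e"
  proof eventually_elim
    fix t :: real assume t: "\<bar>t\<bar> * nrm (H v) < e / 2"
    have "nrm (T t u - u) \<le> nrm (T t u - T t v) + nrm (T t v - u)"
      using u v by (intro nrm_triangle_mid) (auto simp: contractionD(1)[OF T])
    also have "nrm (T t v - u) \<le> nrm (T t v - v) + nrm (v - u)"
      using u v by (intro nrm_triangle_mid) (auto simp: contractionD(1)[OF T])
    also have "nrm (T t u - T t v) \<le> nrm (u - v)"
      using u v by (intro contraction_diff_le T) auto
    finally show "dist (nrm (T t u - u)) 0 < e"
      using T_le[OF v(1), of t] t v(2) u v(1) nrm_diff_commute[of v u] by (simp add: contractionD(1)[OF T])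
  qed
qed

lemma J_approx: "\<lbrakk>w \<in> X; 0 < e\<rbrakk> \<Longrightarrow> \<exists>r. r \<noteq> 0 \<and> nrm (w - J r w) < e"
proof -
  assume w: "w \<in> X" and e: "0 < e"
  have "\<forall>\<^sub>F r in at 0. nrm (J r w - w) < e"
    using contraction_continuous[OF contraction_J J_id_le w] e by (rule order_tendstoD)
  moreover have "\<forall>\<^sub>F r in at (0::real). r \<noteq> 0"
    by (simp add: eventually_at_filter)
  ultimately have "\<forall>\<^sub>F r in at 0. r \<noteq> 0 \<and> nrm (J r w - w) < e"
    by eventually_elim simp
  then have "\<exists>r. r \<noteq> 0 \<and> nrm (J r w - w) < e"
    by (rule eventually_happens'[rotated]) simp
  then show ?thesis
    using w nrm_diff_commute by (metis J_X)
qed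

section \<open>The domain of H^2\<close>

definition D2 :: "'v set" where "D2 = {u \<in> D. H u \<in> D}"

lemma D2_D [simp]: "u \<in> D2 \<Longrightarrow> u \<in> D" "u \<in> D2 \<Longrightarrow> H u \<in> D"
  by (auto simp: D2_def)

lemma J_D2: "\<lbrakk>u \<in> D; r \<noteq> 0\<rbrakk> \<Longrightarrow> J r u \<in> D2"
  unfolding D2_def using J_D_R(1)[of r "H u"] by (simp add: H_J del: D2_D)

text \<open>Approximate within \<open>D\<close> first, then apply a resolvent close to the identity:
  \<open>J r\<close> maps \<open>D\<close> into \<open>D2\<close>.\<close>

lemma D2_dense: "\<lbrakk>u \<in> X; 0 < e\<rbrakk> \<Longrightarrow> \<exists>v\<in>D2. nrm (u - v) < e"
proof -
  assume u: "u \<in> X" and e: "0 < e"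
  obtain v where v: "v \<in> D" "nrm (u - v) < e / 2"
    using D_dense[OF u, of "e / 2"] e by auto
  obtain r where r: "r \<noteq> 0" "nrm (v - J r v) < e / 2"
    using J_approx[of v "e / 2"] v e by auto
  have "nrm (u - J r v) < e"
    using nrm_triangle_mid[of u v "J r v"] u v r by simp
  then show ?thesis
    using J_D2[OF v(1) r(1)] by blast
qed

section \<open>Backward Euler approximations and their convergence\<close>

definition Q :: "nat \<Rightarrow> real \<Rightarrow> 'v \<Rightarrow> 'v" where
  "Q k t = J (t / 2 ^ k) ^^ (2 ^ k)"

lemma contraction_Q: "contraction (Q k t)"
  by (simp add: Q_def contraction_funpow contraction_J)

lemmas Q_contr = contractionD[OF contraction_Q]

text \<open>Powers of two make each step of \<open>Q k\<close> comparable with two half steps of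
  \<open>Q (Suc k)\<close>. There are 2^k pairs, each with error h^2 for h = t / 2^(k+1), whence the
  constant t^2/4 times 2^(-k).\<close>

lemma Q_step:
  assumes u: "u \<in> D2"
  shows "nrm (Q (Suc k) t u - Q k t u) \<le> t\<^sup>2 / 4 * (1 / 2) ^ k * nrm (H (H u))"
proof -
  define h where "h = t / 2 ^ Suc k"
  have hh: "h + h = t / 2 ^ k" by (simp add: h_def)
  have "Q (Suc k) t = (J h ^^ 2) ^^ (2 ^ k)"
    by (simp add: Q_def h_def funpow_mult)
  also have "J h ^^ 2 = J h \<circ> J h"
    by (simp add: numeral_2_eq_2)
  finally have "nrm (Q (Suc k) t u - Q k t u) = nrm (((J h \<circ> J h) ^^ (2 ^ k)) u - (J (h + h) ^^ (2 ^ k)) u)"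
    by (simp only: hh Q_def)
  also have "\<dots> \<le> real (2 ^ k) * nrm ((J h \<circ> J h) u - J (h + h) u)"
    using u by (intro funpow_diff_le contraction_comp contraction_J) (auto simp: J_commute)
  also have "\<dots> \<le> real (2 ^ k) * (\<bar>h * h\<bar> * nrm (H (H u)))"
    using J_step[of u h h] u by (intro mult_left_mono) auto
  also have "\<dots> = t\<^sup>2 / 4 * (1 / 2) ^ k * nrm (H (H u))"
    by (simp add: h_def power2_eq_square field_simps)
  finally show ?thesis .
qed

text \<open>Partial sum of the geometric series of \<open>Q_step\<close>; keeping the subtracted
  term \<open>(1 / 2) ^ (k + j)\<close> makes the induction close exactly.\<close>

lemma Q_bound:
  assumes u: "u \<in> D2"
  shows "nrm (Q (k + j) t u - Q k t u) \<le> t\<^sup>2 / 2 * ((1 / 2) ^ k - (1 / 2) ^ (k + j)) * nrm (H (H u))"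
proof (induction j)
  case (Suc j)
  have "nrm (Q (k + Suc j) t u - Q k t u) \<le> nrm (Q (Suc (k + j)) t u - Q (k + j) t u) + nrm (Q (k + j) t u - Q k t u)"
    using nrm_triangle_mid[of "Q (Suc (k + j)) t u" "Q (k + j) t u" "Q k t u"] u by (simp add: Q_contr)
  also have "\<dots> \<le> t\<^sup>2 / 4 * (1 / 2) ^ (k + j) * nrm (H (H u))
      + t\<^sup>2 / 2 * ((1 / 2) ^ k - (1 / 2) ^ (k + j)) * nrm (H (H u))"
    using Q_step[OF u, of "k + j" t] Suc by (intro add_mono) auto
  also have "\<dots> = t\<^sup>2 / 2 * ((1 / 2) ^ k - (1 / 2) ^ (k + Suc j)) * nrm (H (H u))"
    by (simp add: algebra_simps)
  finally show ?case .
qed (use u in simp)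

lemma Q_bound':
  assumes u: "u \<in> D2" and "k \<le> m"
  shows "nrm (Q m t u - Q k t u) \<le> t\<^sup>2 / 2 * (1 / 2) ^ k * nrm (H (H u))"
proof -
  have "nrm (Q m t u - Q k t u) \<le> t\<^sup>2 / 2 * ((1 / 2) ^ k - (1 / 2) ^ m) * nrm (H (H u))"
    using Q_bound[OF u, of k "m - k" t] \<open>k \<le> m\<close> by simp
  also have "\<dots> \<le> t\<^sup>2 / 2 * (1 / 2) ^ k * nrm (H (H u))"
    using u by (intro mult_right_mono mult_left_mono) auto
  finally show ?thesis .
qed

text \<open>On \<open>D2\<close> the sequence is Cauchy with a rate. Being contractions, the
  \<open>Q k t\<close> transfer this to \<open>X\<close> by density, with the single vector
  \<open>Q N t v\<close> as common reference point.\<close>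

lemma Q_convergent: "u \<in> X \<Longrightarrow> \<exists>l\<in>X. (\<lambda>k. nrm (Q k t u - l)) \<longlonglongrightarrow> 0"
proof (rule complete)
  fix e :: real assume u: "u \<in> X" and e: "0 < e"
  obtain v where v: "v \<in> D2" "nrm (u - v) < e / 6"
    using D2_dense[OF u, of "e / 6"] e by auto
  have "(\<lambda>k. t\<^sup>2 / 2 * (1 / 2) ^ k * nrm (H (H v))) \<longlonglongrightarrow> t\<^sup>2 / 2 * 0 * nrm (H (H v))"
    by (intro tendsto_intros LIMSEQ_power_zero) simp
  then have "\<forall>\<^sub>F k in sequentially. t\<^sup>2 / 2 * (1 / 2) ^ k * nrm (H (H v)) < e / 6"
    by (rule order_tendstoD) (use e in simp)
  then obtain N where N: "t\<^sup>2 / 2 * (1 / 2) ^ N * nrm (H (H v)) < e / 6"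
    by (meson eventually_sequentially order_refl)
  have close: "nrm (Q m t u - Q N t v) < e / 3" if "N \<le> m" for m
  proof -
    have "nrm (Q m t u - Q N t v) \<le> nrm (Q m t u - Q m t v) + nrm (Q m t v - Q N t v)"
      using u v by (intro nrm_triangle_mid) (auto simp: Q_contr)
    also have "nrm (Q m t u - Q m t v) \<le> nrm (u - v)"
      using u v by (intro contraction_diff_le contraction_Q) auto
    finally show ?thesis
      using Q_bound'[OF v(1) that, of t] N v(2) by linarith
  qed
  have "nrm (Q m t u - Q n t u) < e" if "N \<le> m" "N \<le> n" for m n
    using nrm_triangle_mid[of "Q m t u" "Q N t v" "Q n t u"] nrm_diff_commute[of "Q n t u" "Q N t v"]
      close[OF that(1)] close[OF that(2)] u v e by (simp add: Q_contr)
  then show "\<exists>N. \<forall>m\<ge>N. \<forall>n\<ge>N. nrm (Q m t u - Q n t u) < e" by blast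
qed (simp add: Q_contr)

section \<open>The limit as a group of isometries\<close>

definition U :: "real \<Rightarrow> 'v \<Rightarrow> 'v" where
  "U t u = (SOME l. l \<in> X \<and> (\<lambda>k. nrm (Q k t u - l)) \<longlonglongrightarrow> 0)"

lemma U_lim:
  assumes "u \<in> X"
  shows "U t u \<in> X" "(\<lambda>k. nrm (Q k t u - U t u)) \<longlonglongrightarrow> 0"
proof -
  have "\<exists>l. l \<in> X \<and> (\<lambda>k. nrm (Q k t u - l)) \<longlonglongrightarrow> 0"
    using Q_convergent[OF assms] by blast
  from someI_ex[OF this] show "U t u \<in> X" "(\<lambda>k. nrm (Q k t u - U t u)) \<longlonglongrightarrow> 0"
    by (auto simp: U_def)
qed

lemma U_eqI: "\<lbrakk>u \<in> X; l \<in> X; (\<lambda>k. nrm (Q k t u - l)) \<longlonglongrightarrow> 0\<rbrakk> \<Longrightarrow> U t u = l"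
  using nrm_tendsto_unique[of "\<lambda>k. Q k t u" "U t u" l sequentially] U_lim[of u t]
  by (simp add: Q_contr)

lemma nrm_le_limI:
  assumes "\<And>k. s k \<in> X" "l \<in> X" "w \<in> X" "(\<lambda>k. nrm (s k - l)) \<longlonglongrightarrow> 0"
    and "\<And>k. nrm (s k - w) \<le> b"
  shows "nrm (l - w) \<le> b"
proof (rule tendsto_upperbound)
  have "(\<lambda>k. nrm ((s k - w) - (l - w))) \<longlonglongrightarrow> 0"
    using assms(4) by simp
  then show "(\<lambda>k. nrm (s k - w)) \<longlonglongrightarrow> nrm (l - w)"
    using assms(1-3) by (intro tendsto_nrm) auto
qed (use assms(5) in auto)

lemma contraction_U: "contraction (U t)"
  unfolding contraction_def
proof (intro conjI ballI allI)
  fix x assume x: "x \<in> X"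
  show "U t x \<in> X" by (rule U_lim[OF x])
  show "nrm (U t x) \<le> nrm x"
    using nrm_le_limI[of "\<lambda>k. Q k t x" "U t x" 0 "nrm x"] U_lim[OF x] x by (simp add: Q_contr)
next
  fix c x y assume x: "x \<in> X" and y: "y \<in> X"
  show "U t (c \<odot> x + y) = c \<odot> U t x + U t y"
  proof (rule U_eqI)
    have "(\<lambda>k. cmod c * nrm (Q k t x - U t x) + nrm (Q k t y - U t y)) \<longlonglongrightarrow> 0"
      using tendsto_add[OF tendsto_mult_right_zero[OF U_lim(2)[OF x, of t], of "cmod c"] U_lim(2)[OF y, of t]]
      by simp
    then show "(\<lambda>k. nrm (Q k t (c \<odot> x + y) - (c \<odot> U t x + U t y))) \<longlonglongrightarrow> 0"
    proof (rule tendsto_0_le[where K = 1], intro always_eventually allI)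
      fix k
      have eq: "Q k t (c \<odot> x + y) - (c \<odot> U t x + U t y) = c \<odot> (Q k t x - U t x) + (Q k t y - U t y)"
        using x y by (simp add: Q_contr(3) scale_right_diff_distrib)
      have "nrm (c \<odot> (Q k t x - U t x) + (Q k t y - U t y))
          \<le> nrm (c \<odot> (Q k t x - U t x)) + nrm (Q k t y - U t y)"
        using x y by (intro nrm_triangle) (auto simp: Q_contr U_lim)
      then have "nrm (Q k t (c \<odot> x + y) - (c \<odot> U t x + U t y))
          \<le> cmod c * nrm (Q k t x - U t x) + nrm (Q k t y - U t y)"
        unfolding eq using x y by (simp add: nrm_scale Q_contr U_lim)
      then show "norm (nrm (Q k t (c \<odot> x + y) - (c \<odot> U t x + U t y)))
          \<le> norm (cmod c * nrm (Q k t x - U t x) + nrm (Q k t y - U t y)) * 1"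
        using x y by (simp add: Q_contr U_lim)
    qed
  qed (use x y U_lim in auto)
qed

lemmas U_contr = contractionD[OF contraction_U]

lemma contraction_eqI:
  assumes A: "contraction A" and B: "contraction B" and eq: "\<And>v. v \<in> D2 \<Longrightarrow> A v = B v" and u: "u \<in> X"
  shows "A u = B u"
proof -
  have X: "A u \<in> X" "B u \<in> X"
    using A B u by (auto intro: contractionD)
  have "nrm (A u - B u) \<le> e" if e: "0 < e" for e
  proof -
    obtain v where v: "v \<in> D2" "nrm (u - v) < e / 2"
      using D2_dense[OF u, of "e / 2"] e by auto
    have vX: "v \<in> X" "A v \<in> X" using v A by (auto intro: contractionD)
    have "nrm (A u - B u) \<le> nrm (A u - A v) + nrm (B v - B u)"
      using nrm_triangle_mid[OF X(1) vX(2) X(2)] eq[OF v(1)] by simp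
    also have "\<dots> \<le> nrm (u - v) + nrm (v - u)"
      using A B u vX by (intro add_mono contraction_diff_le) auto
    finally show ?thesis
      using v u vX nrm_diff_commute[of u v] by simp
  qed
  then have "nrm (A u - B u) \<le> 0"
    by (rule field_le_epsilon[of _ 0, simplified])
  then show ?thesis
    using definite[of "A u - B u"] nrm_nonneg[of "A u - B u"] X by (simp add: order_antisym del: nrm_nonneg)
qed

lemma U_zero: "u \<in> X \<Longrightarrow> U 0 u = u"
proof (rule U_eqI)
  have "Q k 0 u = u" for k
  proof -
    have "(J 0 ^^ n) u = u" for n by (induction n) auto
    then show ?thesis by (simp add: Q_def)
  qed
  then show "(\<lambda>k. nrm (Q k 0 u - u)) \<longlonglongrightarrow> 0" by simp
qed auto

text \<open>Both sides are approximated with 2^k steps, merged ones \<open>J (h + l)\<close> against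
  pairs \<open>J h\<close>, \<open>J l\<close>; the total error 2^k |h l| equals |s t| / 2^k. The
  vector \<open>U t u\<close> enters only through convergence of \<open>Q k s\<close> on all of
  \<open>X\<close>.\<close>

lemma U_add_D2:
  assumes u: "u \<in> D2"
  shows "U (s + t) u = U s (U t u)"
proof (rule U_eqI)
  let ?C = "nrm (H (H u))"
  have uX: "u \<in> X" using u by simp
  note X = Q_contr(1)[OF uX] U_lim(1)[OF uX]
  have "nrm (Q k (s + t) u - U s (U t u))
      \<le> \<bar>s * t\<bar> * (1/2) ^ k * ?C + nrm (Q k t u - U t u) + nrm (Q k s (U t u) - U s (U t u))" for k
  proof -
    define h where "h = s / 2 ^ k"
    define l where "l = t / 2 ^ k"
    have a1: "Q k (s + t) u = (J (h + l) ^^ (2 ^ k)) u"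
      by (simp add: Q_def h_def l_def add_divide_distrib)
    have a2: "Q k s (Q k t u) = ((J h \<circ> J l) ^^ (2 ^ k)) u"
    proof -
      have "((J h \<circ> J l) ^^ (2 ^ k)) u = (J h ^^ (2 ^ k)) ((J l ^^ (2 ^ k)) u)"
        using contraction_J contraction_J J_commute uX by (rule funpow_comp_on)
      then show ?thesis
        by (simp only: Q_def h_def l_def)
    qed
    have b1: "nrm (((J h \<circ> J l) ^^ (2 ^ k)) u - (J (h + l) ^^ (2 ^ k)) u)
        \<le> real (2 ^ k) * nrm ((J h \<circ> J l) u - J (h + l) u)"
      using uX by (intro funpow_diff_le contraction_comp contraction_J) (auto simp: J_commute)
    have b2: "real (2 ^ k) * nrm ((J h \<circ> J l) u - J (h + l) u) \<le> real (2 ^ k) * (\<bar>h * l\<bar> * ?C)"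
      using J_step[of u h l] u by (intro mult_left_mono) auto
    have b3: "real (2 ^ k) * (\<bar>h * l\<bar> * ?C) = \<bar>s * t\<bar> * (1/2) ^ k * ?C"
      by (simp add: h_def l_def abs_mult field_simps)
    have 1: "nrm (Q k s (Q k t u) - Q k (s + t) u) \<le> \<bar>s * t\<bar> * (1/2) ^ k * ?C"
      unfolding a1 a2 b3[symmetric] using b1 b2 by (rule order_trans)
    have 2: "nrm (Q k s (Q k t u) - Q k s (U t u)) \<le> nrm (Q k t u - U t u)"
      using X by (intro contraction_diff_le contraction_Q) auto
    have "nrm (Q k (s + t) u - U s (U t u)) \<le> nrm (Q k (s + t) u - Q k s (Q k t u)) + nrm (Q k s (Q k t u) - U s (U t u))"
      using X by (intro nrm_triangle_mid) (auto simp: Q_contr U_lim)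
    also have "nrm (Q k s (Q k t u) - U s (U t u)) \<le> nrm (Q k s (Q k t u) - Q k s (U t u)) + nrm (Q k s (U t u) - U s (U t u))"
      using X by (intro nrm_triangle_mid) (auto simp: Q_contr U_lim)
    also have "nrm (Q k (s + t) u - Q k s (Q k t u)) = nrm (Q k s (Q k t u) - Q k (s + t) u)"
      using X by (intro nrm_diff_commute) (auto simp: Q_contr)
    finally show ?thesis using 1 2 by linarith
  qed
  note bound = this
  have "(\<lambda>k. \<bar>s * t\<bar> * (1/2) ^ k * ?C) \<longlonglongrightarrow> \<bar>s * t\<bar> * 0 * ?C"
    by (intro tendsto_intros LIMSEQ_power_zero) simp
  from tendsto_add[OF tendsto_add[OF this U_lim(2)[OF uX, of t]] U_lim(2)[OF X(2), of s t]]
  have lim: "(\<lambda>k. \<bar>s * t\<bar> * (1/2) ^ k * ?C + nrm (Q k t u - U t u) + nrm (Q k s (U t u) - U s (U t u))) \<longlonglongrightarrow> 0"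
    by simp
  show "(\<lambda>k. nrm (Q k (s + t) u - U s (U t u))) \<longlonglongrightarrow> 0"
    using X by (intro tendsto_sandwich[OF _ _ tendsto_const lim] always_eventually allI bound)
      (auto simp: U_lim)
qed (use u in \<open>auto simp: U_lim\<close>)

lemma U_add: "u \<in> X \<Longrightarrow> U (s + t) u = U s (U t u)"
  using contraction_eqI[of "U (s + t)" "U s \<circ> U t" u]
  by (simp add: contraction_U contraction_comp U_add_D2)

text \<open>The approximations are only contractions, but the limit is a contraction in both time
  directions, and \<open>U (- t)\<close> inverts \<open>U t\<close>.\<close>

lemma U_isometry: "u \<in> X \<Longrightarrow> nrm (U t u) = nrm u"
  using U_contr(2)[of u t] U_contr(2)[of "U t u" "- t"] U_add[of u "- t" t] U_zero[of u] U_lim(1)[of u t]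
  by simp

section \<open>The generator and its exact domain\<close>

lemma U_id_le:
  assumes u: "u \<in> D"
  shows "nrm (U t u - u) \<le> \<bar>t\<bar> * nrm (H u)"
proof (rule nrm_le_limI)
  show "(\<lambda>k. nrm (Q k t u - U t u)) \<longlonglongrightarrow> 0" using U_lim u by simp
  fix k
  have id_pow: "(id ^^ n) u = u" for n by (induction n) auto
  \<comment> \<open>Comparison with powers of the identity: 2^k steps, each displacing
    \<open>u\<close> by at most |t| / 2^k times nrm (H u).\<close>
  have "nrm ((J (t / 2 ^ k) ^^ (2 ^ k)) u - (id ^^ (2 ^ k)) u) \<le> real (2 ^ k) * nrm (J (t / 2 ^ k) u - id u)"
    using u by (intro funpow_diff_le contraction_id contraction_J) auto
  also have "\<dots> \<le> real (2 ^ k) * (\<bar>t / 2 ^ k\<bar> * nrm (H u))"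
    using J_id_le[OF u, of "t / 2 ^ k"] by (intro mult_left_mono) simp_all
  also have "\<dots> = \<bar>t\<bar> * nrm (H u)" by simp
  finally show "nrm (Q k t u - u) \<le> \<bar>t\<bar> * nrm (H u)"
    unfolding id_pow by (simp add: Q_def)
qed (use u in \<open>auto simp: Q_contr U_lim\<close>)

lemma U_continuous: "u \<in> X \<Longrightarrow> ((\<lambda>t. nrm (U t u - u)) \<longlongrightarrow> 0) (at 0)"
  by (rule contraction_continuous[OF contraction_U U_id_le])

text \<open>\<open>Q 0 t\<close> is the single resolvent \<open>J t\<close>, so the Euler error from
  level 0 is t^2/2, and the resolvent itself deviates from 1 - itH by t^2. The factor 2 rounds up
  3/2.\<close>

lemma U_second_order:
  assumes u: "u \<in> D2"
  shows "nrm (U t u - u + (\<i> * complex_of_real t) \<odot> H u) \<le> 2 * t\<^sup>2 * nrm (H (H u))"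
proof -
  let ?it = "\<i> * complex_of_real t"
  have 1: "nrm (U t u - J t u) \<le> t\<^sup>2 / 2 * nrm (H (H u))"
  proof (rule nrm_le_limI)
    show "(\<lambda>k. nrm (Q k t u - U t u)) \<longlonglongrightarrow> 0" using U_lim u by simp
    show "nrm (Q k t u - J t u) \<le> t\<^sup>2 / 2 * nrm (H (H u))" for k
      using Q_bound'[OF u, of 0 k t] by (simp add: Q_def)
  qed (use u in \<open>auto simp: Q_contr U_lim\<close>)
  have "J t u - u + ?it \<odot> H u = ?it \<odot> (H u - J t (H u))"
    using J_diff_id[of u t] u by (simp add: algebra_simps)
  also have "\<dots> = (?it * ?it) \<odot> J t (H (H u))"
    using J_diff_id[of "H u" t] u by simp
  finally have "nrm (J t u - u + ?it \<odot> H u) = t\<^sup>2 * nrm (J t (H (H u)))"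
    using u by (simp add: nrm_scale norm_mult power2_eq_square)
  also have "\<dots> \<le> t\<^sup>2 * nrm (H (H u))"
    using u by (intro mult_left_mono J_contr) auto
  finally have 2: "nrm (J t u - u + ?it \<odot> H u) \<le> t\<^sup>2 * nrm (H (H u))" .
  have 3: "nrm (U t u - u + ?it \<odot> H u) \<le> nrm (U t u - J t u) + nrm (J t u - u + ?it \<odot> H u)"
  proof -
    have "(U t u - J t u) + (J t u - u + ?it \<odot> H u) = U t u - u + ?it \<odot> H u"
      by (simp add: algebra_simps)
    moreover have "U t u - J t u \<in> X" "J t u - u + ?it \<odot> H u \<in> X"
      using u by (auto simp: U_lim)
    ultimately show ?thesis
      using nrm_triangle by metis
  qed
  have "0 \<le> t\<^sup>2 * nrm (H (H u))"
    using u by (intro mult_nonneg_nonneg nrm_nonneg) auto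
  with 1 2 3 show ?thesis by linarith
qed

text \<open>Approximation in graph norm: v = J r u lies in \<open>D2\<close>, and H (u - v) = H u -
  J r (H u) is small. The remainder u - v costs |t| nrm (H (u - v)) twice, once through
  \<open>U_id_le\<close> and once through the derivative term.\<close>

lemma U_derivative_D:
  assumes u: "u \<in> D"
  shows "((\<lambda>t. nrm ((1 / complex_of_real t) \<odot> (U t u - u) - (- \<i>) \<odot> H u)) \<longlongrightarrow> 0) (at 0)"
proof (rule tendstoI)
  fix e :: real assume e: "0 < e"
  obtain r where r: "r \<noteq> 0" "nrm (H u - J r (H u)) < e / 4"
    using J_approx[of "H u" "e / 4"] u e by auto
  define v where "v = J r u"
  have v: "v \<in> D2"
    using J_D2[OF u r(1)] by (simp add: v_def)
  have uv: "nrm (H (u - v)) < e / 4"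
    using r u by (simp add: v_def H_diff H_J)
  have "((\<lambda>t. 2 * \<bar>t\<bar> * nrm (H (H v))) \<longlongrightarrow> 2 * \<bar>0\<bar> * nrm (H (H v))) (at 0)"
    by (intro tendsto_intros)
  then have "\<forall>\<^sub>F t in at 0. 2 * \<bar>t\<bar> * nrm (H (H v)) < e / 2"
    by (rule order_tendstoD) (use e in simp)
  moreover have "\<forall>\<^sub>F t in at (0::real). t \<noteq> 0"
    by (simp add: eventually_at_filter)
  ultimately show "\<forall>\<^sub>F t in at 0. dist (nrm ((1 / complex_of_real t) \<odot> (U t u - u) - (- \<i>) \<odot> H u)) 0 < e"
  proof eventually_elim
    fix t :: real assume t: "2 * \<bar>t\<bar> * nrm (H (H v)) < e / 2" "t \<noteq> 0"
    let ?it = "\<i> * complex_of_real t"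
    have X: "U t u \<in> X" "U t v \<in> X" "U t (u - v) \<in> X"
      using u v by (auto simp: U_lim)
    define a where "a = U t (u - v) - (u - v)"
    define b where "b = ?it \<odot> H (u - v)"
    define c where "c = U t v - v + ?it \<odot> H v"
    have abc: "a \<in> X" "b \<in> X" "c \<in> X"
      using u v X by (auto simp: a_def b_def c_def)
    have sum: "U t u - u + ?it \<odot> H u = a + (b + c)"
      using u v by (simp add: a_def b_def c_def U_contr(5) H_diff scale_right_diff_distrib)
    have "nrm (a + (b + c)) \<le> nrm a + (nrm b + nrm c)"
      using nrm_triangle[of a "b + c"] nrm_triangle[of b c] abc by simp
    moreover have "nrm a \<le> \<bar>t\<bar> * nrm (H (u - v))"
      unfolding a_def using u v by (intro U_id_le) auto
    moreover have "nrm b = \<bar>t\<bar> * nrm (H (u - v))"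
      unfolding b_def using u v by (simp add: nrm_scale norm_mult)
    moreover have "nrm c \<le> 2 * t\<^sup>2 * nrm (H (H v))"
      unfolding c_def by (rule U_second_order[OF v])
    moreover have "t\<^sup>2 = \<bar>t\<bar> * \<bar>t\<bar>"
      by (simp add: power2_eq_square)
    ultimately have le: "nrm (U t u - u + ?it \<odot> H u)
        \<le> \<bar>t\<bar> * (2 * nrm (H (u - v)) + 2 * \<bar>t\<bar> * nrm (H (H v)))"
      unfolding sum by (simp add: algebra_simps)
    have "(1 / complex_of_real t) \<odot> (U t u - u) - (- \<i>) \<odot> H u = (1 / complex_of_real t) \<odot> (U t u - u + ?it \<odot> H u)"
      using t by (simp add: scale_right_distrib)
    then have "nrm ((1 / complex_of_real t) \<odot> (U t u - u) - (- \<i>) \<odot> H u) = nrm (U t u - u + ?it \<odot> H u) / \<bar>t\<bar>"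
      using u X by (simp add: nrm_scale norm_divide)
    also have "\<dots> \<le> 2 * nrm (H (u - v)) + 2 * \<bar>t\<bar> * nrm (H (H v))"
      using le t by (simp add: divide_le_eq mult.commute)
    also have "\<dots> < e"
      using uv t by linarith
    finally show "dist (nrm ((1 / complex_of_real t) \<odot> (U t u - u) - (- \<i>) \<odot> H u)) 0 < e"
      using u X by simp
  qed
qed

lemma U_adjoint: "\<lbrakk>x \<in> X; y \<in> X\<rbrakk> \<Longrightarrow> ip (U t x) y = ip x (U (- t) y)"
  using ip_isometry[of "U t" x "U (- t) y", OF U_contr(1) U_isometry U_contr(3)]
    U_add[of y t "- t"] U_zero[of y] by (simp add: U_contr(1))

text \<open>The generator cannot have a larger domain: differentiating ip (U t v) u = ip v (U (- t)
  u) at 0 for \<open>v\<close> in \<open>D\<close> shows that \<open>u\<close> satisfies the adjoint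
  relation with value \<open>\<i> \<odot> f\<close>, and \<open>H\<close> equals its
  adjoint.\<close>

lemma U_derivative_imp_D:
  assumes u: "u \<in> X" and f: "f \<in> X"
    and lim: "((\<lambda>t. nrm ((1 / complex_of_real t) \<odot> (U t u - u) - f)) \<longlongrightarrow> 0) (at 0)"
  shows "u \<in> D \<and> f = (- \<i>) \<odot> H u"
proof -
  have "ip (H v) u = ip v (\<i> \<odot> f)" if v: "v \<in> D" for v
  proof -
    have vX: "v \<in> X" "H v \<in> X" using v by auto
    have 1: "((\<lambda>t. ip ((1 / complex_of_real t) \<odot> (U t v - v)) u) \<longlongrightarrow> ip ((- \<i>) \<odot> H v) u) (at 0)"
      using U_derivative_D[OF v] u vX by (intro tendsto_ip) (auto simp: U_lim)
    have "filterlim uminus (at (0::real)) (at 0)"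
      by (simp add: filterlim_def filtermap_at_minus)
    from filterlim_compose[OF lim this]
    have "((\<lambda>t. nrm ((1 / complex_of_real (- t)) \<odot> (U (- t) u - u) - f)) \<longlongrightarrow> 0) (at 0)" .
    then have 2: "((\<lambda>t. ip v ((1 / complex_of_real (- t)) \<odot> (U (- t) u - u))) \<longlongrightarrow> ip v f) (at 0)"
      using u f vX by (intro tendsto_ip) (auto simp: U_lim)
    have "ip ((1 / complex_of_real t) \<odot> (U t v - v)) u = - ip v ((1 / complex_of_real (- t)) \<odot> (U (- t) u - u))" for t
      using u vX U_adjoint[of v u t] ip_scale_right[of "U (- t) u - u" v "1 / complex_of_real (- t)"]
      by (simp add: ip_scale_left ip_diff_left ip_diff_right U_lim)
    then have "((\<lambda>t. ip ((1 / complex_of_real t) \<odot> (U t v - v)) u) \<longlongrightarrow> - ip v f) (at 0)"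
      using tendsto_minus[OF 2] by simp
    then have "ip ((- \<i>) \<odot> H v) u = - ip v f"
      using 1 tendsto_unique[of "at (0::real)"] by auto
    then have "\<i> * ip (H v) u = ip v f"
      using u vX ip_scale_left[of "H v" u "- \<i>"] by simp
    moreover have "ip (H v) u = - \<i> * (\<i> * ip (H v) u)"
      by simp
    ultimately have "ip (H v) u = - \<i> * ip v f"
      by (simp only:)
    then show ?thesis
      using f vX by (simp add: ip_scale_right)
  qed
  then have "u \<in> D \<and> H u = \<i> \<odot> f"
    using H_self_adjoint[of u "\<i> \<odot> f"] u f by simp
  then show ?thesis by simp
qed

end

section \<open>\<open>L\<^sup>2\<close> as a Hilbert space\<close>

definition fscale :: "complex \<Rightarrow> ('a \<Rightarrow> complex) \<Rightarrow> 'a \<Rightarrow> complex" where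
  "fscale c f = (\<lambda>x. c * f x)"

lemma fscale_apply [simp]: "fscale c f x = c * f x"
  by (simp add: fscale_def)

interpretation fun_space: vector_space fscale
  by unfold_locales (auto simp: fun_eq_iff algebra_simps)

text \<open>Composing with a projection that kills the null functions turns equality almost everywhere
  into equality, so that the abstract theory applies to a complement of the null functions.\<close>

lemma (in vector_space) exists_projection_along:
  assumes N: "subspace N"
  obtains P where "\<And>x y. P (x + y) = P x + P y" "\<And>c x. P (scale c x) = scale c (P x)"
    "\<And>x. P x - x \<in> N" "\<And>x. x \<in> N \<Longrightarrow> P x = 0"
proof -
  obtain B where B: "B \<subseteq> N" "independent B" "N \<subseteq> span B"
    using maximal_independent_subset[of N] by blast
  have "independent (extend_basis B)" "B \<subseteq> extend_basis B" "span (extend_basis B) = UNIV"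
    using independent_extend_basis[OF B(2)] extend_basis_superset[OF B(2)] span_extend_basis[OF B(2)] by auto
  note C = this
  interpret vector_space_pair scale scale ..
  \<comment> \<open>\<open>P\<close> kills a basis of \<open>N\<close> and fixes the other vectors
    of an extended basis, so it moves every vector by an element of \<open>N\<close>.\<close>
  obtain P where P: "Vector_Spaces.linear scale scale P" "\<forall>x\<in>extend_basis B. P x = (if x \<in> B then 0 else x)"
    using linear_independent_extend[OF C(1), of "\<lambda>x. if x \<in> B then 0 else x"] by blast
  interpret P: Vector_Spaces.linear scale scale P by (rule P(1))
  have "P x - x \<in> N" for x
  proof -
    have "x \<in> span (extend_basis B)" using C(3) by simp
    then show ?thesis
    proof (induction rule: span_induct_alt)
      case base
      then show ?case using N by (simp add: P.zero subspace_0)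
    next
      case (step c x y)
      have "P x - x \<in> N"
        using P(2) step(1) B(1) N by (auto simp: subspace_0 subspace_neg)
      then have "scale c (P x - x) + (P y - y) \<in> N"
        using N step(2) by (intro subspace_add subspace_scale)
      then show ?case
        by (simp add: P.add P.scale scale_right_diff_distrib algebra_simps)
    qed
  qed
  moreover have "P x = 0" if "x \<in> N" for x
  proof -
    have "x \<in> span B" using that B(3) by blast
    then show ?thesis
    proof (induction rule: span_induct_alt)
      case (step c x y)
      then show ?case using P(2) C(2) by (auto simp: P.add P.scale)
    qed (simp add: P.zero)
  qed
  ultimately show ?thesis
    using that[of P] P.add P.scale by blast
qed

lemma L2_iff: "u \<in> L2 \<mu> \<longleftrightarrow> u \<in> borel_measurable \<mu> \<and> integrable \<mu> (\<lambda>x. (cmod (u x))\<^sup>2)"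
proof (cases "u \<in> borel_measurable \<mu>")
  case True
  then have "Lp_norm \<mu> 2 u < \<infinity> \<longleftrightarrow> integrable \<mu> (\<lambda>x. (cmod (u x))\<^sup>2)"
    by (auto simp: Lp_norm_def Let_def integrable_iff_bounded top.not_eq_extremum)
  then show ?thesis by (simp add: L2_def)
qed (simp add: L2_def)

lemma borel_measurable_cnj [measurable (raw)]:
  "f \<in> borel_measurable M \<Longrightarrow> (\<lambda>x. cnj (f x)) \<in> borel_measurable M"
  by (rule borel_measurable_continuous_on[of cnj]) (auto intro: continuous_intros)

lemma L2_mult_cnj_integrable:
  assumes u: "u \<in> L2 \<mu>" and v: "v \<in> L2 \<mu>"
  shows "integrable \<mu> (\<lambda>x. u x * cnj (v x))"
proof (rule Bochner_Integration.integrable_bound)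
  show "integrable \<mu> (\<lambda>x. (cmod (u x))\<^sup>2 + (cmod (v x))\<^sup>2)"
    using u v by (auto simp: L2_iff)
  show "(\<lambda>x. u x * cnj (v x)) \<in> borel_measurable \<mu>"
    using u v by (auto simp: L2_iff)
  have "a * b \<le> a\<^sup>2 + b\<^sup>2" if "0 \<le> a" "0 \<le> b" for a b :: real
    using sum_squares_bound[of a b] mult_nonneg_nonneg[OF that] by linarith
  then show "AE x in \<mu>. norm (u x * cnj (v x)) \<le> norm ((cmod (u x))\<^sup>2 + (cmod (v x))\<^sup>2)"
    by (auto simp: norm_mult)
qed

lemma L2_add:
  assumes u: "u \<in> L2 \<mu>" and v: "v \<in> L2 \<mu>"
  shows "u + v \<in> L2 \<mu>"
proof -
  have "integrable \<mu> (\<lambda>x. (cmod (u x + v x))\<^sup>2)"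
  proof (rule Bochner_Integration.integrable_bound)
    show "integrable \<mu> (\<lambda>x. 2 * (cmod (u x))\<^sup>2 + 2 * (cmod (v x))\<^sup>2)"
      using u v by (auto simp: L2_iff)
    show "(\<lambda>x. (cmod (u x + v x))\<^sup>2) \<in> borel_measurable \<mu>"
      using u v by (auto simp: L2_iff)
    have "(cmod (a + b))\<^sup>2 \<le> 2 * (cmod a)\<^sup>2 + 2 * (cmod b)\<^sup>2" for a b
    proof -
      have "(cmod (a + b))\<^sup>2 \<le> (cmod a + cmod b)\<^sup>2"
        by (intro power_mono norm_triangle_ineq) auto
      also have "\<dots> \<le> 2 * (cmod a)\<^sup>2 + 2 * (cmod b)\<^sup>2"
        using sum_squares_bound[of "cmod a" "cmod b"] by (simp add: power2_sum)
      finally show ?thesis .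
    qed
    then show "AE x in \<mu>. norm ((cmod (u x + v x))\<^sup>2) \<le> norm (2 * (cmod (u x))\<^sup>2 + 2 * (cmod (v x))\<^sup>2)"
      by auto
  qed
  then show ?thesis
    using u v by (auto simp: L2_iff plus_fun_def)
qed

lemma L2_fscale: "u \<in> L2 \<mu> \<Longrightarrow> fscale c u \<in> L2 \<mu>"
  by (auto simp: L2_iff fscale_def norm_mult power_mult_distrib)

interpretation l2: semi_inner_space fscale "L2 \<mu>" "L2_inner \<mu>" for \<mu> :: "'a measure"
proof unfold_locales
  have "0 \<in> L2 \<mu>"
    by (simp add: L2_iff zero_fun_def)
  then show "fun_space.subspace (L2 \<mu>)"
    by (rule fun_space.subspaceI) (auto intro: L2_add L2_fscale)
next
  fix x y z :: "'a \<Rightarrow> complex" and c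
  assume "x \<in> L2 \<mu>" "y \<in> L2 \<mu>" "z \<in> L2 \<mu>"
  then show "L2_inner \<mu> (x + y) z = L2_inner \<mu> x z + L2_inner \<mu> y z"
    using L2_mult_cnj_integrable[of x \<mu> z] L2_mult_cnj_integrable[of y \<mu> z]
    by (simp add: L2_inner_def distrib_right)
next
  fix x z :: "'a \<Rightarrow> complex" and c
  show "L2_inner \<mu> (fscale c x) z = c * L2_inner \<mu> x z"
    by (simp add: L2_inner_def mult.assoc)
next
  fix x y :: "'a \<Rightarrow> complex"
  show "L2_inner \<mu> x y = cnj (L2_inner \<mu> y x)"
    unfolding L2_inner_def using Bochner_Integration.integral_cnj[of \<mu> "\<lambda>a. y a * cnj (x a)"] by (simp add: mult.commute)
next
  fix x :: "'a \<Rightarrow> complex"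
  assume "x \<in> L2 \<mu>"
  have "L2_inner \<mu> x x = (\<integral>y. complex_of_real ((cmod (x y))\<^sup>2) \<partial>\<mu>)"
    unfolding L2_inner_def by (intro Bochner_Integration.integral_cong refl) (simp only: complex_norm_square)
  then show "0 \<le> Re (L2_inner \<mu> x x)"
    by (simp only: integral_complex_of_real Re_complex_of_real) simp
qed

lemma L2_nrm_sq: "(l2.nrm \<mu> u)\<^sup>2 = (\<integral>x. (cmod (u x))\<^sup>2 \<partial>\<mu>)"
proof -
  have "L2_inner \<mu> u u = (\<integral>x. complex_of_real ((cmod (u x))\<^sup>2) \<partial>\<mu>)"
    unfolding L2_inner_def by (intro Bochner_Integration.integral_cong refl) (simp only: complex_norm_square)
  then show ?thesis
    unfolding l2.nrm_def by (simp only: integral_complex_of_real Re_complex_of_real) simp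
qed

lemma L2_nn_integral: "u \<in> L2 \<mu> \<Longrightarrow> (\<integral>\<^sup>+x. ennreal ((cmod (u x))\<^sup>2) \<partial>\<mu>) = ennreal ((l2.nrm \<mu> u)\<^sup>2)"
  unfolding L2_nrm_sq by (intro nn_integral_eq_integral) (auto simp: L2_iff)

lemma Lp_norm_2: "u \<in> L2 \<mu> \<Longrightarrow> Lp_norm \<mu> 2 u = ennreal (l2.nrm \<mu> u)"
  by (simp add: Lp_norm_def Let_def L2_nn_integral powr_half_sqrt del: ennreal_power)

lemma L2_nrm_eq_0_iff: "u \<in> L2 \<mu> \<Longrightarrow> l2.nrm \<mu> u = 0 \<longleftrightarrow> (AE x in \<mu>. u x = 0)"
proof -
  assume u: "u \<in> L2 \<mu>"
  have "l2.nrm \<mu> u = 0 \<longleftrightarrow> (\<integral>x. (cmod (u x))\<^sup>2 \<partial>\<mu>) = 0"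
    unfolding L2_nrm_sq[symmetric] by simp
  also have "\<dots> \<longleftrightarrow> (AE x in \<mu>. (cmod (u x))\<^sup>2 = 0)"
    using u by (intro integral_nonneg_eq_0_iff_AE) (auto simp: L2_iff)
  finally show ?thesis by simp
qed

lemma L2_nrm_cong_AE: "\<lbrakk>u \<in> L2 \<mu>; v \<in> L2 \<mu>; AE x in \<mu>. u x = v x\<rbrakk> \<Longrightarrow> l2.nrm \<mu> u = l2.nrm \<mu> v"
proof -
  assume *: "u \<in> L2 \<mu>" "v \<in> L2 \<mu>" "AE x in \<mu>. u x = v x"
  have "l2.nrm \<mu> (u - v) = 0"
    using * by (subst L2_nrm_eq_0_iff) auto
  then show ?thesis
    using l2.nrm_diff_abs[of u \<mu> v] * by simp
qed

lemma L2_inner_cong_AE: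
  assumes "u \<in> L2 \<mu>" "v \<in> L2 \<mu>" "u' \<in> L2 \<mu>" "v' \<in> L2 \<mu>"
    "AE x in \<mu>. u x = u' x" "AE x in \<mu>. v x = v' x"
  shows "L2_inner \<mu> u v = L2_inner \<mu> u' v'"
  unfolding L2_inner_def
proof (rule integral_cong_AE)
  show "AE x in \<mu>. u x * cnj (v x) = u' x * cnj (v' x)"
    using assms(5,6) by eventually_elim simp
qed (use assms in \<open>auto simp: L2_iff\<close>)

text \<open>Riesz-Fischer: a rapidly Cauchy subsequence converges almost everywhere, and Fatou's
  lemma upgrades this to norm convergence of the whole sequence.\<close>

lemma L2_complete:
  fixes s :: "nat \<Rightarrow> 'a \<Rightarrow> complex"
  assumes s: "\<And>n. s n \<in> L2 \<mu>"
    and cauchy: "\<And>e. 0 < e \<Longrightarrow> \<exists>N. \<forall>m\<ge>N. \<forall>n\<ge>N. l2.nrm \<mu> (s m - s n) < e"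
  shows "\<exists>l\<in>L2 \<mu>. (\<lambda>n. l2.nrm \<mu> (s n - l)) \<longlonglongrightarrow> 0"
proof -
  have [measurable]: "s n \<in> borel_measurable \<mu>" for n
    using s by (auto simp: L2_iff)
  have "\<forall>k. \<exists>N. \<forall>m\<ge>N. \<forall>n\<ge>N. l2.nrm \<mu> (s m - s n) < (1/4)^k"
    using cauchy by simp
  then obtain N where N: "\<And>k m n. \<lbrakk>N k \<le> m; N k \<le> n\<rbrakk> \<Longrightarrow> l2.nrm \<mu> (s m - s n) < (1/4)^k"
    by metis
  \<comment> \<open>The sum makes \<open>r\<close> monotone and at least \<open>N k\<close>; the
    summand k makes it unbounded.\<close>
  define r where "r k = k + (\<Sum>i\<le>k. N i)" for k
  have r_N: "N k \<le> r k" for k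
    unfolding r_def by (rule trans_le_add2) (rule member_le_sum, auto)
  have r_Suc: "r k \<le> r (Suc k)" and r_id: "k \<le> r k" for k
    by (auto simp: r_def)
  define f where "f k = s (r k)" for k
  define d where "d k = f (Suc k) - f k" for k
  have [measurable]: "f k \<in> borel_measurable \<mu>" for k by (simp add: f_def)
  have dL: "d k \<in> L2 \<mu>" for k using s by (simp add: d_def f_def)
  have [measurable]: "d k \<in> borel_measurable \<mu>" for k using dL by (auto simp: L2_iff)
  have d: "l2.nrm \<mu> (d k) \<le> (1/4)^k" for k
    unfolding d_def f_def using N[of k "r (Suc k)" "r k"] r_N[of k] r_Suc[of k] by simp
  \<comment> \<open>The weight 4^k is a compromise. The squared norms are at most 16^(-k), so the
    weighted integrals still sum up, and a finite weighted sum at x forces |d_k(x)| to be at most a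
    constant times 2^(-k), hence summable.\<close>
  have "(\<integral>\<^sup>+x. (\<Sum>k. ennreal (4^k * (cmod (d k x))\<^sup>2)) \<partial>\<mu>) = (\<Sum>k. \<integral>\<^sup>+x. ennreal (4^k * (cmod (d k x))\<^sup>2) \<partial>\<mu>)"
    by (intro nn_integral_suminf) measurable
  also have "\<dots> \<le> (\<Sum>k. ennreal ((1/4)^k))"
  proof (intro suminf_le allI)
    fix k
    have "(\<integral>\<^sup>+x. ennreal (4^k * (cmod (d k x))\<^sup>2) \<partial>\<mu>) = ennreal (4^k) * (\<integral>\<^sup>+x. ennreal ((cmod (d k x))\<^sup>2) \<partial>\<mu>)"
      by (subst nn_integral_cmult[symmetric]) (auto simp: ennreal_mult)
    also have "\<dots> = ennreal (4^k * (l2.nrm \<mu> (d k))\<^sup>2)"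
      by (subst L2_nn_integral[OF dL]) (simp add: ennreal_mult)
    also have "\<dots> \<le> ennreal ((1/4)^k)"
    proof (rule ennreal_leI)
      have "(l2.nrm \<mu> (d k))\<^sup>2 \<le> ((1/4)^k)\<^sup>2"
        using d dL by (intro power_mono) auto
      then have "4^k * (l2.nrm \<mu> (d k))\<^sup>2 \<le> 4^k * ((1/4)^k)\<^sup>2"
        by (intro mult_left_mono) auto
      also have "\<dots> = (1/4)^k"
        by (simp add: power2_eq_square power_divide)
      finally show "4^k * (l2.nrm \<mu> (d k))\<^sup>2 \<le> (1/4)^k" .
    qed
    finally show "(\<integral>\<^sup>+x. ennreal (4^k * (cmod (d k x))\<^sup>2) \<partial>\<mu>) \<le> ennreal ((1/4)^k)" .
  qed auto
  also have "\<dots> = ennreal (\<Sum>k. (1/4)^k)"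
    by (intro suminf_ennreal2) (auto intro: summable_geometric)
  also have "\<dots> < \<infinity>" by simp
  finally have "AE x in \<mu>. (\<Sum>k. ennreal (4^k * (cmod (d k x))\<^sup>2)) \<noteq> \<infinity>"
    by (intro nn_integral_PInf_AE) (auto simp: top.not_eq_extremum)
  then have conv: "AE x in \<mu>. convergent (\<lambda>k. f k x)"
  proof eventually_elim
    fix x assume fin: "(\<Sum>k. ennreal (4^k * (cmod (d k x))\<^sup>2)) \<noteq> \<infinity>"
    define C where "C = enn2real (\<Sum>k. ennreal (4^k * (cmod (d k x))\<^sup>2))"
    have C: "0 \<le> C" "(\<Sum>k. ennreal (4^k * (cmod (d k x))\<^sup>2)) = ennreal C"
      using fin by (simp_all only: C_def enn2real_nonneg ennreal_enn2real top.not_eq_extremum infinity_ennreal_def)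
    have "cmod (d k x) \<le> sqrt C * (1/2)^k" for k
    proof -
      have "(\<Sum>i\<in>{k}. ennreal (4^i * (cmod (d i x))\<^sup>2)) \<le> (\<Sum>k. ennreal (4^k * (cmod (d k x))\<^sup>2))"
        by (rule sum_le_suminf) auto
      then have "ennreal (4^k * (cmod (d k x))\<^sup>2) \<le> ennreal C"
        unfolding C(2) by simp
      then have "4^k * (cmod (d k x))\<^sup>2 \<le> C"
        using C(1) by (simp add: ennreal_le_iff)
      then have "sqrt (4^k * (cmod (d k x))\<^sup>2) \<le> sqrt C" by simp
      moreover have "sqrt (4^k * (cmod (d k x))\<^sup>2) = 2^k * cmod (d k x)"
        by (simp add: real_sqrt_mult real_sqrt_power)
      ultimately show ?thesis
        by (simp add: field_simps power_divide)
    qed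
    moreover have "summable (\<lambda>k. sqrt C * (1/2)^k)"
      by (rule summable_mult[OF summable_geometric]) simp
    ultimately have "summable (\<lambda>k. d k x)"
      using summable_comparison_test'[of "\<lambda>k. sqrt C * (1/2)^k" 0 "\<lambda>k. d k x"] by blast
    then have "convergent (\<lambda>k. \<Sum>i<k. d i x)"
      by (simp add: summable_iff_convergent)
    moreover have "(\<Sum>i<k. d i x) = f k x - f 0 x" for k
      using sum_lessThan_telescope[of "\<lambda>k. f k x" k] by (simp add: d_def)
    ultimately show "convergent (\<lambda>k. f k x)"
      by (simp add: convergent_diff_const_right_iff)
  qed
  define l where "l x = lim (\<lambda>k. f k x)" for x
  have [measurable]: "l \<in> borel_measurable \<mu>"
    unfolding l_def by (intro borel_measurable_lim_metric) simp
  have lim: "AE x in \<mu>. (\<lambda>k. f k x) \<longlonglongrightarrow> l x"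
    using conv by eventually_elim (simp add: l_def convergent_LIMSEQ_iff)
  \<comment> \<open>Fatou along the subsequence \<open>f\<close>: the assumed bound holds for s m -
    s n at all late n, in particular at n = r k, and passes to the limit function.\<close>
  have bound: "(\<integral>\<^sup>+x. ennreal ((cmod (s m x - l x))\<^sup>2) \<partial>\<mu>) \<le> ennreal (e\<^sup>2)"
    if e: "\<And>n. M \<le> n \<Longrightarrow> l2.nrm \<mu> (s m - s n) \<le> e" for m M e
  proof -
    have "(\<integral>\<^sup>+x. ennreal ((cmod (s m x - l x))\<^sup>2) \<partial>\<mu>)
        = (\<integral>\<^sup>+x. liminf (\<lambda>k. ennreal ((cmod (s m x - f k x))\<^sup>2)) \<partial>\<mu>)"
    proof (rule nn_integral_cong_AE)
      show "AE x in \<mu>. ennreal ((cmod (s m x - l x))\<^sup>2) = liminf (\<lambda>k. ennreal ((cmod (s m x - f k x))\<^sup>2))"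
        using lim
      proof eventually_elim
        fix x assume "(\<lambda>k. f k x) \<longlonglongrightarrow> l x"
        then have "(\<lambda>k. ennreal ((cmod (s m x - f k x))\<^sup>2)) \<longlonglongrightarrow> ennreal ((cmod (s m x - l x))\<^sup>2)"
          by (intro tendsto_intros)
        then show "ennreal ((cmod (s m x - l x))\<^sup>2) = liminf (\<lambda>k. ennreal ((cmod (s m x - f k x))\<^sup>2))"
          by (rule lim_imp_Liminf[OF sequentially_bot, symmetric])
      qed
    qed
    also have "\<dots> \<le> liminf (\<lambda>k. \<integral>\<^sup>+x. ennreal ((cmod (s m x - f k x))\<^sup>2) \<partial>\<mu>)"
      by (intro nn_integral_liminf) measurable
    also have "\<dots> \<le> limsup (\<lambda>k. \<integral>\<^sup>+x. ennreal ((cmod (s m x - f k x))\<^sup>2) \<partial>\<mu>)"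
      by (intro Liminf_le_Limsup) simp
    also have "\<dots> \<le> ennreal (e\<^sup>2)"
    proof (rule Limsup_bounded)
      show "\<forall>\<^sub>F k in sequentially. (\<integral>\<^sup>+x. ennreal ((cmod (s m x - f k x))\<^sup>2) \<partial>\<mu>) \<le> ennreal (e\<^sup>2)"
        using eventually_ge_at_top[of M]
      proof eventually_elim
        fix k assume "M \<le> k"
        have "(\<integral>\<^sup>+x. ennreal ((cmod (s m x - f k x))\<^sup>2) \<partial>\<mu>) = ennreal ((l2.nrm \<mu> (s m - f k))\<^sup>2)"
          using L2_nn_integral[of "s m - f k" \<mu>] s by (simp add: f_def)
        also have "\<dots> \<le> ennreal (e\<^sup>2)"
          using e[of "r k"] \<open>M \<le> k\<close> r_id[of k] s by (intro ennreal_leI power_mono) (auto simp: f_def)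
        finally show "(\<integral>\<^sup>+x. ennreal ((cmod (s m x - f k x))\<^sup>2) \<partial>\<mu>) \<le> ennreal (e\<^sup>2)" .
      qed
    qed
    finally show ?thesis .
  qed
  have diffL: "s m - l \<in> L2 \<mu>" and le: "0 \<le> e \<Longrightarrow> l2.nrm \<mu> (s m - l) \<le> e"
    if e: "\<And>n. M \<le> n \<Longrightarrow> l2.nrm \<mu> (s m - s n) \<le> e" for m M e
  proof -
    have fin: "(\<integral>\<^sup>+x. ennreal ((cmod (s m x - l x))\<^sup>2) \<partial>\<mu>) < \<infinity>"
      using bound[OF e] by (rule order_le_less_trans) auto
    then show L: "s m - l \<in> L2 \<mu>"
      by (auto simp: L2_iff integrable_iff_bounded fun_diff_def)
    assume "0 \<le> e"
    have "ennreal ((l2.nrm \<mu> (s m - l))\<^sup>2) \<le> ennreal (e\<^sup>2)"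
      using bound[OF e] L2_nn_integral[OF L] by simp
    then have "(l2.nrm \<mu> (s m - l))\<^sup>2 \<le> e\<^sup>2"
      by (simp add: ennreal_le_iff)
    then show "l2.nrm \<mu> (s m - l) \<le> e"
      using \<open>0 \<le> e\<close> by (rule power2_le_imp_le)
  qed
  have "\<exists>M. \<forall>m\<ge>M. \<forall>n\<ge>M. l2.nrm \<mu> (s m - s n) \<le> e" if "0 < e" for e
    using cauchy[OF that] by (meson less_imp_le)
  note cauchy_le = this
  obtain M1 where "\<forall>n\<ge>M1. l2.nrm \<mu> (s M1 - s n) \<le> 1"
    using cauchy_le[of 1] by auto
  then have "s M1 - l \<in> L2 \<mu>"
    using diffL[of M1 M1 1] by blast
  then have "s M1 - (s M1 - l) \<in> L2 \<mu>"
    using s by blast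
  then have lL: "l \<in> L2 \<mu>" by simp
  have "(\<lambda>n. l2.nrm \<mu> (s n - l)) \<longlonglongrightarrow> 0"
  proof (rule LIMSEQ_I)
    fix e :: real assume e: "0 < e"
    obtain M where M: "\<forall>m\<ge>M. \<forall>n\<ge>M. l2.nrm \<mu> (s m - s n) \<le> e / 2"
      using cauchy_le[of "e / 2"] e by auto
    have "norm (l2.nrm \<mu> (s n - l) - 0) < e" if "M \<le> n" for n
      using le[of M n "e / 2"] M that e l2.nrm_nonneg[of "s n - l" \<mu>] s lL by auto
    then show "\<exists>no. \<forall>n\<ge>no. norm (l2.nrm \<mu> (s n - l) - 0) < e" by blast
  qed
  with lL show ?thesis by blast
qed

section \<open>Stone's theorem in \<open>L\<^sup>2\<close>\<close>

lemma Lp_norm_diff: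
  assumes "u \<in> L2 \<mu>" "v \<in> L2 \<mu>"
  shows "Lp_norm \<mu> 2 (\<lambda>x. u x - v x) = ennreal (l2.nrm \<mu> (u - v))"
proof -
  have "u - v \<in> L2 \<mu>" using assms by blast
  moreover have "(\<lambda>x. u x - v x) = u - v" by (rule fun_diff_def[symmetric])
  ultimately show ?thesis by (simp only: Lp_norm_2)
qed

lemma fun_lincomb_eq: "(\<lambda>x. a * u x + b * v x) = fscale a u + fscale b v"
  by (simp add: fun_eq_iff)

lemma tendsto_ennreal_0_iff:
  "(\<And>x. 0 \<le> f x) \<Longrightarrow> ((\<lambda>x. ennreal (f x)) \<longlongrightarrow> 0) F \<longleftrightarrow> (f \<longlongrightarrow> 0) F"
  using tendsto_ennreal_iff[of f F 0] by simp

section \<open>One representative per class of functions equal almost everywhere\<close>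

locale L2_projection =
  fixes \<mu> :: "'a measure" and P :: "('a \<Rightarrow> complex) \<Rightarrow> 'a \<Rightarrow> complex"
  assumes P_add: "P (u + v) = P u + P v" and P_scale: "P (fscale c u) = fscale c (P u)"
    and P_AE_range: "P u - u \<in> {w \<in> L2 \<mu>. AE x in \<mu>. w x = 0}"
    and P_null: "\<lbrakk>w \<in> L2 \<mu>; AE x in \<mu>. w x = 0\<rbrakk> \<Longrightarrow> P w = 0"
begin

lemma P_zero: "P 0 = 0"
  using P_add[of 0 0] by simp

lemma P_diff: "P (u - v) = P u - P v"
  using P_add[of "u - v" v] by (simp add: algebra_simps)

lemma P_AE: "AE x in \<mu>. P u x = u x"
  using P_AE_range[of u] by simp

lemma P_L2 [simp]: "u \<in> L2 \<mu> \<Longrightarrow> P u \<in> L2 \<mu>"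
  using P_AE_range[of u] l2.X_closed(2)[of "P u - u" \<mu> u] by simp

lemma P_eq_iff: "\<lbrakk>u \<in> L2 \<mu>; v \<in> L2 \<mu>\<rbrakk> \<Longrightarrow> P u = P v \<longleftrightarrow> (AE x in \<mu>. u x = v x)"
proof
  assume "P u = P v"
  then show "AE x in \<mu>. u x = v x"
    using P_AE[of u] P_AE[of v] by auto
next
  assume "u \<in> L2 \<mu>" "v \<in> L2 \<mu>" "AE x in \<mu>. u x = v x"
  then have "P (u - v) = 0"
    by (intro P_null) auto
  then show "P u = P v" by (simp add: P_diff)
qed

lemma P_idem: "P (P u) = P u"
  using P_null[of "P u - u"] P_AE_range[of u] P_diff[of "P u" u] by simp

text \<open>A copy of the quotient of L^2 by the null functions: by \<open>P_eq_iff\<close> it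
  contains exactly one function from each class, so \<open>nrm\<close> is definite on it.\<close>

definition R :: "('a \<Rightarrow> complex) set" where "R = P ` L2 \<mu>"

lemma R_L2 [simp]: "u \<in> R \<Longrightarrow> u \<in> L2 \<mu>" by (auto simp: R_def)
lemma P_R [simp]: "u \<in> L2 \<mu> \<Longrightarrow> P u \<in> R" by (auto simp: R_def)
lemma P_fix [simp]: "u \<in> R \<Longrightarrow> P u = u" by (auto simp: R_def P_idem)

lemma nrm_P: "u \<in> L2 \<mu> \<Longrightarrow> l2.nrm \<mu> (P u) = l2.nrm \<mu> u"
  by (rule L2_nrm_cong_AE) (auto intro: P_AE)

lemma hilbert_subspace_R: "hilbert_subspace fscale R (L2_inner \<mu>)"
proof -
  have sub: "fun_space.subspace R"
  proof (rule fun_space.subspaceI)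
    show "0 \<in> R" using P_R[of 0] P_zero by simp
    show "x + y \<in> R" if "x \<in> R" "y \<in> R" for x y
      using that P_R[of "x + y"] by (simp add: P_add)
    show "fscale c x \<in> R" if "x \<in> R" for c x
      using that P_R[of "fscale c x"] by (simp add: P_scale)
  qed
  interpret semi: semi_inner_space fscale R "L2_inner \<mu>"
    using sub by unfold_locales (auto intro: l2.ip_add_left l2.ip_scale_left l2.ip_commute l2.ip_nonneg)
  show ?thesis
  proof unfold_locales
    fix x assume x: "x \<in> R" "l2.nrm \<mu> x = 0"
    then have "P x = 0"
      by (intro P_null) (simp_all flip: L2_nrm_eq_0_iff)
    then show "x = 0" using x by simp
  next
    fix s :: "nat \<Rightarrow> 'a \<Rightarrow> complex"
    assume s: "\<And>n. s n \<in> R"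
      and cauchy: "\<And>e. 0 < e \<Longrightarrow> \<exists>N. \<forall>m\<ge>N. \<forall>n\<ge>N. l2.nrm \<mu> (s m - s n) < e"
    obtain l where l: "l \<in> L2 \<mu>" "(\<lambda>n. l2.nrm \<mu> (s n - l)) \<longlonglongrightarrow> 0"
      using L2_complete[of s \<mu>] s cauchy by auto
    have "l2.nrm \<mu> (s n - P l) = l2.nrm \<mu> (s n - l)" for n
      using nrm_P[of "s n - l"] s l(1) by (simp add: P_diff)
    then show "\<exists>l\<in>R. (\<lambda>n. l2.nrm \<mu> (s n - l)) \<longlonglongrightarrow> 0"
      using l by (intro bexI[of _ "P l"]) auto
  qed
qed

end

lemma exists_L2_projection:
  obtains P where "L2_projection \<mu> P"
proof -
  have "fun_space.subspace {w \<in> L2 \<mu>. AE x in \<mu>. w x = 0}"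
    by (rule fun_space.subspaceI) (auto intro: L2_add L2_fscale)
  then obtain P where "\<And>x y. P (x + y) = P x + P y" "\<And>c x. P (fscale c x) = fscale c (P x)"
    "\<And>x. P x - x \<in> {w \<in> L2 \<mu>. AE x in \<mu>. w x = 0}"
    "\<And>x. x \<in> {w \<in> L2 \<mu>. AE x in \<mu>. w x = 0} \<Longrightarrow> P x = 0"
    by (rule fun_space.exists_projection_along) blast
  then have "L2_projection \<mu> P"
    by unfold_locales auto
  then show ?thesis by (rule that)
qed

lemma self_adjointD:
  assumes "self_adjoint \<mu> H"
  shows "fst H \<subseteq> L2 \<mu>" "u \<in> fst H \<Longrightarrow> snd H u \<in> L2 \<mu>"
    "\<lbrakk>u \<in> fst H; v \<in> fst H\<rbrakk> \<Longrightarrow> fscale a u + fscale b v \<in> fst H"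
    "\<lbrakk>u \<in> fst H; v \<in> fst H\<rbrakk> \<Longrightarrow> AE x in \<mu>. snd H (fscale a u + fscale b v) x = a * snd H u x + b * snd H v x"
    "\<lbrakk>u \<in> L2 \<mu>; 0 < e\<rbrakk> \<Longrightarrow> \<exists>v\<in>fst H. l2.nrm \<mu> (u - v) < e"
    "\<lbrakk>u \<in> L2 \<mu>; f \<in> L2 \<mu>\<rbrakk> \<Longrightarrow> (\<forall>v\<in>fst H. L2_inner \<mu> (snd H v) u = L2_inner \<mu> v f)
      \<longleftrightarrow> (u \<in> fst H \<and> (AE x in \<mu>. snd H u x = f x))"
proof -
  have d: "densely_defined \<mu> H" using assms by (simp add: self_adjoint_def)
  then show sub: "fst H \<subseteq> L2 \<mu>" by (simp add: densely_defined_def)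
  show "u \<in> fst H \<Longrightarrow> snd H u \<in> L2 \<mu>" using d by (simp add: densely_defined_def)
  show "\<lbrakk>u \<in> fst H; v \<in> fst H\<rbrakk> \<Longrightarrow> fscale a u + fscale b v \<in> fst H"
    using d by (simp add: densely_defined_def fun_lincomb_eq)
  show "\<lbrakk>u \<in> fst H; v \<in> fst H\<rbrakk> \<Longrightarrow> AE x in \<mu>. snd H (fscale a u + fscale b v) x = a * snd H u x + b * snd H v x"
    using d by (simp add: densely_defined_def L2_linear_on_def fun_lincomb_eq)
  show "\<exists>v\<in>fst H. l2.nrm \<mu> (u - v) < e" if "u \<in> L2 \<mu>" "0 < e"
  proof -
    have "\<exists>v\<in>fst H. Lp_norm \<mu> 2 (\<lambda>x. u x - v x) < ennreal e"
      using d that by (simp add: densely_defined_def)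
    then show ?thesis
      using that sub by (metis Lp_norm_diff ennreal_less_iff l2.X_closed(3) l2.nrm_nonneg subsetD)
  qed
  show "\<lbrakk>u \<in> L2 \<mu>; f \<in> L2 \<mu>\<rbrakk> \<Longrightarrow> (\<forall>v\<in>fst H. L2_inner \<mu> (snd H v) u = L2_inner \<mu> v f)
      \<longleftrightarrow> (u \<in> fst H \<and> (AE x in \<mu>. snd H u x = f x))"
    using assms by (simp add: self_adjoint_def)
qed

lemma self_adjoint_symmetric:
  "\<lbrakk>self_adjoint \<mu> H; u \<in> fst H; v \<in> fst H\<rbrakk> \<Longrightarrow> L2_inner \<mu> (snd H u) v = L2_inner \<mu> u (snd H v)"
  using self_adjointD(6)[of \<mu> H v "snd H v"] self_adjointD(1,2)[of \<mu> H] by auto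

text \<open>The adjoint relation consists of integrals, which do not see null sets, and
  self-adjointness makes it decide membership in the domain.\<close>

lemma self_adjoint_AE_closed:
  assumes sa: "self_adjoint \<mu> H" and u: "u \<in> fst H" and v: "v \<in> L2 \<mu>" and uv: "AE x in \<mu>. u x = v x"
  shows "v \<in> fst H \<and> (AE x in \<mu>. snd H v x = snd H u x)"
proof -
  note D = self_adjointD[OF sa]
  have uL: "u \<in> L2 \<mu>" using D(1) u by auto
  have "L2_inner \<mu> (snd H w) v = L2_inner \<mu> w (snd H u)" if w: "w \<in> fst H" for w
  proof -
    have "L2_inner \<mu> (snd H w) v = L2_inner \<mu> (snd H w) u"
      using uv D(2)[OF w] uL v by (intro L2_inner_cong_AE) auto
    then show ?thesis
      using self_adjoint_symmetric[OF sa w u] by simp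
  qed
  then show ?thesis
    using D(6)[OF v D(2)[OF u]] by blast
qed

text \<open>The domain is stable under \<open>P\<close> because it is closed under changes on null
  sets; quantifying over representatives or over all of \<open>fst H\<close> in the adjoint relation
  is then the same.\<close>

lemma (in L2_projection) self_adjoint_operator_R:
  assumes sa: "self_adjoint \<mu> H"
  shows "self_adjoint_operator fscale R (L2_inner \<mu>) (fst H \<inter> R) (\<lambda>u. P (snd H u))"
proof -
  interpret hilbert_subspace fscale R "L2_inner \<mu>" by (rule hilbert_subspace_R)
  note D = self_adjointD[OF sa]
  have P_D: "P v \<in> fst H \<inter> R" and P_H: "P (snd H (P v)) = P (snd H v)" if v: "v \<in> fst H" for v
  proof -
    have vL: "v \<in> L2 \<mu>" using v D(1) by auto
    have "AE x in \<mu>. v x = P v x" using P_AE[of v] by auto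
    with self_adjoint_AE_closed[OF sa v P_L2[OF vL]]
    have "P v \<in> fst H" "AE x in \<mu>. snd H (P v) x = snd H v x" by auto
    then show "P v \<in> fst H \<inter> R" "P (snd H (P v)) = P (snd H v)"
      using vL D(2) v by (auto simp: P_eq_iff)
  qed
  have sub: "fun_space.subspace (fst H)"
  proof (rule fun_space.subspaceI)
    obtain v where v: "v \<in> fst H" using D(5)[of 0 1] by auto
    show "0 \<in> fst H" using D(3)[OF v v, of 0 0] by simp
    show "x + y \<in> fst H" if "x \<in> fst H" "y \<in> fst H" for x y using D(3)[OF that, of 1 1] by simp
    show "fscale c x \<in> fst H" if "x \<in> fst H" for c x using D(3)[OF that that, of c 0] by simp
  qed
  show ?thesis
  proof unfold_locales
    show "fun_space.subspace (fst H \<inter> R)"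
      using sub X_subspace by (rule fun_space.subspace_inter)
    show "fst H \<inter> R \<subseteq> R" by simp
    show "P (snd H u) \<in> R" if "u \<in> fst H \<inter> R" for u using that D(2) by simp
  next
    fix u v c assume u: "u \<in> fst H \<inter> R" and v: "v \<in> fst H \<inter> R"
    have "fscale c u + fscale 1 v \<in> fst H"
      using u v by (intro D(3)) auto
    then have "P (snd H (fscale c u + fscale 1 v)) = P (fscale c (snd H u) + snd H v)"
      using D(4)[of u v c 1] u v D(2) by (subst P_eq_iff) auto
    then show "P (snd H (fscale c u + v)) = fscale c (P (snd H u)) + P (snd H v)"
      by (simp add: P_add P_scale)
  next
    fix u e assume u: "u \<in> R" and e: "(0::real) < e"
    then obtain v where v: "v \<in> fst H" "l2.nrm \<mu> (u - v) < e"
      using D(5)[of u e] by auto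
    have "l2.nrm \<mu> (u - P v) = l2.nrm \<mu> (u - v)"
      using nrm_P[of "u - v"] u v(1) D(1) by (auto simp: P_diff)
    then show "\<exists>v\<in>fst H \<inter> R. l2.nrm \<mu> (u - v) < e"
      using v P_D by (intro bexI[of _ "P v"]) auto
  next
    fix u f assume u: "u \<in> R" and f: "f \<in> R"
    have ip: "L2_inner \<mu> (P (snd H v)) u = L2_inner \<mu> (snd H v) u" if "v \<in> fst H" for v
      using that D(2) u by (intro L2_inner_cong_AE P_AE) auto
    have "(\<forall>v\<in>fst H \<inter> R. L2_inner \<mu> (P (snd H v)) u = L2_inner \<mu> v f)
        \<longleftrightarrow> (\<forall>v\<in>fst H. L2_inner \<mu> (snd H v) u = L2_inner \<mu> v f)"
    proof (intro iffI ballI)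
      fix v assume *: "\<forall>v\<in>fst H \<inter> R. L2_inner \<mu> (P (snd H v)) u = L2_inner \<mu> v f" and v: "v \<in> fst H"
      have "L2_inner \<mu> (P (snd H v)) u = L2_inner \<mu> (P v) f"
        using * P_D[OF v] P_H[OF v] by force
      also have "\<dots> = L2_inner \<mu> v f"
        using v D(1) f by (intro L2_inner_cong_AE P_AE) auto
      finally show "L2_inner \<mu> (snd H v) u = L2_inner \<mu> v f"
        using ip[OF v] by simp
    qed (use ip in auto)
    also have "\<dots> \<longleftrightarrow> u \<in> fst H \<and> (AE x in \<mu>. snd H u x = f x)"
      using u f by (intro D(6)) auto
    also have "\<dots> \<longleftrightarrow> u \<in> fst H \<inter> R \<and> P (snd H u) = f"
      using u f P_eq_iff[of "snd H u" f] D(2) by auto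
    finally show "(\<forall>v\<in>fst H \<inter> R. L2_inner \<mu> (P (snd H v)) u = L2_inner \<mu> v f)
        \<longleftrightarrow> u \<in> fst H \<inter> R \<and> P (snd H u) = f" .
  qed
qed

text \<open>The group on representatives is pulled back along \<open>P\<close>. Every clause of
  \<open>unitary_group\<close> and \<open>generated_by\<close> is an equality almost everywhere or a
  norm, so it survives the passage.\<close>

theorem stone_exists:
  assumes sa: "self_adjoint \<mu> H"
  shows "\<exists>U. unitary_group \<mu> U \<and> generated_by \<mu> U H"
proof -
  obtain P where "L2_projection \<mu> P" using exists_L2_projection by blast
  then interpret L2_projection \<mu> P .
  interpret S: self_adjoint_operator fscale R "L2_inner \<mu>" "fst H \<inter> R" "\<lambda>u. P (snd H u)"
    by (rule self_adjoint_operator_R[OF sa])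
  note S.D_closed [simp del, rule del]
  note D = self_adjointD[OF sa]
  define V where "V t u = S.U t (P u)" for t u
  have V_R: "V t u \<in> R" if "u \<in> L2 \<mu>" for t u
    using that by (simp add: V_def S.U_contr)
  have "unitary_group \<mu> V"
    unfolding unitary_group_def
  proof (intro conjI allI ballI)
    fix t u assume u: "u \<in> L2 \<mu>"
    show "V t u \<in> L2 \<mu>" using V_R[OF u] by simp
    show "Lp_norm \<mu> 2 (V t u) = Lp_norm \<mu> 2 u"
      unfolding Lp_norm_2[OF u] Lp_norm_2[OF R_L2[OF V_R[OF u]]]
      unfolding V_def S.U_isometry[OF P_R[OF u]] nrm_P[OF u] ..
  next
    fix t
    show "L2_linear_on \<mu> (L2 \<mu>) (V t)"
      unfolding L2_linear_on_def fun_lincomb_eq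
      by (auto simp: V_def P_add P_scale S.U_contr)
  next
    fix u assume u: "u \<in> L2 \<mu>"
    show "AE x in \<mu>. V 0 u x = u x"
      using u P_AE[of u] by (simp add: V_def S.U_zero)
  next
    fix s t u assume u: "u \<in> L2 \<mu>"
    show "AE x in \<mu>. V (s + t) u x = V s (V t u) x"
      using u by (simp add: V_def S.U_add S.U_contr)
  next
    fix u assume u: "u \<in> L2 \<mu>"
    have "Lp_norm \<mu> 2 (\<lambda>x. V t u x - u x) = ennreal (l2.nrm \<mu> (S.U t (P u) - P u))" for t
    proof -
      have "Lp_norm \<mu> 2 (\<lambda>x. V t u x - u x) = ennreal (l2.nrm \<mu> (V t u - u))"
        using u V_R[OF u] by (intro Lp_norm_diff) auto
      also have "l2.nrm \<mu> (V t u - u) = l2.nrm \<mu> (P (V t u - u))"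
        using u V_R[OF u] by (intro nrm_P[symmetric]) auto
      also have "P (V t u - u) = S.U t (P u) - P u"
        using V_R[OF u] by (simp add: P_diff V_def)
      finally show ?thesis .
    qed
    then show "((\<lambda>t. Lp_norm \<mu> 2 (\<lambda>x. V t u x - u x)) \<longlongrightarrow> 0) (at 0)"
      using S.U_continuous[of "P u"] u by (simp add: tendsto_ennreal_0_iff S.U_contr)
  qed
  moreover have "generated_by \<mu> V H"
    unfolding generated_by_def
  proof (intro ballI)
    fix u f assume u: "u \<in> L2 \<mu>" and f: "f \<in> L2 \<mu>"
    let ?deriv = "((\<lambda>t. Lp_norm \<mu> 2 (\<lambda>x. (V t u x - u x) / complex_of_real t - f x)) \<longlongrightarrow> 0) (at 0)"
    have "Lp_norm \<mu> 2 (\<lambda>x. (V t u x - u x) / complex_of_real t - f x)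
        = ennreal (l2.nrm \<mu> (fscale (1 / complex_of_real t) (S.U t (P u) - P u) - P f))" for t
    proof -
      let ?w = "fscale (1 / complex_of_real t) (V t u - u) - f"
      have "(\<lambda>x. (V t u x - u x) / complex_of_real t - f x) = ?w"
        by (simp add: fun_eq_iff)
      moreover have "Lp_norm \<mu> 2 ?w = ennreal (l2.nrm \<mu> ?w)"
        using u f V_R[OF u] by (intro Lp_norm_2) auto
      moreover have "l2.nrm \<mu> ?w = l2.nrm \<mu> (P ?w)"
        using u f V_R[OF u] by (intro nrm_P[symmetric]) auto
      ultimately show ?thesis
        using V_R[OF u] by (simp add: P_diff P_scale V_def)
    qed
    then have "?deriv
        \<longleftrightarrow> ((\<lambda>t. l2.nrm \<mu> (fscale (1 / complex_of_real t) (S.U t (P u) - P u) - P f)) \<longlongrightarrow> 0) (at 0)"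
      using u f by (simp add: tendsto_ennreal_0_iff S.U_contr)
    also have "\<dots> \<longleftrightarrow> P u \<in> fst H \<inter> R \<and> P f = fscale (- \<i>) (P (snd H (P u)))"
      using S.U_derivative_D[of "P u"] S.U_derivative_imp_D[of "P u" "P f"] u f by auto
    also have "\<dots> \<longleftrightarrow> u \<in> fst H \<and> (AE x in \<mu>. f x = - \<i> * snd H u x)"
    proof -
      \<comment> \<open>The abstract result speaks of \<open>P u\<close>, the goal of
        \<open>u\<close>; both the domain and the value of \<open>H\<close> depend only on the
        class.\<close>
      have AE_P: "AE x in \<mu>. u x = P u x"
        using P_AE[of u] by eventually_elim simp
      then have "P u \<in> fst H \<longleftrightarrow> u \<in> fst H"
        using self_adjoint_AE_closed[OF sa, of u "P u"] self_adjoint_AE_closed[OF sa, of "P u" u] P_AE[of u] u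
        by auto
      moreover have "P f = fscale (- \<i>) (P (snd H (P u))) \<longleftrightarrow> (AE x in \<mu>. f x = - \<i> * snd H u x)"
        if uD: "u \<in> fst H"
      proof -
        have "P (snd H (P u)) = P (snd H u)"
          using self_adjoint_AE_closed[OF sa uD, of "P u"] AE_P u D(2) uD by (subst P_eq_iff) auto
        then have "fscale (- \<i>) (P (snd H (P u))) = P (fscale (- \<i>) (snd H u))"
          by (simp only: P_scale)
        then show ?thesis
          using P_eq_iff[of f "fscale (- \<i>) (snd H u)"] f D(2)[OF uD] by simp
      qed
      ultimately show ?thesis using u by auto
    qed
    finally show "?deriv
        \<longleftrightarrow> u \<in> fst H \<and> (AE x in \<mu>. f x = - \<i> * snd H u x)" .
  qed
  ultimately show ?thesis by blast
qed

lemma evolution_spec: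
  assumes "self_adjoint \<mu> H"
  shows "unitary_group \<mu> (evolution \<mu> H)" "generated_by \<mu> (evolution \<mu> H) H"
  using someI_ex[OF stone_exists[OF assms]] by (auto simp: evolution_def)

section \<open>Evolution of quasimodes\<close>

text \<open>Duhamel's formula in discrete form: [0, t] is cut into N + 1 equal steps and N tends to
  infinity. The derivative is known only at the single vector \<open>u\<close>. The second estimate
  pairs with \<open>u\<close>, so that V s w - w turns into V (- s) u - u on the other side, and one
  derivative yields a second-order bound.\<close>

lemma (in semi_inner_space) isometric_group_estimates:
  assumes V_X: "\<And>t x. x \<in> X \<Longrightarrow> V t x \<in> X" and V_iso: "\<And>t x. x \<in> X \<Longrightarrow> nrm (V t x) = nrm x"
    and V_lin: "\<And>t c x y. \<lbrakk>x \<in> X; y \<in> X\<rbrakk> \<Longrightarrow> V t (c \<odot> x + y) = c \<odot> V t x + V t y"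
    and V_add: "\<And>s t x. x \<in> X \<Longrightarrow> V (s + t) x = V s (V t x)" and V_0: "\<And>x. x \<in> X \<Longrightarrow> V 0 x = x"
    and u: "u \<in> X" and g: "g \<in> X"
    and deriv: "((\<lambda>t. nrm ((1 / complex_of_real t) \<odot> (V t u - u) - g)) \<longlongrightarrow> 0) (at 0)"
    and t: "0 < t"
  shows "nrm (V t u - u) \<le> t * nrm g"
    and "cmod (ip (V t u - u) u - complex_of_real t * ip g u) \<le> (t * nrm g)\<^sup>2"
proof -
  define h where "h N = t / real (Suc N)" for N
  define w where "w N = V (h N) u - u" for N
  have h_pos: "0 < h N" for N using t by (simp add: h_def)
  have wX: "w N \<in> X" for N using V_X u by (simp add: w_def)
  have V_diff: "V s (x - y) = V s x - V s y" if "x \<in> X" "y \<in> X" for s x y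
    using V_lin[of y x s "-1"] that by simp
  have V_add': "V s (x + y) = V s x + V s y" if "x \<in> X" "y \<in> X" for s x y
    using V_lin[of x y s 1] that by simp
  have V_step: "V (real (Suc n) * h N) u - u = (V (real n * h N) u - u) + V (real n * h N) (w N)" for n N
  proof -
    have "V (real (Suc n) * h N) u = V (real n * h N) (V (h N) u)"
      using V_add[OF u, of "real n * h N" "h N"] by (simp add: distrib_right add.commute)
    also have "V (h N) u = u + w N" by (simp add: w_def)
    finally show ?thesis using V_add'[OF u wX] by simp
  qed
  have lin: "nrm (V (real n * h N) u - u) \<le> real n * nrm (w N)" for n N
  proof (induction n)
    case 0
    then show ?case using V_0 u by simp
  next
    case (Suc n)
    have "nrm (V (real (Suc n) * h N) u - u) \<le> nrm (V (real n * h N) u - u) + nrm (V (real n * h N) (w N))"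
      unfolding V_step using V_X u wX by (intro nrm_triangle) auto
    then show ?case
      using Suc V_iso[OF wX] by (simp add: distrib_right)
  qed
  have adj: "ip (V s x) u = ip x (V (- s) u)" if "x \<in> X" for s x
  proof -
    have "ip (V s x) (V s (V (- s) u)) = ip x (V (- s) u)"
      using that u V_X V_iso V_lin by (intro ip_isometry) auto
    then show ?thesis
      using V_add[OF u, of s "- s"] V_0[OF u] by simp
  qed
  \<comment> \<open>Each step replaces ip (V s w) u by ip w u. The price ip w (V (- s) u - u) is at
    most (N + 1) (nrm w)^2 by Cauchy-Schwarz and \<open>lin\<close>; the cap
    \<open>n \<le> Suc N\<close> makes it uniform in n.\<close>
  have quad: "cmod (ip (V (real n * h N) u - u) u - of_nat n * ip (w N) u) \<le> real n * (real (Suc N) * (nrm (w N))\<^sup>2)"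
    if "n \<le> Suc N" for n N
    using that
  proof (induction n)
    case 0
    then show ?case using V_0 u by simp
  next
    case (Suc n)
    let ?s = "real n * h N"
    have "ip (V (real (Suc n) * h N) u - u) u - of_nat (Suc n) * ip (w N) u
        = (ip (V ?s u - u) u - of_nat n * ip (w N) u) + ip (w N) (V (- ?s) u - u)"
      unfolding V_step using V_X u wX adj[OF wX, of ?s N]
      by (simp add: ip_add_left ip_diff_right distrib_right)
    also have "cmod \<dots> \<le> cmod (ip (V ?s u - u) u - of_nat n * ip (w N) u) + cmod (ip (w N) (V (- ?s) u - u))"
      by (rule norm_triangle_ineq)
    also have "cmod (ip (w N) (V (- ?s) u - u)) \<le> nrm (w N) * nrm (V (- ?s) u - u)"
      using V_X u wX by (intro Cauchy_Schwarz) auto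
    also have "nrm (V (- ?s) u - u) = nrm (V ?s u - u)"
    proof -
      have "nrm (V (- ?s) u - u) = nrm (V ?s (V (- ?s) u - u))"
        using V_X u V_iso by simp
      also have "V ?s (V (- ?s) u - u) = u - V ?s u"
        using V_diff V_X u V_add[OF u, of ?s "- ?s"] V_0[OF u] by simp
      finally show ?thesis using nrm_diff_commute V_X u by simp
    qed
    also have "nrm (w N) * nrm (V ?s u - u) \<le> nrm (w N) * (real (Suc N) * nrm (w N))"
    proof (intro mult_left_mono)
      have "real n * nrm (w N) \<le> real (Suc N) * nrm (w N)"
        using Suc.prems wX by (intro mult_right_mono) auto
      then show "nrm (V ?s u - u) \<le> real (Suc N) * nrm (w N)"
        using lin[of n N] by linarith
    qed (use wX in simp)
    finally show ?case
      using Suc by (simp add: power2_eq_square algebra_simps)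
  qed
  have h_lim: "filterlim h (at 0) sequentially"
  proof -
    have "(\<lambda>N. t * inverse (real (Suc N))) \<longlonglongrightarrow> t * 0"
      by (intro tendsto_mult tendsto_const LIMSEQ_inverse_real_of_nat)
    moreover have "h = (\<lambda>N. t * inverse (real (Suc N)))"
      by (simp add: fun_eq_iff h_def divide_inverse)
    ultimately have "h \<longlonglongrightarrow> 0" by simp
    then show ?thesis
      using h_pos by (simp add: filterlim_at less_imp_neq[symmetric])
  qed
  \<comment> \<open>The difference quotient, tending to \<open>g\<close>. Since (N + 1) h N = t, the
    accumulated increments equal t times \<open>q N\<close>.\<close>
  define q where "q N = (1 / complex_of_real (h N)) \<odot> w N" for N
  have qX: "q N \<in> X" for N using wX by (simp add: q_def)
  have q_lim: "(\<lambda>N. nrm (q N - g)) \<longlonglongrightarrow> 0"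
    using filterlim_compose[OF deriv h_lim] by (simp add: q_def w_def)
  have N_h: "real (Suc N) * h N = t" for N
    by (simp add: h_def)
  have wq: "w N = complex_of_real (h N) \<odot> q N" for N
    using h_pos[of N] by (simp add: q_def)
  have nrm_w: "real (Suc N) * nrm (w N) = t * nrm (q N)" for N
  proof -
    have "nrm (w N) = h N * nrm (q N)"
      using h_pos[of N] qX by (subst wq) (simp add: nrm_scale)
    then show ?thesis by (simp only: N_h mult.assoc[symmetric])
  qed
  have ip_w: "of_nat (Suc N) * ip (w N) u = complex_of_real t * ip (q N) u" for N
  proof -
    have "ip (w N) u = complex_of_real (h N) * ip (q N) u"
      using qX u by (subst wq) (rule ip_scale_left)
    moreover have "of_nat (Suc N) * complex_of_real (h N) = complex_of_real t"
      unfolding N_h[of N, symmetric] by simp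
    ultimately show ?thesis by (simp only: mult.assoc[symmetric])
  qed
  have nrm_q: "(\<lambda>N. nrm (q N)) \<longlonglongrightarrow> nrm g"
    using qX g q_lim by (rule tendsto_nrm)
  show "nrm (V t u - u) \<le> t * nrm g"
  proof (rule tendsto_lowerbound)
    show "(\<lambda>N. t * nrm (q N)) \<longlonglongrightarrow> t * nrm g"
      by (intro tendsto_intros nrm_q)
    show "\<forall>\<^sub>F N in sequentially. nrm (V t u - u) \<le> t * nrm (q N)"
    proof (intro always_eventually allI)
      show "nrm (V t u - u) \<le> t * nrm (q N)" for N
        using lin[of "Suc N" N] by (simp only: N_h nrm_w)
    qed
  qed simp
  show "cmod (ip (V t u - u) u - complex_of_real t * ip g u) \<le> (t * nrm g)\<^sup>2"
  proof (rule tendsto_le[OF sequentially_bot])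
    show "(\<lambda>N. (t * nrm (q N))\<^sup>2) \<longlonglongrightarrow> (t * nrm g)\<^sup>2"
      by (intro tendsto_intros nrm_q)
    have "(\<lambda>N. ip (q N) u) \<longlonglongrightarrow> ip g u"
      using qX g u q_lim by (intro tendsto_ip) auto
    then show "(\<lambda>N. cmod (ip (V t u - u) u - complex_of_real t * ip (q N) u))
        \<longlonglongrightarrow> cmod (ip (V t u - u) u - complex_of_real t * ip g u)"
      by (intro tendsto_intros)
    have "cmod (ip (V t u - u) u - complex_of_real t * ip (q N) u) \<le> (t * nrm (q N))\<^sup>2" for N
    proof -
      have "real (Suc N) * (real (Suc N) * (nrm (w N))\<^sup>2) = (t * nrm (q N))\<^sup>2"
        unfolding nrm_w[symmetric] by (simp add: power2_eq_square)
      then show ?thesis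
        using quad[of "Suc N" N] by (simp only: N_h ip_w order_refl)
    qed
    then show "\<forall>\<^sub>F N in sequentially. cmod (ip (V t u - u) u - complex_of_real t * ip (q N) u) \<le> (t * nrm (q N))\<^sup>2"
      by simp
  qed
qed

section \<open>Unitary groups compared with phase rotations\<close>

lemma unitary_groupD:
  assumes "unitary_group \<mu> U" and u: "u \<in> L2 \<mu>" and v: "v \<in> L2 \<mu>"
  shows "U t u \<in> L2 \<mu>" "l2.nrm \<mu> (U t u) = l2.nrm \<mu> u"
    "AE x in \<mu>. U t (fscale a u + fscale b v) x = a * U t u x + b * U t v x"
    "AE x in \<mu>. U 0 u x = u x" "AE x in \<mu>. U (s + t) u x = U s (U t u) x"
proof -
  show U: "U t u \<in> L2 \<mu>" using assms by (simp add: unitary_group_def)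
  have "Lp_norm \<mu> 2 (U t u) = Lp_norm \<mu> 2 u" using assms by (simp add: unitary_group_def)
  then show "l2.nrm \<mu> (U t u) = l2.nrm \<mu> u"
    using u U by (simp add: Lp_norm_2 ennreal_inj)
  show "AE x in \<mu>. U t (fscale a u + fscale b v) x = a * U t u x + b * U t v x"
    using assms by (simp add: unitary_group_def L2_linear_on_def fun_lincomb_eq)
qed (use assms in \<open>simp_all add: unitary_group_def\<close>)

lemma unitary_group_AE_cong:
  assumes U: "unitary_group \<mu> U" and u: "u \<in> L2 \<mu>" and v: "v \<in> L2 \<mu>" and uv: "AE x in \<mu>. u x = v x"
  shows "AE x in \<mu>. U t u x = U t v x"
proof -
  let ?d = "fscale 1 u + fscale (-1) v"
  have d: "?d \<in> L2 \<mu>" using u v by blast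
  have "l2.nrm \<mu> ?d = 0"
    using d uv by (subst L2_nrm_eq_0_iff) auto
  then have "AE x in \<mu>. U t ?d x = 0"
    using unitary_groupD(1,2)[OF U d d, of t] by (simp flip: L2_nrm_eq_0_iff)
  then show ?thesis
    using unitary_groupD(3)[OF U u v, of t 1 "-1"] by eventually_elim simp
qed

text \<open>Both estimates compare with the same rotating vector. The first will be applied to the
  unperturbed operator, where \<open>k\<close> is the small residual of a quasimode, the second to
  the perturbed one, where \<open>k\<close> also contains W u.\<close>

lemma rotation_estimates:
  fixes r t :: real
  assumes sa: "self_adjoint \<mu> H" and uH: "u \<in> fst H" and t: "0 < t"
  defines "k \<equiv> snd H u - fscale (complex_of_real r) u"
  defines "d \<equiv> evolution \<mu> H t u - fscale (cis (- r * t)) u"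
  shows "l2.nrm \<mu> d \<le> t * l2.nrm \<mu> k"
    and "t * Re (L2_inner \<mu> k u) - (t * l2.nrm \<mu> k)\<^sup>2 \<le> l2.nrm \<mu> d * l2.nrm \<mu> u"
proof -
  obtain P where "L2_projection \<mu> P" using exists_L2_projection by blast
  then interpret L2_projection \<mu> P .
  interpret S: hilbert_subspace fscale R "L2_inner \<mu>" by (rule hilbert_subspace_R)
  define U where "U = evolution \<mu> H"
  have ug: "unitary_group \<mu> U" and gen: "generated_by \<mu> U H"
    using evolution_spec[OF sa] by (simp_all add: U_def)
  note UD = unitary_groupD[OF ug]
  have UL: "U s x \<in> L2 \<mu>" if "x \<in> L2 \<mu>" for s x
    using UD(1) that by blast
  have uL: "u \<in> L2 \<mu>" and HuL: "snd H u \<in> L2 \<mu>"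
    using self_adjointD(1,2)[OF sa] uH by auto
  have kL: "k \<in> L2 \<mu>" and dL: "d \<in> L2 \<mu>"
    using uL HuL UL[OF uL] unfolding k_def d_def U_def[symmetric] by blast+
  let ?g = "fscale (- \<i>) (P k)"
  \<comment> \<open>The phase cancels the oscillation of frequency r, so the derivative at
    \<open>u\<close> is -i (H - r) u, small for a quasimode however large r is. \<open>P\<close>
    turns the group laws into genuine equalities.\<close>
  define V where "V s x = fscale (cis (r * s)) (P (U s x))" for s x
  have V_R: "V s x \<in> R" if "x \<in> R" for s x
    using that UL[of x s] by (simp add: V_def)
  have V_AE: "V s x = V s y" if "x \<in> L2 \<mu>" "y \<in> L2 \<mu>" "AE z in \<mu>. x z = y z" for s x y
  proof -
    have "P (U s x) = P (U s y)"
      using that UL unitary_group_AE_cong[OF ug that] by (subst P_eq_iff) auto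
    then show ?thesis by (simp add: V_def)
  qed
  have lim: "((\<lambda>s. l2.nrm \<mu> (fscale (1 / complex_of_real s) (P (U s u) - P u) - fscale (- \<i>) (P (snd H u)))) \<longlongrightarrow> 0) (at 0)"
  proof -
    have "(\<lambda>x. - \<i> * snd H u x) \<in> L2 \<mu>"
      using L2_fscale[OF HuL, of "- \<i>"] by (simp add: fscale_def)
    then have "((\<lambda>s. Lp_norm \<mu> 2 (\<lambda>x. (U s u x - u x) / complex_of_real s - (- \<i> * snd H u x))) \<longlongrightarrow> 0) (at 0)"
      by (rule iffD2[OF bspec[OF bspec[OF gen[unfolded generated_by_def] uL]]]) (simp add: uH)
    moreover have "Lp_norm \<mu> 2 (\<lambda>x. (U s u x - u x) / complex_of_real s - (- \<i> * snd H u x))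
        = ennreal (l2.nrm \<mu> (fscale (1 / complex_of_real s) (P (U s u) - P u) - fscale (- \<i>) (P (snd H u))))" for s
    proof -
      let ?w = "fscale (1 / complex_of_real s) (U s u - u) - fscale (- \<i>) (snd H u)"
      have wL: "?w \<in> L2 \<mu>"
        using uL HuL UL[OF uL] by blast
      have "(\<lambda>x. (U s u x - u x) / complex_of_real s - (- \<i> * snd H u x)) = ?w"
        by (simp add: fun_eq_iff)
      moreover have "P ?w = fscale (1 / complex_of_real s) (P (U s u) - P u) - fscale (- \<i>) (P (snd H u))"
        by (simp only: P_diff P_scale)
      ultimately show ?thesis
        using Lp_norm_2[OF wL] nrm_P[OF wL] by simp
    qed
    ultimately show ?thesis
      using uL HuL UL[OF uL] by (simp add: tendsto_ennreal_0_iff)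
  qed
  have VPu: "V s (P u) = fscale (cis (r * s)) (P (U s u))" for s
    using V_AE[of "P u" u s] uL P_AE[of u] by (simp add: V_def)
  have deriv: "((\<lambda>s. l2.nrm \<mu> (fscale (1 / complex_of_real s) (V s (P u) - P u) - ?g)) \<longlongrightarrow> 0) (at 0)"
  proof -
    define a where "a = fscale (- \<i>) (P (snd H u))"
    define A where "A s = fscale (1 / complex_of_real s) (P (U s u) - P u)" for s
    define c where "c s = (cis (r * s) - 1) / complex_of_real s" for s
    have aR: "a \<in> R" and AR: "A s \<in> R" for s
      using uL HuL UL[OF uL] by (auto simp: a_def A_def)
    have "((\<lambda>s. cis (r * s)) has_derivative (\<lambda>h. (r * h) *\<^sub>R (\<i> * cis (r * 0)))) (at 0)"
      by (intro derivative_intros)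
    then have "((\<lambda>s. cmod (cis (r * s) - 1 - (r * s) *\<^sub>R \<i>) / \<bar>s\<bar>) \<longlongrightarrow> 0) (at 0)"
      by (simp add: has_derivative_at)
    then have c_lim: "((\<lambda>s. cmod (c s - \<i> * complex_of_real r)) \<longlongrightarrow> 0) (at 0)"
    proof (rule Lim_transform_eventually)
      show "\<forall>\<^sub>F s in at 0. cmod (cis (r * s) - 1 - (r * s) *\<^sub>R \<i>) / \<bar>s\<bar> = cmod (c s - \<i> * complex_of_real r)"
        unfolding eventually_at_filter
      proof (intro always_eventually allI impI)
        fix s :: real assume s: "s \<noteq> 0"
        then have "c s - \<i> * complex_of_real r = (cis (r * s) - 1 - (r * s) *\<^sub>R \<i>) / complex_of_real s"
          by (simp add: c_def scaleR_conv_of_real field_simps)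
        then show "cmod (cis (r * s) - 1 - (r * s) *\<^sub>R \<i>) / \<bar>s\<bar> = cmod (c s - \<i> * complex_of_real r)"
          by (simp add: norm_divide)
      qed
    qed
    have "((\<lambda>s. cis (r * s)) \<longlongrightarrow> cis (r * 0)) (at 0)"
      by (intro tendsto_intros)
    then have cis_lim: "((\<lambda>s. cmod (cis (r * s) - 1)) \<longlongrightarrow> 0) (at 0)"
      by (intro tendsto_norm_zero LIM_zero) simp
    have A_lim: "((\<lambda>s. l2.nrm \<mu> (A s - a)) \<longlongrightarrow> 0) (at 0)"
      using lim by (simp add: A_def a_def)
    \<comment> \<open>Product rule for the phase times the group; \<open>c s\<close> is the
      difference quotient of the phase, with limit ir. Each of the three summands tends to
      zero.\<close>
    have decomp: "fscale (1 / complex_of_real s) (V s (P u) - P u) - ?g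
        = fscale (cis (r * s)) (A s - a) + (fscale (cis (r * s) - 1) a + fscale (c s - \<i> * complex_of_real r) (P u))" for s
    proof -
      have Pk: "P k = P (snd H u) - fscale (complex_of_real r) (P u)"
        by (simp add: k_def P_diff P_scale)
      show ?thesis
        unfolding VPu Pk by (simp add: fun_eq_iff A_def a_def c_def divide_inverse algebra_simps)
    qed
    have le: "l2.nrm \<mu> (fscale (1 / complex_of_real s) (V s (P u) - P u) - ?g)
        \<le> l2.nrm \<mu> (A s - a) + (cmod (cis (r * s) - 1) * l2.nrm \<mu> a
          + cmod (c s - \<i> * complex_of_real r) * l2.nrm \<mu> (P u))" for s
    proof -
      let ?x = "fscale (cis (r * s)) (A s - a)" and ?y = "fscale (cis (r * s) - 1) a"
        and ?z = "fscale (c s - \<i> * complex_of_real r) (P u)"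
      have X: "?x \<in> L2 \<mu>" "?y \<in> L2 \<mu>" "?z \<in> L2 \<mu>"
        using aR AR[of s] uL by (blast intro: L2_fscale l2.X_closed(3) R_L2 P_L2)+
      have "l2.nrm \<mu> (?x + (?y + ?z)) \<le> l2.nrm \<mu> ?x + (l2.nrm \<mu> ?y + l2.nrm \<mu> ?z)"
        using l2.nrm_triangle[OF X(1) l2.X_closed(2)[OF X(2,3)]] l2.nrm_triangle[OF X(2,3)] by linarith
      also have "l2.nrm \<mu> ?x = l2.nrm \<mu> (A s - a)"
        using aR AR[of s] by (subst l2.nrm_scale) auto
      also have "l2.nrm \<mu> ?y = cmod (cis (r * s) - 1) * l2.nrm \<mu> a"
        using aR by (subst l2.nrm_scale) auto
      also have "l2.nrm \<mu> ?z = cmod (c s - \<i> * complex_of_real r) * l2.nrm \<mu> (P u)"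
        using uL by (subst l2.nrm_scale) auto
      finally show ?thesis unfolding decomp .
    qed
    have bound_lim: "((\<lambda>s. l2.nrm \<mu> (A s - a) + (cmod (cis (r * s) - 1) * l2.nrm \<mu> a
        + cmod (c s - \<i> * complex_of_real r) * l2.nrm \<mu> (P u))) \<longlongrightarrow> 0) (at 0)"
      using tendsto_add[OF A_lim tendsto_add[OF tendsto_mult_left_zero[OF cis_lim] tendsto_mult_left_zero[OF c_lim]]]
      by simp
    have nonneg: "0 \<le> l2.nrm \<mu> (fscale (1 / complex_of_real s) (V s (P u) - P u) - ?g)" for s
      using V_R[of "P u" s] uL kL by (intro l2.nrm_nonneg) (blast intro: L2_fscale l2.X_closed(3) R_L2 P_L2 P_R)
    show ?thesis
      by (rule tendsto_sandwich[OF always_eventually[OF allI[OF nonneg]] always_eventually[OF allI[OF le]]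
            tendsto_const bound_lim])
  qed
  have est: "l2.nrm \<mu> (V t (P u) - P u) \<le> t * l2.nrm \<mu> ?g"
    "cmod (L2_inner \<mu> (V t (P u) - P u) (P u) - complex_of_real t * L2_inner \<mu> ?g (P u))
       \<le> (t * l2.nrm \<mu> ?g)\<^sup>2"
  proof -
    have 1: "l2.nrm \<mu> (V s x) = l2.nrm \<mu> x" if x: "x \<in> R" for s x
      using x UL[of x s] UD(2)[of x x s] by (simp add: V_def l2.nrm_scale nrm_P)
    have 2: "V s (fscale c x + y) = fscale c (V s x) + V s y" if x: "x \<in> R" and y: "y \<in> R" for s c x y
    proof -
      have "P (U s (fscale c x + fscale 1 y)) = P (fscale c (U s x) + U s y)"
        using x y UL UD(3)[of x y s c 1] by (subst P_eq_iff) auto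
      then show ?thesis
        by (simp add: V_def P_add P_scale fun_space.scale_right_distrib mult.commute)
    qed
    have 3: "V (s + q) x = V s (V q x)" if x: "x \<in> R" for s q x
    proof -
      have Ux: "U q x \<in> L2 \<mu>" using x UL[of x q] by simp
      have "P (U s (fscale (cis (r * q)) (P (U q x)) + fscale 0 x)) = P (fscale (cis (r * q)) (U s (P (U q x))))"
        using x UL Ux UD(3)[of "P (U q x)" x s "cis (r * q)" 0] by (subst P_eq_iff) auto
      then have "P (U s (fscale (cis (r * q)) (P (U q x)))) = fscale (cis (r * q)) (P (U s (P (U q x))))"
        by (simp add: P_scale)
      also have "P (U s (P (U q x))) = P (U s (U q x))"
        using Ux UL unitary_group_AE_cong[OF ug P_L2[OF Ux] Ux P_AE] by (subst P_eq_iff) auto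
      also have "P (U s (U q x)) = P (U (s + q) x)"
        using x Ux UL UD(5)[of x x s q] by (subst P_eq_iff) (auto elim: AE_mp)
      finally have "V s (V q x) = fscale (cis (r * s)) (fscale (cis (r * q)) (P (U (s + q) x)))"
        by (simp only: V_def)
      also have "\<dots> = V (s + q) x"
        unfolding fun_space.scale_scale cis_mult V_def by (simp only: distrib_left)
      finally show ?thesis by (rule sym)
    qed
    have 4: "V 0 x = x" if x: "x \<in> R" for x
      using x UL[of x 0] UD(4)[of x x] P_eq_iff[of "U 0 x" x] by (simp add: V_def)
    note est = S.isometric_group_estimates[OF V_R 1 2 3 4 P_R[OF uL] S.X_closed(5)[OF P_R[OF kL]] deriv t]
    show "l2.nrm \<mu> (V t (P u) - P u) \<le> t * l2.nrm \<mu> ?g"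
      by (rule est(1))
    show "cmod (L2_inner \<mu> (V t (P u) - P u) (P u) - complex_of_real t * L2_inner \<mu> ?g (P u))
       \<le> (t * l2.nrm \<mu> ?g)\<^sup>2"
      by (rule est(2))
  qed
  have nrm_k: "l2.nrm \<mu> ?g = l2.nrm \<mu> k"
    using kL by (simp add: l2.nrm_scale nrm_P del: fun_space.scale_minus_left)
  have nrm_d: "l2.nrm \<mu> (V t (P u) - P u) = l2.nrm \<mu> d"
  proof -
    have "V t (P u) - P u = P (fscale (cis (r * t)) d)"
      unfolding VPu d_def U_def[symmetric]
      by (simp add: P_scale P_diff fun_space.scale_right_diff_distrib cis_mult)
    moreover have "l2.nrm \<mu> (P (fscale (cis (r * t)) d)) = l2.nrm \<mu> d"
      using dL by (simp add: nrm_P l2.nrm_scale)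
    ultimately show ?thesis by (simp only:)
  qed
  show "l2.nrm \<mu> d \<le> t * l2.nrm \<mu> k"
    using est(1) unfolding nrm_k nrm_d .
  have "t * Re (L2_inner \<mu> k u) \<le> cmod (complex_of_real t * L2_inner \<mu> ?g (P u))"
  proof -
    have "L2_inner \<mu> (P k) (P u) = L2_inner \<mu> k u"
      using kL uL by (intro L2_inner_cong_AE P_AE) auto
    then have "cmod (complex_of_real t * L2_inner \<mu> ?g (P u)) = t * cmod (L2_inner \<mu> k u)"
      using kL uL t l2.ip_scale_left[of "P k" \<mu> "P u" "- \<i>"] by (simp add: norm_mult)
    then show ?thesis
      using complex_Re_le_cmod t by simp
  qed
  also have "\<dots> \<le> cmod (L2_inner \<mu> (V t (P u) - P u) (P u)) + (t * l2.nrm \<mu> k)\<^sup>2"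
    using norm_triangle_sub[of "complex_of_real t * L2_inner \<mu> ?g (P u)"
        "L2_inner \<mu> (V t (P u) - P u) (P u)"] est(2)
    unfolding nrm_k by (simp only: norm_minus_commute)
  also have "cmod (L2_inner \<mu> (V t (P u) - P u) (P u)) \<le> l2.nrm \<mu> (V t (P u) - P u) * l2.nrm \<mu> (P u)"
    using V_R[of "P u" t] uL by (intro l2.Cauchy_Schwarz) auto
  finally show "t * Re (L2_inner \<mu> k u) - (t * l2.nrm \<mu> k)\<^sup>2 \<le> l2.nrm \<mu> d * l2.nrm \<mu> u"
    using uL by (simp add: nrm_d nrm_P)
qed

section \<open>Perturbation by bounded real potentials\<close>

lemma L2_mult_bounded:
  fixes W :: "'a \<Rightarrow> real"
  assumes W: "W \<in> borel_measurable \<mu>" "\<And>x. \<bar>W x\<bar> \<le> B" and u: "u \<in> L2 \<mu>"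
  shows "(\<lambda>x. complex_of_real (W x) * u x) \<in> L2 \<mu>"
proof -
  have "integrable \<mu> (\<lambda>x. (cmod (complex_of_real (W x) * u x))\<^sup>2)"
  proof (rule Bochner_Integration.integrable_bound)
    show "integrable \<mu> (\<lambda>x. B\<^sup>2 * (cmod (u x))\<^sup>2)"
      using u by (simp add: L2_iff)
    show "(\<lambda>x. (cmod (complex_of_real (W x) * u x))\<^sup>2) \<in> borel_measurable \<mu>"
      using u W by (auto simp: L2_iff)
    have "(cmod (complex_of_real (W x) * u x))\<^sup>2 \<le> B\<^sup>2 * (cmod (u x))\<^sup>2" for x
    proof -
      have "\<bar>W x\<bar>\<^sup>2 \<le> B\<^sup>2" using W(2)[of x] by (intro power_mono) auto
      then show ?thesis by (simp add: norm_mult power_mult_distrib mult_right_mono)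
    qed
    then show "AE x in \<mu>. norm ((cmod (complex_of_real (W x) * u x))\<^sup>2) \<le> norm (B\<^sup>2 * (cmod (u x))\<^sup>2)"
      by auto
  qed
  then show ?thesis
    using u W by (auto simp: L2_iff)
qed

text \<open>Multiplication by W is bounded and symmetric, so it can be moved across: the adjoint
  relation of H + W with value f is that of H with value f - W u, on the same domain.\<close>

lemma self_adjoint_add_potential:
  fixes W :: "'a \<Rightarrow> real"
  assumes sa: "self_adjoint \<mu> H" and W: "W \<in> borel_measurable \<mu>" "\<And>x. \<bar>W x\<bar> \<le> B"
  shows "self_adjoint \<mu> (add_potential H W)"
proof -
  define M where "M u = (\<lambda>x. complex_of_real (W x) * u x)" for u
  have M: "M u \<in> L2 \<mu>" if "u \<in> L2 \<mu>" for u
    unfolding M_def using W that by (rule L2_mult_bounded)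
  note D = self_adjointD[OF sa]
  have fst_eq: "fst (add_potential H W) = fst H" and snd_eq: "snd (add_potential H W) u = snd H u + M u" for u
    by (simp_all add: add_potential_def M_def plus_fun_def)
  have "densely_defined \<mu> (add_potential H W)"
    unfolding densely_defined_def fst_eq
  proof (intro conjI ballI)
    show "L2_linear_on \<mu> (fst H) (snd (add_potential H W))"
      unfolding L2_linear_on_def
    proof (intro ballI allI)
      fix u v a b assume "u \<in> fst H" "v \<in> fst H"
      from D(4)[OF this, of a b]
      show "AE x in \<mu>. snd (add_potential H W) (\<lambda>x. a * u x + b * v x) x
          = a * snd (add_potential H W) u x + b * snd (add_potential H W) v x"
        unfolding fun_lincomb_eq snd_eq by eventually_elim (simp add: M_def algebra_simps)
    qed
    show "snd (add_potential H W) u \<in> L2 \<mu>" if "u \<in> fst H" for u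
      using that D(1,2) M unfolding snd_eq by blast
  qed (use sa in \<open>auto simp: self_adjoint_def densely_defined_def\<close>)
  moreover have "(\<forall>v\<in>fst H. L2_inner \<mu> (snd H v + M v) u = L2_inner \<mu> v f)
      \<longleftrightarrow> u \<in> fst H \<and> (AE x in \<mu>. (snd H u + M u) x = f x)" if u: "u \<in> L2 \<mu>" and f: "f \<in> L2 \<mu>" for u f
  proof -
    have "L2_inner \<mu> (snd H v + M v) u = L2_inner \<mu> v f \<longleftrightarrow> L2_inner \<mu> (snd H v) u = L2_inner \<mu> v (f - M u)"
      if v: "v \<in> fst H" for v
    proof -
      have vL: "v \<in> L2 \<mu>" "snd H v \<in> L2 \<mu>" using D(1,2) v by auto
      have "L2_inner \<mu> (M v) u = L2_inner \<mu> v (M u)"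
        by (simp add: L2_inner_def M_def mult_ac)
      then show ?thesis
        using vL u f M by (auto simp: l2.ip_add_left l2.ip_diff_right algebra_simps)
    qed
    then have "(\<forall>v\<in>fst H. L2_inner \<mu> (snd H v + M v) u = L2_inner \<mu> v f)
        \<longleftrightarrow> (\<forall>v\<in>fst H. L2_inner \<mu> (snd H v) u = L2_inner \<mu> v (f - M u))"
      by simp
    also have "\<dots> \<longleftrightarrow> u \<in> fst H \<and> (AE x in \<mu>. snd H u x = (f - M u) x)"
      using u f M by (intro D(6)) auto
    also have "\<dots> \<longleftrightarrow> u \<in> fst H \<and> (AE x in \<mu>. (snd H u + M u) x = f x)"
      by (simp add: eq_diff_eq)
    finally show ?thesis .
  qed
  ultimately show ?thesis
    unfolding self_adjoint_def fst_eq snd_eq by blast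
qed

text \<open>The trial vector is \<open>u\<close>, and both evolutions are compared with the rotating
  vector \<open>e\<close>. One \<open>t * \<rho>\<close> is the drift of the unperturbed evolution,
  the other the loss when Re ip (k + m) u is replaced by Re ip m u; \<open>b + \<rho>\<close> bounds
  the norm of k + m.\<close>

lemma op_norm_evolution_ge:
  fixes W :: "'a \<Rightarrow> real" and r t :: real
  assumes sa: "self_adjoint \<mu> H" and W: "W \<in> borel_measurable \<mu>" "\<And>x. \<bar>W x\<bar> \<le> B"
    and u: "u \<in> fst H" and nu: "l2.nrm \<mu> u = 1" and t: "0 < t"
  defines "\<rho> \<equiv> l2.nrm \<mu> (snd H u - fscale (complex_of_real r) u)"
  defines "b \<equiv> l2.nrm \<mu> (\<lambda>x. complex_of_real (W x) * u x)"
  shows "ennreal (t * (\<integral>x. W x * (cmod (u x))\<^sup>2 \<partial>\<mu>) - 2 * t * \<rho> - t\<^sup>2 * (b + \<rho>)\<^sup>2)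
    \<le> op_norm \<mu> (\<lambda>f x. evolution \<mu> (add_potential H W) t f x - evolution \<mu> H t f x)"
proof -
  define HW where "HW = add_potential H W"
  have saW: "self_adjoint \<mu> HW"
    unfolding HW_def using sa W by (rule self_adjoint_add_potential)
  define m where "m = (\<lambda>x. complex_of_real (W x) * u x)"
  have uL: "u \<in> L2 \<mu>" and HuL: "snd H u \<in> L2 \<mu>"
    using self_adjointD(1,2)[OF sa] u by auto
  have mL: "m \<in> L2 \<mu>"
    unfolding m_def using W uL by (rule L2_mult_bounded)
  define k where "k = snd H u - fscale (complex_of_real r) u"
  have kL: "k \<in> L2 \<mu>" using uL HuL unfolding k_def by blast
  have snd_HW: "snd HW u - fscale (complex_of_real r) u = k + m"
    by (simp add: HW_def add_potential_def k_def m_def fun_eq_iff)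
  define e where "e = fscale (cis (- r * t)) u"
  define E where "E = evolution \<mu> H t u"
  define EW where "EW = evolution \<mu> HW t u"
  have L: "E \<in> L2 \<mu>" "EW \<in> L2 \<mu>" "e \<in> L2 \<mu>"
    using unitary_groupD(1)[OF evolution_spec(1)[OF sa] uL uL]
      unitary_groupD(1)[OF evolution_spec(1)[OF saW] uL uL] L2_fscale[OF uL]
    by (simp_all add: E_def EW_def e_def)
  have 1: "l2.nrm \<mu> (E - e) \<le> t * \<rho>"
    using rotation_estimates(1)[OF sa u t, of r] by (simp only: E_def e_def \<rho>_def)
  have "u \<in> fst HW" using u by (simp add: HW_def add_potential_def)
  from rotation_estimates(2)[OF saW this t, of r]
  have 2: "t * Re (L2_inner \<mu> (k + m) u) - (t * l2.nrm \<mu> (k + m))\<^sup>2 \<le> l2.nrm \<mu> (EW - e)"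
    by (simp only: snd_HW EW_def e_def nu mult_1_right)
  have 3: "l2.nrm \<mu> (k + m) \<le> b + \<rho>"
    using l2.nrm_triangle[OF kL mL] by (simp add: b_def \<rho>_def k_def m_def)
  have 4: "(\<integral>x. W x * (cmod (u x))\<^sup>2 \<partial>\<mu>) - \<rho> \<le> Re (L2_inner \<mu> (k + m) u)"
  proof -
    have "L2_inner \<mu> m u = (\<integral>x. complex_of_real (W x * (cmod (u x))\<^sup>2) \<partial>\<mu>)"
      unfolding L2_inner_def m_def
      by (intro Bochner_Integration.integral_cong refl) (simp only: of_real_mult complex_norm_square mult.assoc)
    then have "Re (L2_inner \<mu> m u) = (\<integral>x. W x * (cmod (u x))\<^sup>2 \<partial>\<mu>)"
      by (simp only: integral_complex_of_real Re_complex_of_real)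
    moreover have "- Re (L2_inner \<mu> k u) \<le> \<rho>"
      using l2.Cauchy_Schwarz[OF kL uL] abs_Re_le_cmod[of "L2_inner \<mu> k u"]
      by (simp add: nu \<rho>_def k_def)
    ultimately show ?thesis
      using kL mL uL by (simp add: l2.ip_add_left)
  qed
  have 5: "(t * l2.nrm \<mu> (k + m))\<^sup>2 \<le> t\<^sup>2 * (b + \<rho>)\<^sup>2"
    using 3 kL mL by (simp add: power_mult_distrib power_mono mult_left_mono)
  have 6: "t * ((\<integral>x. W x * (cmod (u x))\<^sup>2 \<partial>\<mu>) - \<rho>) \<le> t * Re (L2_inner \<mu> (k + m) u)"
    using 4 t by (intro mult_left_mono) auto
  have 7: "l2.nrm \<mu> (EW - e) \<le> l2.nrm \<mu> (EW - E) + l2.nrm \<mu> (E - e)"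
    using L by (intro l2.nrm_triangle_mid) auto
  have "t * (\<integral>x. W x * (cmod (u x))\<^sup>2 \<partial>\<mu>) - 2 * t * \<rho> - t\<^sup>2 * (b + \<rho>)\<^sup>2 \<le> l2.nrm \<mu> (EW - E)"
    using 1 2 5 6 7 by (simp add: right_diff_distrib)
  then have "ennreal (t * (\<integral>x. W x * (cmod (u x))\<^sup>2 \<partial>\<mu>) - 2 * t * \<rho> - t\<^sup>2 * (b + \<rho>)\<^sup>2)
      \<le> Lp_norm \<mu> 2 (\<lambda>x. EW x - E x)"
    using Lp_norm_diff[OF L(2,1)] by (simp add: ennreal_leI)
  also have "\<dots> \<le> op_norm \<mu> (\<lambda>f x. evolution \<mu> HW t f x - evolution \<mu> H t f x)"
    unfolding op_norm_def E_def EW_def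
    by (rule SUP_upper) (simp add: uL Lp_norm_2 nu)
  finally show ?thesis by (simp only: HW_def)
qed

section \<open>Smooth bump functions\<close>

lemma partial_eq: "(f has_derivative f') (at x) \<Longrightarrow> partial i f x = f' (axis i 1)"
  unfolding partial_def using frechet_derivative_at by metis

lemma Ck_on_SucI:
  assumes S: "open S" and f: "\<And>x. x \<in> S \<Longrightarrow> (f has_derivative f' x) (at x)"
    and k: "\<And>i. Ck_on k (\<lambda>x. partial i f x) S"
  shows "Ck_on (Suc k) f S"
proof -
  have "f differentiable_on S"
    unfolding differentiable_on_eq_differentiable_at[OF S] using f differentiable_def by blast
  then show ?thesis using k by simp
qed

lemma Ck_on_SucD:
  assumes "Ck_on (Suc k) f S" "open S" "x \<in> S"
  shows "(f has_derivative frechet_derivative f (at x)) (at x)"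
  using assms by (simp add: differentiable_on_eq_differentiable_at frechet_derivative_works)

lemma Ck_on_cong:
  assumes "open S" "\<And>x. x \<in> S \<Longrightarrow> f x = g x" "Ck_on k f S"
  shows "Ck_on k g S"
  using assms(2,3)
proof (induction k arbitrary: f g)
  case 0
  then show ?case using continuous_on_cong[of S S f g] by simp
next
  case (Suc k)
  have d: "(g has_derivative frechet_derivative f (at x)) (at x)" if "x \<in> S" for x
    using has_derivative_transform_within_open[OF Ck_on_SucD[OF Suc.prems(2) assms(1) that] assms(1) that] Suc.prems(1)
    by blast
  have "Ck_on k (partial i g) S" for i
  proof (rule Suc.IH)
    show "partial i f x = partial i g x" if "x \<in> S" for x
      using partial_eq[OF d[OF that]] by (simp add: partial_def)
    show "Ck_on k (partial i f) S" using Suc.prems(2) by simp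
  qed
  then show ?case using d by (intro Ck_on_SucI assms(1)) auto
qed

lemma Ck_on_SucI':
  assumes S: "open S" and f: "\<And>x. x \<in> S \<Longrightarrow> (f has_derivative f' x) (at x)"
    and k: "\<And>i. Ck_on k (\<lambda>x. f' x (axis i 1)) S"
  shows "Ck_on (Suc k) f S"
proof (rule Ck_on_SucI[OF S f])
  show "Ck_on k (partial i f) S" for i
    by (rule Ck_on_cong[OF S _ k]) (use partial_eq[OF f] in simp)
qed

lemma Ck_on_lower: "Ck_on (Suc k) f S \<Longrightarrow> Ck_on k f S"
  by (induction k arbitrary: f) (auto simp: differentiable_imp_continuous_on)

text \<open>For gluing a bump with the zero function over two overlapping open sets.\<close>

lemma Ck_on_Un:
  assumes "open S" "open T" "Ck_on k f S" "Ck_on k f T"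
  shows "Ck_on k f (S \<union> T)"
  using assms(3,4)
proof (induction k arbitrary: f)
  case 0
  then show ?case using continuous_on_open_Un assms(1,2) by simp
next
  case (Suc k)
  then show ?case
    using assms(1,2) by (auto simp: differentiable_on_eq_differentiable_at open_Un)
qed

lemma Ck_on_const: "open S \<Longrightarrow> Ck_on k (\<lambda>x. c) S"
proof (induction k arbitrary: c)
  case (Suc k)
  then show ?case by (intro Ck_on_SucI'[where f' = "\<lambda>x h. 0"]) auto
qed simp

lemma Ck_on_add:
  assumes S: "open S" and "Ck_on k f S" "Ck_on k g S"
  shows "Ck_on k (\<lambda>x. f x + g x) S"
  using assms(2,3)
proof (induction k arbitrary: f g)
  case 0
  then show ?case by (auto intro: continuous_intros)
next
  case (Suc k)
  show ?case
  proof (rule Ck_on_SucI'[OF S])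
    show "((\<lambda>x. f x + g x) has_derivative (\<lambda>h. frechet_derivative f (at x) h + frechet_derivative g (at x) h)) (at x)"
      if "x \<in> S" for x
      using Ck_on_SucD[OF Suc.prems(1) S that] Ck_on_SucD[OF Suc.prems(2) S that] by (rule has_derivative_add)
    show "Ck_on k (\<lambda>x. frechet_derivative f (at x) (axis i 1) + frechet_derivative g (at x) (axis i 1)) S" for i
      unfolding partial_def[symmetric] using Suc.prems by (intro Suc.IH) simp_all
  qed
qed

lemma Ck_on_sum:
  assumes "open S" "\<And>i. i \<in> I \<Longrightarrow> Ck_on k (f i) S"
  shows "Ck_on k (\<lambda>x. \<Sum>i\<in>I. f i x) S"
  using assms(2) by (induction I rule: infinite_finite_induct) (auto intro: Ck_on_const Ck_on_add assms(1))

lemma Ck_on_scaleR: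
  fixes f :: "real^'n::finite \<Rightarrow> real" and g :: "real^'n \<Rightarrow> 'b::real_normed_vector"
  assumes S: "open S" and "Ck_on k f S" "Ck_on k g S"
  shows "Ck_on k (\<lambda>x. f x *\<^sub>R g x) S"
  using assms(2,3)
proof (induction k arbitrary: f g)
  case 0
  then show ?case by (auto intro: continuous_intros)
next
  case (Suc k)
  show ?case
  proof (rule Ck_on_SucI'[OF S])
    show "((\<lambda>x. f x *\<^sub>R g x) has_derivative
        (\<lambda>h. f x *\<^sub>R frechet_derivative g (at x) h + frechet_derivative f (at x) h *\<^sub>R g x)) (at x)"
      if "x \<in> S" for x
      using Ck_on_SucD[OF Suc.prems(1) S that] Ck_on_SucD[OF Suc.prems(2) S that] by (rule has_derivative_scaleR)
    show "Ck_on k (\<lambda>x. f x *\<^sub>R frechet_derivative g (at x) (axis i 1) + frechet_derivative f (at x) (axis i 1) *\<^sub>R g x) S" for i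
      unfolding partial_def[symmetric]
      using Suc.prems Ck_on_lower[OF Suc.prems(1)] Ck_on_lower[OF Suc.prems(2)]
      by (intro Ck_on_add[OF S] Suc.IH) simp_all
  qed
qed

lemma Ck_on_mult:
  fixes f g :: "real^'n::finite \<Rightarrow> real"
  shows "\<lbrakk>open S; Ck_on k f S; Ck_on k g S\<rbrakk> \<Longrightarrow> Ck_on k (\<lambda>x. f x * g x) S"
  using Ck_on_scaleR[of S k f g] by simp

lemma Ck_on_diff:
  fixes f g :: "real^'n::finite \<Rightarrow> real"
  shows "\<lbrakk>open S; Ck_on k f S; Ck_on k g S\<rbrakk> \<Longrightarrow> Ck_on k (\<lambda>x. f x - g x) S"
  using Ck_on_add[of S k f "\<lambda>x. (-1) * g x"] Ck_on_mult[OF _ Ck_on_const, of S k g "-1"] by simp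

lemma Ck_on_prod:
  fixes f :: "'i \<Rightarrow> real^'n::finite \<Rightarrow> real"
  assumes "open S" "\<And>i. i \<in> I \<Longrightarrow> Ck_on k (f i) S"
  shows "Ck_on k (\<lambda>x. \<Prod>i\<in>I. f i x) S"
  using assms(2) by (induction I rule: infinite_finite_induct) (auto intro: Ck_on_const Ck_on_mult assms(1))

lemma Ck_on_nth:
  assumes S: "open S" and "Ck_on k f S"
  shows "Ck_on k (\<lambda>x. f x $ j) S"
  using assms(2)
proof (induction k arbitrary: f)
  case 0
  then show ?case by (auto intro: continuous_intros)
next
  case (Suc k)
  show ?case
  proof (rule Ck_on_SucI'[OF S])
    show "((\<lambda>x. f x $ j) has_derivative (\<lambda>h. frechet_derivative f (at x) h $ j)) (at x)" if "x \<in> S" for x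
      using bounded_linear.has_derivative[OF bounded_linear_vec_nth Ck_on_SucD[OF Suc.prems S that]] .
    show "Ck_on k (\<lambda>x. frechet_derivative f (at x) (axis i 1) $ j) S" for i
      unfolding partial_def[symmetric] using Suc.prems by (intro Suc.IH) simp
  qed
qed

lemma Ck_on_nth_id:
  fixes S :: "(real^'n::finite) set"
  shows "open S \<Longrightarrow> Ck_on k (\<lambda>x. x $ j) S"
proof (cases k)
  case (Suc m)
  assume S: "open S"
  show ?thesis
    unfolding Suc
  proof (rule Ck_on_SucI'[OF S])
    show "((\<lambda>x. x $ j) has_derivative (\<lambda>h. h $ j)) (at x)" for x :: "real^'n"
      using bounded_linear.has_derivative[OF bounded_linear_vec_nth has_derivative_ident] .
  qed (rule Ck_on_const[OF S])
qed (auto intro: continuous_intros)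

text \<open>Expanding the derivative of \<open>f\<close> in the standard basis writes each partial
  derivative of the composite as a sum of products with factors \<open>partial j f\<close> composed
  with \<open>T\<close>. The induction therefore runs over all \<open>f\<close> with
  \<open>T\<close> fixed.\<close>

lemma Ck_on_compose:
  fixes f :: "real^'m::finite \<Rightarrow> 'b::real_normed_vector" and T :: "real^'n::finite \<Rightarrow> real^'m"
  assumes S: "open S" and S': "open S'" and TS: "T ` S \<subseteq> S'" and "Ck_on k f S'" "Ck_on k T S"
  shows "Ck_on k (\<lambda>x. f (T x)) S"
  using assms(4,5)
proof (induction k arbitrary: f)
  case 0
  then show ?case using continuous_on_compose2[of S' f S T] TS by simp
next
  case (Suc k)
  show ?case
  proof (rule Ck_on_SucI'[OF S])
    fix x assume x: "x \<in> S"
    have "(f has_derivative frechet_derivative f (at (T x))) (at (T x))"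
      using Suc.prems(1) S' x TS by (intro Ck_on_SucD) auto
    note f = this
    then have lin: "linear (frechet_derivative f (at (T x)))"
      using has_derivative_linear by blast
    have expand: "frechet_derivative f (at (T x)) v = (\<Sum>j\<in>UNIV. v $ j *\<^sub>R partial j f (T x))" for v
    proof -
      have "v = (\<Sum>j\<in>UNIV. v $ j *\<^sub>R axis j 1)"
        using basis_expansion[of v] by (simp add: scalar_mult_eq_scaleR)
      then have "frechet_derivative f (at (T x)) v = frechet_derivative f (at (T x)) (\<Sum>j\<in>UNIV. v $ j *\<^sub>R axis j 1)"
        by simp
      also have "\<dots> = (\<Sum>j\<in>UNIV. v $ j *\<^sub>R partial j f (T x))"
        unfolding partial_def by (simp add: linear_sum[OF lin] linear_scale[OF lin])
      finally show ?thesis .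
    qed
    show "((\<lambda>x. f (T x)) has_derivative
        (\<lambda>h. \<Sum>j\<in>UNIV. frechet_derivative T (at x) h $ j *\<^sub>R partial j f (T x))) (at x)"
      using diff_chain_at[OF Ck_on_SucD[OF Suc.prems(2) S x] f]
      by (simp add: o_def expand)
  next
    fix i
    show "Ck_on k (\<lambda>x. \<Sum>j\<in>UNIV. frechet_derivative T (at x) (axis i 1) $ j *\<^sub>R partial j f (T x)) S"
    proof (intro Ck_on_sum Ck_on_scaleR S)
      fix j
      have "Ck_on k (\<lambda>x. partial i T x $ j) S"
        using Suc.prems(2) by (intro Ck_on_nth S) simp
      then show "Ck_on k (\<lambda>x. frechet_derivative T (at x) (axis i 1) $ j) S"
        by (simp add: partial_def)
      show "Ck_on k (\<lambda>x. partial j f (T x)) S"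
        using Suc.prems(1) Ck_on_lower[OF Suc.prems(2)] by (intro Suc.IH) simp_all
    qed
  qed
qed

text \<open>Derivatives of \<open>exp (-1/x)\<close> on the positive axis are polynomials in \<open>1/x\<close> times \<open>exp (-1/x)\<close>;
  this class of functions, extended by zero, is closed under differentiation.\<close>

definition flat_exp :: "real poly \<Rightarrow> real \<Rightarrow> real" where
  "flat_exp p x = (if 0 < x then poly p (1 / x) * exp (- 1 / x) else 0)"

lemma poly_div_exp_tendsto_0: "((\<lambda>y. poly p y / exp y) \<longlongrightarrow> 0) at_top" for p :: "real poly"
proof -
  have "((\<lambda>y. \<Sum>i\<le>degree p. coeff p i * (y ^ i / exp y)) \<longlongrightarrow> (\<Sum>i\<le>degree p. coeff p i * 0)) at_top"
    by (intro tendsto_intros tendsto_power_div_exp_0)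
  then show ?thesis by (simp add: poly_altdef sum_divide_distrib)
qed

text \<open>With y = 1/x, differentiating p(y) exp(-y) in x gives y^2 (p(y) - p'(y)) exp(-y), which
  explains the polynomial. At 0 from the right the difference quotient is y p(y) / exp y, which
  tends to 0 as y grows.\<close>

lemma DERIV_flat_exp: "DERIV (flat_exp p) x :> flat_exp (monom 1 2 * (p - pderiv p)) x"
proof (cases "x = 0")
  case False
  show ?thesis
  proof (cases "0 < x")
    case True
    have "DERIV (\<lambda>x. poly p (1 / x) * exp (- 1 / x)) x :> flat_exp (monom 1 2 * (p - pderiv p)) x"
      using True
      by (auto intro!: derivative_eq_intros simp: flat_exp_def poly_monom field_simps power2_eq_square)
    then show ?thesis
      by (rule has_field_derivative_transform_within_open[of _ _ _ "{0<..}"]) (use True in \<open>auto simp: flat_exp_def\<close>)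
  next
    case False
    with \<open>x \<noteq> 0\<close> have "x < 0" by simp
    have "DERIV (\<lambda>x. 0) x :> flat_exp (monom 1 2 * (p - pderiv p)) x"
      using \<open>x < 0\<close> by (simp add: flat_exp_def)
    then show ?thesis
      by (rule has_field_derivative_transform_within_open[of _ _ _ "{..<0}"]) (use \<open>x < 0\<close> in \<open>auto simp: flat_exp_def\<close>)
  qed
next
  case True
  have "((\<lambda>h. flat_exp p h / h) \<longlongrightarrow> 0) (at_right 0)"
  proof -
    have "((\<lambda>h. poly (monom 1 1 * p) (inverse h) / exp (inverse h)) \<longlongrightarrow> 0) (at_right (0::real))"
      by (rule filterlim_compose[OF poly_div_exp_tendsto_0 filterlim_inverse_at_top_right])
    then show ?thesis
    proof (rule Lim_transform_eventually)
      show "\<forall>\<^sub>F h in at_right 0. poly (monom 1 1 * p) (inverse h) / exp (inverse h) = flat_exp p h / h"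
        unfolding eventually_at_right_field
        by (intro exI[of _ 1]) (auto simp: flat_exp_def poly_monom exp_minus divide_inverse)
    qed
  qed
  moreover have "((\<lambda>h. flat_exp p h / h) \<longlongrightarrow> 0) (at_left 0)"
  proof (rule Lim_transform_eventually[OF tendsto_const])
    show "\<forall>\<^sub>F h in at_left 0. 0 = flat_exp p h / h"
      unfolding eventually_at_left_field by (intro exI[of _ "-1"]) (auto simp: flat_exp_def)
  qed
  ultimately have "((\<lambda>h. flat_exp p h / h) \<longlongrightarrow> 0) (at 0)"
    using filterlim_at_split by blast
  then show ?thesis
    unfolding True DERIV_def by (simp add: flat_exp_def)
qed

text \<open>The squared distance keeps the inner function polynomial, so the centre is no exception.
  All \<open>p\<close> are treated at once because each derivative changes the polynomial.\<close>

lemma Ck_on_flat_exp: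
  fixes y0 :: "real^'n::finite"
  shows "Ck_on k (\<lambda>y. flat_exp p (2 - (dist y y0)\<^sup>2 / r)) UNIV"
proof (induction k arbitrary: p)
  case 0
  have "continuous_on UNIV (flat_exp p)"
    using DERIV_flat_exp DERIV_isCont continuous_at_imp_continuous_on by blast
  then show ?case
    by simp (rule continuous_on_compose2[of UNIV "flat_exp p"], auto intro!: continuous_intros simp: divide_inverse)
next
  case (Suc k)
  let ?p = "monom 1 2 * (p - pderiv p)"
  show ?case
  proof (rule Ck_on_SucI')
    fix y :: "real^'n"
    have d: "((\<lambda>y. 2 - (dist y y0)\<^sup>2 / r) has_derivative (\<lambda>h. - 2 / r * ((y - y0) \<bullet> h))) (at y)"
      unfolding dist_norm power2_norm_eq_inner
      by (auto intro!: derivative_eq_intros simp: inner_commute divide_inverse algebra_simps)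
    show "((\<lambda>y. flat_exp p (2 - (dist y y0)\<^sup>2 / r)) has_derivative
        (\<lambda>h. flat_exp ?p (2 - (dist y y0)\<^sup>2 / r) * (- 2 / r * ((y - y0) \<bullet> h)))) (at y)"
      using has_derivative_compose[OF d DERIV_flat_exp[unfolded has_field_derivative_def]] .
  next
    fix i
    have "Ck_on k (\<lambda>y. flat_exp ?p (2 - (dist y y0)\<^sup>2 / r) * (- 2 / r * (y $ i - y0 $ i))) UNIV"
      using Suc.IH by (intro Ck_on_mult Ck_on_diff Ck_on_const Ck_on_nth_id open_UNIV)
    then show "Ck_on k (\<lambda>y. flat_exp ?p (2 - (dist y y0)\<^sup>2 / r) * (- 2 / r * ((y - y0) \<bullet> axis i 1))) UNIV"
      by (simp add: inner_axis)
  qed simp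
qed

lemma flat_exp_1_le: "x \<le> 2 \<Longrightarrow> flat_exp 1 x \<le> exp (- 1 / 2)"
  by (auto simp: flat_exp_def field_simps)

lemma flat_exp_1_ge: "1 \<le> x \<Longrightarrow> exp (- 1) \<le> flat_exp 1 x"
  by (auto simp: flat_exp_def field_simps)

lemma flat_exp_1_nonneg: "0 \<le> flat_exp 1 x"
  by (simp add: flat_exp_def)

lemma exists_smooth_bump:
  fixes K :: "(real^'n::finite) set"
  assumes K: "compact K" and V: "open V" and KV: "K \<subseteq> V"
  obtains h C where "smooth_on h UNIV" "\<And>y. 0 \<le> h y" "\<And>y. h y \<le> (1::real)"
    "\<And>y. y \<in> K \<Longrightarrow> exp (- 1 / 2) \<le> h y" "compact C" "C \<subseteq> V" "\<And>y. y \<notin> C \<Longrightarrow> h y = 0"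
proof -
  have "\<forall>y\<in>K. \<exists>r>0. cball y (2 * r) \<subseteq> V"
  proof
    fix y assume "y \<in> K"
    then obtain e where "0 < e" "cball y e \<subseteq> V"
      using V KV open_contains_cball by blast
    then show "\<exists>r>0. cball y (2 * r) \<subseteq> V" by (intro exI[of _ "e / 2"]) auto
  qed
  then obtain r where r: "\<And>y. y \<in> K \<Longrightarrow> 0 < r y" "\<And>y. y \<in> K \<Longrightarrow> cball y (2 * r y) \<subseteq> V"
    by metis
  obtain I where I: "I \<subseteq> K" "finite I" "K \<subseteq> (\<Union>y\<in>I. ball y (r y))"
  proof (rule compactE_image[OF K, of K "\<lambda>y. ball y (r y)"])
    show "K \<subseteq> (\<Union>y\<in>K. ball y (r y))"
      using r(1) by force
  qed auto
  \<comment> \<open>\<open>flat_exp 1\<close> is at most exp (-1/2) on arguments up to 2, whence the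
    normalising factor. Within distance r z the argument is at least 1, which leaves exp (1/2 - 1);
    beyond 2 r z it is negative and \<open>b\<close> vanishes.\<close>
  define b where "b z y = exp (1 / 2) * flat_exp 1 (2 - (dist y z)\<^sup>2 / (r z)\<^sup>2)" for z y
  \<comment> \<open>However many balls overlap, this stays in [0, 1] and is at least each single
    \<open>b z y\<close>.\<close>
  define h where "h y = 1 - (\<Prod>z\<in>I. 1 - b z y)" for y
  define C where "C = (\<Union>z\<in>I. cball z (2 * r z))"
  have b0: "0 \<le> b z y" for z y
    by (simp add: b_def flat_exp_1_nonneg)
  have b1: "b z y \<le> 1" for z y
  proof -
    have "flat_exp 1 (2 - (dist y z)\<^sup>2 / (r z)\<^sup>2) \<le> exp (- 1 / 2)"
      by (intro flat_exp_1_le) simp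
    then have "b z y \<le> exp (1 / 2) * exp (- 1 / 2)"
      unfolding b_def by (intro mult_left_mono) auto
    then show ?thesis by (simp add: exp_add[symmetric])
  qed
  have smooth: "smooth_on h UNIV"
    unfolding smooth_on_def h_def b_def
    by (intro allI Ck_on_diff Ck_on_prod Ck_on_mult Ck_on_const Ck_on_flat_exp open_UNIV)
  have P: "0 \<le> (\<Prod>z\<in>J. 1 - b z y)" "(\<Prod>z\<in>J. 1 - b z y) \<le> 1" for J y
    using b0 b1 by (auto intro!: prod_nonneg prod_le_1)
  have "exp (- 1 / 2) \<le> h y" if y: "y \<in> K" for y
  proof -
    obtain z where z: "z \<in> I" "dist z y < r z"
      using I(3) y by auto
    have rz: "0 < r z" using z I(1) r(1) by auto
    have "(dist y z)\<^sup>2 \<le> (r z)\<^sup>2"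
      using z by (intro power_mono) (auto simp: dist_commute)
    then have "(dist y z)\<^sup>2 / (r z)\<^sup>2 \<le> 1" using rz by simp
    then have "exp (- 1) \<le> flat_exp 1 (2 - (dist y z)\<^sup>2 / (r z)\<^sup>2)"
      by (intro flat_exp_1_ge) simp
    then have "exp (1 / 2) * exp (- 1) \<le> b z y"
      unfolding b_def by (intro mult_left_mono) auto
    then have bz: "exp (- 1 / 2) \<le> b z y" by (simp add: exp_add[symmetric])
    have "(\<Prod>z\<in>I. 1 - b z y) = (1 - b z y) * (\<Prod>z\<in>I - {z}. 1 - b z y)"
      using I(2) z(1) by (rule prod.remove)
    also have "\<dots> \<le> (1 - b z y) * 1"
      using P b1 by (intro mult_left_mono) auto
    finally show ?thesis using bz by (simp add: h_def)
  qed
  moreover have "h y = 0" if "y \<notin> C" for y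
  proof -
    have "b z y = 0" if z: "z \<in> I" for z
    proof -
      have rz: "0 < r z" using z I(1) r(1) by auto
      have "2 * r z < dist y z"
        using \<open>y \<notin> C\<close> z by (auto simp: C_def dist_commute)
      then have "(2 * r z)\<^sup>2 \<le> (dist y z)\<^sup>2"
        using rz by (intro power_mono) auto
      then have "4 \<le> (dist y z)\<^sup>2 / (r z)\<^sup>2"
        using rz by (simp add: pos_le_divide_eq power_mult_distrib)
      then show ?thesis by (simp add: b_def flat_exp_def)
    qed
    then show ?thesis by (simp add: h_def)
  qed
  moreover have "compact C" "C \<subseteq> V"
    using I(1,2) r(2) by (auto simp: C_def intro!: compact_UN)
  ultimately show ?thesis
    using that[of h C] smooth P by (simp add: h_def)
qed

section \<open>Cutoffs around null sets on manifolds\<close>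

lemma smooth_on_continuous: "smooth_on f S \<Longrightarrow> continuous_on S f"
  unfolding smooth_on_def by (metis Ck_on.simps(1))

lemma is_chartD:
  assumes "is_chart c"
  shows "open (fst c)" "open (chart_image c)" "continuous_on (fst c) (snd c)"
    "continuous_on (chart_image c) (chart_inv c)"
    "x \<in> fst c \<Longrightarrow> snd c x \<in> chart_image c" "x \<in> fst c \<Longrightarrow> chart_inv c (snd c x) = x"
    "y \<in> chart_image c \<Longrightarrow> chart_inv c y \<in> fst c" "y \<in> chart_image c \<Longrightarrow> snd c (chart_inv c y) = y"
  using assms unfolding is_chart_def homeomorphism_def by auto

lemma is_chart_open_image:
  assumes c: "is_chart c" and S: "open S" "S \<subseteq> fst c"
  shows "open (snd c ` S)"
proof -
  have "openin (top_of_set (fst c)) S"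
    using S is_chartD(1)[OF c] by (simp add: openin_open_eq)
  then have "openin (top_of_set (chart_image c)) (snd c ` S)"
    using c homeomorphism_imp_open_map unfolding is_chart_def by blast
  then show ?thesis
    using is_chartD(2)[OF c] by (simp add: openin_open_eq)
qed

text \<open>The preimage \<open>N\<close> of \<open>C\<close> is compact, hence closed in a
  Hausdorff space. In any chart the overlap with \<open>c\<close> and the complement of
  \<open>N\<close> are thus two open pieces covering everything; on the first the function is
  \<open>h\<close> after a change of charts, on the second it is zero.\<close>

lemma smooth_fun_extend_by_zero:
  fixes A :: "('a::t2_space, 'n::finite) chart set"
  assumes A: "smooth_atlas A" and c: "c \<in> A" and h: "smooth_on h UNIV"
    and C: "compact C" "C \<subseteq> chart_image c" and h0: "\<And>y. y \<notin> C \<Longrightarrow> h y = (0::real)"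
  defines "f \<equiv> \<lambda>x. if x \<in> fst c then h (snd c x) else 0"
  shows "smooth_fun A f" "continuous_on UNIV f" "vanishes_at_infinity f"
proof -
  define N where "N = chart_inv c ` C"
  have chart: "is_chart d" if "d \<in> A" for d
    using A that by (auto simp: smooth_atlas_def)
  note c' = is_chartD[OF chart[OF c]]
  have "compact N"
    unfolding N_def using C continuous_on_subset[OF c'(4)] by (intro compact_continuous_image) auto
  then have N: "closed N" by (rule compact_imp_closed)
  have N_sub: "N \<subseteq> fst c"
    using C(2) c'(7) by (auto simp: N_def)
  have f0: "f x = 0" if "x \<notin> N" for x
  proof (cases "x \<in> fst c")
    case True
    have "snd c x \<notin> C"
      using that c'(6)[OF True] by (force simp: N_def)
    then show ?thesis by (simp add: f_def h0)
  qed (simp add: f_def)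
  have h_cont: "continuous_on UNIV h" using h by (rule smooth_on_continuous)
  show "vanishes_at_infinity f"
    unfolding vanishes_at_infinity_def using \<open>compact N\<close> f0 by (intro allI impI exI[of _ N]) auto
  have "continuous_on (fst c) f"
  proof -
    have "continuous_on (fst c) (\<lambda>x. h (snd c x))"
      using continuous_on_compose2[OF h_cont c'(3)] by simp
    then show ?thesis by (rule continuous_on_eq) (simp add: f_def)
  qed
  moreover have "continuous_on (- N) f"
    by (rule continuous_on_eq[OF continuous_on_const]) (simp add: f0)
  ultimately have "continuous_on (fst c \<union> - N) f"
    using c'(1) N by (intro continuous_on_open_Un) auto
  moreover have "fst c \<union> - N = UNIV"
    using N_sub by auto
  ultimately show "continuous_on UNIV f" by simp
  show "smooth_fun A f"
    unfolding smooth_fun_def smooth_on_def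
  proof (intro ballI allI)
    fix d k assume d: "d \<in> A"
    note d' = is_chartD[OF chart[OF d]]
    define S1 where "S1 = snd d ` (fst d \<inter> fst c)"
    define S2 where "S2 = snd d ` (fst d - N)"
    have open1: "open S1" and open2: "open S2"
      unfolding S1_def S2_def using d'(1) c'(1) N
      by (auto intro!: is_chart_open_image[OF chart[OF d]])
    have "Ck_on k (f \<circ> chart_inv d) S1"
    proof -
      have T: "Ck_on k (snd c \<circ> chart_inv d) S1"
        using A c d unfolding smooth_atlas_def smooth_on_def S1_def by blast
      have "Ck_on k (\<lambda>y. h ((snd c \<circ> chart_inv d) y)) S1"
        using h unfolding smooth_on_def by (intro Ck_on_compose[OF open1 open_UNIV subset_UNIV _ T]) blast
      then show ?thesis
        by (rule Ck_on_cong[OF open1, rotated]) (auto simp: S1_def f_def d')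
    qed
    moreover have "Ck_on k (f \<circ> chart_inv d) S2"
      by (rule Ck_on_cong[OF open2 _ Ck_on_const[OF open2, of k 0]]) (auto simp: S2_def f0 d')
    ultimately have "Ck_on k (f \<circ> chart_inv d) (S1 \<union> S2)"
      by (rule Ck_on_Un[OF open1 open2])
    moreover have "S1 \<union> S2 = chart_image d"
      using N_sub by (auto simp: S1_def S2_def chart_image_def)
    ultimately show "Ck_on k (f \<circ> chart_inv d) (chart_image d)" by simp
  qed
qed

text \<open>A Borel witness against absolute continuity is localised to one chart and cut down to a
  compact set, around which compactly supported bumps can shrink.\<close>

lemma exists_compact_null_in_chart:
  fixes A :: "('a::{t2_space, second_countable_topology}, 'n::finite) chart set"
  assumes A: "smooth_atlas A" and nu: "sets \<nu> = sets borel" "finite_measure \<nu>"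
    and mu: "sets \<mu> = sets borel" and not_ac: "\<not> absolutely_continuous \<mu> \<nu>"
  obtains c K where "c \<in> A" "compact K" "K \<subseteq> chart_image c"
    "chart_inv c ` K \<in> null_sets \<mu>" "0 < emeasure \<nu> (chart_inv c ` K)"
proof -
  obtain B where B: "B \<in> null_sets \<mu>" "B \<notin> null_sets \<nu>"
    using not_ac by (auto simp: absolutely_continuous_def)
  have Bs: "B \<in> sets borel" using B(1) mu by auto
  have chart: "is_chart d" if "d \<in> A" for d
    using A that by (auto simp: smooth_atlas_def)
  have "\<exists>c\<in>A. B \<inter> fst c \<notin> null_sets \<nu>"
  proof (rule ccontr)
    assume *: "\<not> (\<exists>c\<in>A. B \<inter> fst c \<notin> null_sets \<nu>)"
    \<comment> \<open>By second countability countably many chart domains cover, so if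
      \<open>B\<close> were \<nu>-null in each chart it would be \<nu>-null.\<close>
    obtain F where F: "F \<subseteq> fst ` A" "countable F" "\<Union>F = \<Union>(fst ` A)"
      using Lindelof[of "fst ` A"] chart is_chartD(1) by blast
    have "(\<Union>S\<in>F. B \<inter> S) \<in> null_sets \<nu>"
      using F(1,2) * by (intro null_sets_UN') auto
    moreover have "(\<Union>S\<in>F. B \<inter> S) = B"
      using F(3) A by (auto simp: smooth_atlas_def)
    ultimately show False using B(2) by simp
  qed
  then obtain c where c: "c \<in> A" "B \<inter> fst c \<notin> null_sets \<nu>" by blast
  note c' = is_chartD[OF chart[OF c(1)]]
  define E where "E = {y \<in> chart_image c. chart_inv c y \<in> B}"
  define \<nu>' where "\<nu>' = restrict_space \<nu> (fst c)"
  \<comment> \<open>The part of \<nu> in the chart is carried to Euclidean space, where inner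
    regularity supplies the compact set.\<close>
  define M where "M = distr \<nu>' borel (snd c)"
  have U: "fst c \<in> sets \<nu>" using c'(1) nu(1) by simp
  have sp: "space \<nu> = UNIV" using sets_eq_imp_space_eq[OF nu(1)] by simp
  have sp': "space \<nu>' = fst c" using U by (simp add: \<nu>'_def space_restrict_space sp)
  have meas: "snd c \<in> measurable \<nu>' borel"
  proof -
    have "snd c \<in> borel_measurable (restrict_space borel (fst c))"
      using c'(3) by (rule borel_measurable_continuous_on_restrict)
    moreover have "sets \<nu>' = sets (restrict_space borel (fst c))"
      unfolding \<nu>'_def using nu(1) by (rule sets_restrict_space_cong)
    ultimately show ?thesis by (simp cong: measurable_cong_sets)
  qed
  have E_sets: "E \<in> sets borel"
  proof -
    have "chart_inv c \<in> borel_measurable (restrict_space borel (chart_image c))"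
      using c'(4) by (rule borel_measurable_continuous_on_restrict)
    then have "chart_inv c -` B \<inter> space (restrict_space borel (chart_image c)) \<in> sets (restrict_space borel (chart_image c))"
      using Bs by (rule measurable_sets)
    moreover have "chart_inv c -` B \<inter> space (restrict_space borel (chart_image c)) = E"
      by (auto simp: E_def space_restrict_space)
    ultimately show ?thesis
      using c'(2) by (simp add: sets_restrict_space_iff)
  qed
  have M_eq: "emeasure M D = emeasure \<nu> (chart_inv c ` D)" if D: "D \<in> sets borel" "D \<subseteq> chart_image c" for D
  proof -
    have pre: "snd c -` D \<inter> fst c = chart_inv c ` D"
      using D(2) c' by (force simp: image_iff)
    have "emeasure M D = emeasure \<nu>' (snd c -` D \<inter> fst c)"
      unfolding M_def using meas D(1) by (simp add: emeasure_distr sp')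
    also have "\<dots> = emeasure \<nu> (snd c -` D \<inter> fst c)"
      unfolding \<nu>'_def using U by (intro emeasure_restrict_space) (auto simp: sp)
    finally show ?thesis by (simp add: pre)
  qed
  have inv_E: "chart_inv c ` E = B \<inter> fst c"
    using c' by (force simp: E_def image_iff)
  have "emeasure \<nu> (B \<inter> fst c) \<noteq> 0"
    using c(2) U Bs nu(1) by (auto simp: null_sets_def)
  then have "0 < emeasure M E"
    using M_eq[OF E_sets] inv_E by (auto simp: E_def zero_less_iff_neq_zero)
  moreover have "emeasure M E = (SUP K\<in>{K. K \<subseteq> E \<and> compact K}. emeasure M K)"
  proof (rule inner_regular)
    show "sets M = sets borel" by (simp add: M_def)
    have "finite_measure M"
      unfolding M_def \<nu>'_def using meas finite_measure_restrict_space[OF nu(2)] U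
      by (intro finite_measure.finite_measure_distr) (auto simp: \<nu>'_def sp)
    then show "emeasure M (space M) \<noteq> \<infinity>"
      by (simp add: finite_measure.emeasure_finite)
  qed (rule E_sets)
  ultimately obtain K where K: "K \<subseteq> E" "compact K" "0 < emeasure M K"
    by (auto simp: less_SUP_iff)
  have KB: "K \<in> sets borel" "K \<subseteq> chart_image c"
    using K by (auto simp: E_def compact_imp_closed)
  have "chart_inv c ` K \<in> sets borel"
    using compact_continuous_image[OF continuous_on_subset[OF c'(4) KB(2)] K(2)]
    by (simp add: compact_imp_closed)
  then have "chart_inv c ` K \<in> null_sets \<mu>"
    using K(1) by (intro null_sets_subset[OF B(1)]) (auto simp: E_def mu)
  then show ?thesis
    using that[of c K] c(1) K KB M_eq[OF KB] by simp
qed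

lemma continuous_on_det:
  fixes f :: "'a::topological_space \<Rightarrow> real^'n::finite^'n"
  shows "continuous_on S f \<Longrightarrow> continuous_on S (\<lambda>x. det (f x))"
  unfolding det_def by (intro continuous_intros)

lemma continuous_on_volume_density:
  assumes g: "riemannian_metric A g" and c: "c \<in> A"
  shows "continuous_on (chart_image c) (volume_density g c)"
proof -
  have "continuous_on (chart_image c) (g c \<circ> chart_inv c)"
    using g c by (intro smooth_on_continuous) (simp add: riemannian_metric_def)
  then have "continuous_on (chart_image c) (\<lambda>y. sqrt (det ((g c \<circ> chart_inv c) y)))"
    by (intro continuous_on_real_sqrt continuous_on_det)
  then show ?thesis by (simp add: volume_density_def[abs_def])
qed

lemma exists_shrinking_bumps:
  fixes A :: "('a::{t2_space, second_countable_topology}, 'n::finite) chart set"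
  assumes manifold: "riemannian_manifold A g" and volume: "riemannian_volume A g \<mu>"
    and c: "c \<in> A" and K: "compact K" "K \<subseteq> chart_image c" "K \<noteq> {}"
    and null: "chart_inv c ` K \<in> null_sets \<mu>"
  obtains G w where "\<And>i. G i \<in> sets \<mu>" "decseq G" "(\<Inter>i. G i) = chart_inv c ` K"
    "(\<lambda>i. emeasure \<mu> (G i)) \<longlonglongrightarrow> 0" "\<And>i. emeasure \<mu> (G i) < \<infinity>"
    "\<And>i. smooth_fun A (w i)" "\<And>i. continuous_on UNIV (w i)" "\<And>i. vanishes_at_infinity (w i)"
    "\<And>i x. 0 \<le> w i x" "\<And>i x. w i x \<le> 1" "\<And>i x. x \<notin> G i \<Longrightarrow> w i x = 0"
    "\<And>i x. x \<in> chart_inv c ` K \<Longrightarrow> exp (- 1 / 2) \<le> w i x"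
proof -
  have A: "smooth_atlas A" and g: "riemannian_metric A g"
    using manifold by (auto simp: riemannian_manifold_def)
  have chart: "is_chart c" using A c by (auto simp: smooth_atlas_def)
  note c' = is_chartD[OF chart]
  have mu: "sets \<mu> = sets borel" using volume by (simp add: riemannian_volume_def)
  \<comment> \<open>A closed distance tube \<open>L\<close> around \<open>K\<close> still inside the
    chart image: it is compact and contains all the shrinking tubes \<open>V i\<close>.\<close>
  obtain \<delta> where \<delta>: "0 < \<delta>" "{y. infdist y K \<le> \<delta>} \<subseteq> chart_image c"
    using compact_in_open_separated[OF K(3,1) c'(2) K(2)] by blast
  define L where "L = {y. infdist y K \<le> \<delta>}"
  have L: "compact L" "L \<subseteq> chart_image c"
    using compact_infdist_le[OF K(3,1) \<delta>(1)] \<delta>(2) by (auto simp: L_def)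
  define V where "V i = {y. infdist y K < \<delta> / real (Suc i)}" for i
  have V_open: "open (V i)" for i
    unfolding V_def by (intro open_Collect_less continuous_intros)
  have KV: "K \<subseteq> V i" for i
    using \<delta>(1) by (auto simp: V_def)
  have V_L: "V i \<subseteq> L" for i
  proof
    fix y assume "y \<in> V i"
    then have "infdist y K < \<delta> / real (Suc i)" by (simp add: V_def)
    also have "\<dots> \<le> \<delta> / 1" using \<delta>(1) by (intro divide_left_mono) auto
    finally show "y \<in> L" by (simp add: L_def)
  qed
  have V_image: "V i \<subseteq> chart_image c" for i
    using V_L L(2) by blast
  define G where "G i = chart_inv c ` V i" for i
  have G_eq: "G i = fst c \<inter> snd c -` V i" for i
    using V_image[of i] c' by (force simp: G_def image_iff)
  have G_open: "open (G i)" for i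
    unfolding G_eq using c'(1,3) V_open by (simp add: continuous_open_preimage)
  have G_sets: "G i \<in> sets \<mu>" for i using G_open by (simp add: mu)
  have V_dec: "V j \<subseteq> V i" if "i \<le> j" for i j
  proof
    fix y assume "y \<in> V j"
    then have "infdist y K < \<delta> / real (Suc j)" by (simp add: V_def)
    also have "\<dots> \<le> \<delta> / real (Suc i)" using \<delta>(1) that by (intro divide_left_mono) auto
    finally show "y \<in> V i" by (simp add: V_def)
  qed
  then have G_dec: "decseq G"
    unfolding decseq_def G_def by blast
  have V_Int: "(\<Inter>i. V i) = K"
  proof
    show "(\<Inter>i. V i) \<subseteq> K"
    proof
      fix y assume "y \<in> (\<Inter>i. V i)"
      then have "infdist y K \<le> \<delta> * inverse (real (Suc i))" for i
        by (auto simp: V_def divide_inverse less_imp_le)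
      moreover have "(\<lambda>i. \<delta> * inverse (real (Suc i))) \<longlonglongrightarrow> \<delta> * 0"
        by (intro tendsto_intros LIMSEQ_inverse_real_of_nat)
      ultimately have "infdist y K \<le> \<delta> * 0"
        by (intro tendsto_lowerbound[of _ "\<delta> * 0" sequentially]) auto
      then have "infdist y K = 0" using infdist_nonneg[of y K] by simp
      then show "y \<in> K"
        using in_closed_iff_infdist_zero[OF compact_imp_closed[OF K(1)] K(3)] by simp
    qed
  qed (use KV in auto)
  have G_Int: "(\<Inter>i. G i) = chart_inv c ` K"
  proof -
    have "(\<Inter>i. G i) = fst c \<inter> snd c -` (\<Inter>i. V i)" by (auto simp: G_eq)
    also have "\<dots> = chart_inv c ` K"
      unfolding V_Int using K(2) c' by (force simp: image_iff)
    finally show ?thesis .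
  qed
  \<comment> \<open>The total volume may be infinite, but the density is continuous, hence bounded,
    on the compact tube \<open>L\<close>. Finiteness feeds continuity from above, by which the
    volumes tend to that of the null set.\<close>
  have fin: "emeasure \<mu> (G i) < \<infinity>" for i
  proof -
    have "continuous_on L (volume_density g c)"
      using continuous_on_volume_density[OF g c] L(2) by (rule continuous_on_subset)
    then have "bounded (volume_density g c ` L)"
      using L(1) by (intro compact_imp_bounded compact_continuous_image)
    then obtain b where b: "\<And>y. y \<in> L \<Longrightarrow> \<bar>volume_density g c y\<bar> \<le> b"
      unfolding bounded_iff by (metis imageI real_norm_def)
    have "G i \<subseteq> fst c" by (auto simp: G_eq)
    then have "emeasure \<mu> (G i) = (\<integral>\<^sup>+y\<in>snd c ` G i. ennreal (volume_density g c y) \<partial>lborel)"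
      using volume c borel_open[OF G_open[of i]] by (simp add: riemannian_volume_def)
    also have "snd c ` G i = V i"
      using V_image[of i] c' by (force simp: G_def image_iff)
    also have "(\<integral>\<^sup>+y\<in>V i. ennreal (volume_density g c y) \<partial>lborel) \<le> (\<integral>\<^sup>+y. ennreal b * indicator L y \<partial>lborel)"
    proof (intro nn_integral_mono)
      fix y
      show "ennreal (volume_density g c y) * indicator (V i) y \<le> ennreal b * indicator L y"
        using b[of y] V_L[of i] by (auto split: split_indicator intro!: ennreal_leI)
    qed
    also have "\<dots> = ennreal b * emeasure lborel L"
      using L(1) by (intro nn_integral_cmult_indicator) (simp add: compact_imp_closed)
    also have "\<dots> < \<infinity>"
      using emeasure_bounded_finite[OF compact_imp_bounded[OF L(1)]]
      by (simp add: ennreal_mult_less_top)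
    finally show ?thesis .
  qed
  have lim: "(\<lambda>i. emeasure \<mu> (G i)) \<longlonglongrightarrow> 0"
  proof -
    have "(\<lambda>i. emeasure \<mu> (G i)) \<longlonglongrightarrow> emeasure \<mu> (\<Inter>i. G i)"
      using G_sets fin by (intro Lim_emeasure_decseq G_dec) (auto simp: less_top[symmetric])
    then show ?thesis
      unfolding G_Int using null by (simp add: null_setsD1)
  qed
  have "\<forall>i. \<exists>h C. smooth_on h UNIV \<and> (\<forall>y. 0 \<le> h y) \<and> (\<forall>y. h y \<le> (1::real)) \<and>
      (\<forall>y\<in>K. exp (- 1 / 2) \<le> h y) \<and> compact C \<and> C \<subseteq> V i \<and> (\<forall>y. y \<notin> C \<longrightarrow> h y = 0)"
    using exists_smooth_bump[OF K(1) V_open KV] by metis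
  then obtain h C where hC: "\<And>i. smooth_on (h i) UNIV" "\<And>i y. 0 \<le> h i y" "\<And>i y. h i y \<le> (1::real)"
      "\<And>i y. y \<in> K \<Longrightarrow> exp (- 1 / 2) \<le> h i y" "\<And>i. compact (C i)" "\<And>i. C i \<subseteq> V i"
      "\<And>i y. y \<notin> C i \<Longrightarrow> h i y = 0"
    by metis
  define w where "w i = (\<lambda>x. if x \<in> fst c then h i (snd c x) else 0)" for i
  note ext = smooth_fun_extend_by_zero[OF A c hC(1) hC(5) order_trans[OF hC(6) V_image] hC(7)]
  show ?thesis
  proof (rule that[of G w])
    show "smooth_fun A (w i)" "continuous_on UNIV (w i)" "vanishes_at_infinity (w i)" for i
      unfolding w_def using ext by blast+
    show "0 \<le> w i x" "w i x \<le> 1" for i x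
      using hC(2,3) by (auto simp: w_def)
    show "w i x = 0" if "x \<notin> G i" for i x
      using that hC(6)[of i] hC(7)[of "snd c x" i] by (auto simp: w_def G_eq)
    show "exp (- 1 / 2) \<le> w i x" if "x \<in> chart_inv c ` K" for i x
      using that K(2) hC(4) c' by (auto simp: w_def)
  qed (use G_sets G_dec G_Int lim fin in auto)
qed

section \<open>Superposition of scales\<close>

lemma liminf_pos:
  fixes f :: "nat \<Rightarrow> ennreal"
  assumes "0 < d" "\<forall>\<^sub>F k in sequentially. ennreal d \<le> f k"
  shows "0 < liminf f"
proof -
  have "ennreal d \<le> liminf f"
    using assms(2) by (rule Liminf_bounded)
  then show ?thesis
    using assms(1) by (metis ennreal_less_zero_iff order_less_le_trans)
qed

text \<open>A power |W|^p of a function below an indicator is below the same indicator, so the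
  measure of \<open>G k\<close> controls every exponent at once.\<close>

lemma Lp_norm_tendsto_0:
  fixes W :: "nat \<Rightarrow> 'a \<Rightarrow> real"
  assumes p: "1 \<le> p" and G: "\<And>k. G k \<in> sets \<mu>" "(\<lambda>k. emeasure \<mu> (G k)) \<longlonglongrightarrow> 0" "\<And>k. emeasure \<mu> (G k) < \<infinity>"
    and W: "\<And>k x. \<bar>W k x\<bar> \<le> indicator (G k) x"
  shows "(\<lambda>k. Lp_norm \<mu> p (W k)) \<longlonglongrightarrow> 0"
proof -
  define I where "I k = (\<integral>\<^sup>+x. ennreal (norm (W k x) powr p) \<partial>\<mu>)" for k
  have le: "I k \<le> emeasure \<mu> (G k)" for k
  proof -
    have "I k \<le> (\<integral>\<^sup>+x. indicator (G k) x \<partial>\<mu>)"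
      unfolding I_def
    proof (rule nn_integral_mono)
      fix x
      have "\<bar>W k x\<bar> powr p \<le> indicator (G k) x"
        using W[of k x] p powr_mono2[of p "\<bar>W k x\<bar>" 1] by (auto split: split_indicator_asm)
      then have "ennreal (\<bar>W k x\<bar> powr p) \<le> ennreal (indicator (G k) x)"
        by (rule ennreal_leI)
      then show "ennreal (norm (W k x) powr p) \<le> indicator (G k) x"
        by (simp add: ennreal_indicator)
    qed
    then show ?thesis using G(1) by simp
  qed
  have fin: "I k < \<infinity>" for k
    using le[of k] G(3)[of k] by (rule order_le_less_trans)
  have "I \<longlonglongrightarrow> 0"
    by (rule tendsto_sandwich[OF _ _ tendsto_const G(2)]) (auto simp: le)
  then have "(\<lambda>k. enn2real (I k)) \<longlonglongrightarrow> 0"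
    by (intro tendsto_enn2real) simp_all
  then have "(\<lambda>k. enn2real (I k) powr (1 / p)) \<longlonglongrightarrow> 0"
    using p by (intro tendsto_zero_powrI[OF _ tendsto_const]) auto
  then have "(\<lambda>k. ennreal (enn2real (I k) powr (1 / p))) \<longlonglongrightarrow> 0"
    using tendsto_ennrealI by fastforce
  moreover have "Lp_norm \<mu> p (W k) = ennreal (enn2real (I k) powr (1 / p))" for k
    using fin[of k] by (simp add: Lp_norm_def Let_def I_def)
  ultimately show ?thesis by simp
qed

lemma smooth_fun_sum:
  assumes A: "smooth_atlas A" and w: "\<And>i. i \<in> I \<Longrightarrow> smooth_fun A (w i)"
  shows "smooth_fun A (\<lambda>x. \<Sum>i\<in>I. a i * w i x)"
  unfolding smooth_fun_def smooth_on_def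
proof (intro ballI allI)
  fix c k assume c: "c \<in> A"
  then have op: "open (chart_image c)"
    using A by (intro is_chartD(2)) (simp add: smooth_atlas_def)
  have "Ck_on k (\<lambda>y. w i (chart_inv c y)) (chart_image c)" if "i \<in> I" for i
    using w[OF that] c unfolding smooth_fun_def smooth_on_def o_def by blast
  then show "Ck_on k ((\<lambda>x. \<Sum>i\<in>I. a i * w i x) \<circ> chart_inv c) (chart_image c)"
    unfolding o_def by (intro Ck_on_sum Ck_on_mult Ck_on_const op)
qed

text \<open>The index \<open>2 * k - l\<close> is at least \<open>k\<close>, so the supports shrink, and increases as the amplitude does.\<close>

definition stacked :: "(nat \<Rightarrow> 'a \<Rightarrow> real) \<Rightarrow> nat \<Rightarrow> 'a \<Rightarrow> real" where
  "stacked w k x = (\<Sum>l\<le>k. (1 / 2) ^ Suc l * w (2 * k - l) x)"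

lemma geometric_half_le: "(\<Sum>l\<in>{a..b}. (1 / 2) ^ Suc l) \<le> ((1 / 2) ^ a :: real)"
proof (cases "a \<le> b")
  case True
  then obtain d where b: "b = a + d" using le_Suc_ex by blast
  have "(\<Sum>l\<in>{a..a + d}. (1 / 2) ^ Suc l) = (1 / 2) ^ a - (1 / 2 :: real) ^ Suc (a + d)"
    by (induction d) auto
  then show ?thesis by (simp add: b)
qed simp

lemma stacked_bounds:
  assumes w: "\<And>i x. 0 \<le> w i x" "\<And>i x. w i x \<le> (1::real)"
  shows "0 \<le> stacked w k x" "stacked w k x \<le> 1"
proof -
  show "0 \<le> stacked w k x"
    unfolding stacked_def using w by (intro sum_nonneg) auto
  have "stacked w k x \<le> (\<Sum>l\<le>k. (1 / 2) ^ Suc l * 1)"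
    unfolding stacked_def using w by (intro sum_mono mult_left_mono) auto
  also have "\<dots> \<le> 1"
    using geometric_half_le[of 0 k] by (simp add: atMost_atLeast0)
  finally show "stacked w k x \<le> 1" .
qed

text \<open>The stack is split at level \<open>l0\<close>. The layers from \<open>l0\<close> on sum
  to at most (1/2)^l0 in all. The stronger ones have a sum q in [0, 1], and q^2 \<le> q keeps their
  contribution linear in \<open>w\<close>, so that it can be integrated against |u|^2 layer by
  layer.\<close>

lemma stacked_split:
  assumes w: "\<And>i x. 0 \<le> w i x" "\<And>i x. w i x \<le> (1::real)" and lk: "l0 \<le> k"
  shows "(1 / 2) ^ Suc l0 * w (2 * k - l0) x \<le> stacked w k x"
    and "(stacked w k x)\<^sup>2 \<le> 2 * ((1 / 2) ^ l0)\<^sup>2 + 2 * (\<Sum>l<l0. (1 / 2) ^ Suc l * w (2 * k - l) x)"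
proof -
  define f where "f l = (1 / 2) ^ Suc l * w (2 * k - l) x" for l
  have f0: "0 \<le> f l" for l using w by (simp add: f_def)
  have f1: "f l \<le> (1 / 2) ^ Suc l" for l
    using w(2)[of "2 * k - l" x] by (simp add: f_def mult_left_le)
  have S: "stacked w k x = (\<Sum>l\<le>k. f l)" by (simp add: stacked_def f_def)
  show "(1 / 2) ^ Suc l0 * w (2 * k - l0) x \<le> stacked w k x"
    unfolding S f_def[symmetric] using lk f0 by (intro member_le_sum) auto
  define p where "p = (\<Sum>l\<in>{l0..k}. f l)"
  define q where "q = (\<Sum>l<l0. f l)"
  have "{..k} = {l0..k} \<union> {..<l0}" using lk by auto
  then have pq: "stacked w k x = p + q"
    unfolding S p_def q_def by (simp add: sum.union_disjoint disjoint_iff)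
  have p0: "0 \<le> p" and q0: "0 \<le> q"
    unfolding p_def q_def using f0 by (auto intro: sum_nonneg)
  have "p \<le> (\<Sum>l\<in>{l0..k}. (1 / 2) ^ Suc l)"
    unfolding p_def using f1 by (intro sum_mono)
  then have p1: "p \<le> (1 / 2) ^ l0"
    using geometric_half_le[of l0 k] by linarith
  have "q \<le> 1"
    using pq stacked_bounds(2)[of w k x] w p0 by simp
  then have q1: "q\<^sup>2 \<le> q"
    using q0 by (simp add: power2_eq_square mult_left_le)
  have "p\<^sup>2 \<le> ((1 / 2) ^ l0)\<^sup>2"
    using p1 p0 by (rule power_mono)
  moreover have "(p + q)\<^sup>2 \<le> 2 * p\<^sup>2 + 2 * q\<^sup>2"
    using sum_squares_bound[of p q] by (simp add: power2_sum)
  ultimately have "(p + q)\<^sup>2 \<le> 2 * ((1 / 2) ^ l0)\<^sup>2 + 2 * q"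
    using q1 by linarith
  then show "(stacked w k x)\<^sup>2 \<le> 2 * ((1 / 2) ^ l0)\<^sup>2 + 2 * (\<Sum>l<l0. (1 / 2) ^ Suc l * w (2 * k - l) x)"
    by (simp only: pq q_def f_def)
qed

text \<open>Here a i n is the mass of the n-th quasimode seen by the i-th bump; \<open>up\<close>
  and \<open>dn\<close> are its two conflicting iterated limits. Each chosen scale has a quasimode
  that sees it, and later scales are taken too fine for all quasimodes chosen earlier.\<close>

lemma exists_separated_scales:
  fixes a :: "nat \<Rightarrow> nat \<Rightarrow> real" and \<rho> :: "nat \<Rightarrow> real"
  assumes c0: "0 < c0" and up: "\<And>i. \<exists>L\<ge>c0. (\<lambda>n. a i n) \<longlonglongrightarrow> L" and dn: "\<And>n. (\<lambda>i. a i n) \<longlonglongrightarrow> 0"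
    and \<rho>: "\<rho> \<longlonglongrightarrow> 0"
  obtains r n :: "nat \<Rightarrow> nat" where "\<And>m. m \<le> r m" "\<And>m. c0 / 2 \<le> a (r m) (n m)"
    "\<And>m. \<rho> (n m) \<le> 1 / (real m + 1)" "\<And>m m'. m < m' \<Longrightarrow> a (r m') (n m) \<le> (1 / 4) ^ m'"
proof -
  have "\<exists>n. c0 / 2 \<le> a i n \<and> \<rho> n \<le> 1 / (real i + 1)" for i
  proof -
    obtain L where L: "c0 \<le> L" "(\<lambda>n. a i n) \<longlonglongrightarrow> L" using up by blast
    have "c0 / 2 < L" using L(1) c0 by linarith
    then have "\<forall>\<^sub>F n in sequentially. c0 / 2 < a i n"
      using L(2) by (rule order_tendstoD(1)[rotated])
    moreover have "\<forall>\<^sub>F n in sequentially. \<rho> n < 1 / (real i + 1)"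
      using \<rho> by (rule order_tendstoD) simp
    ultimately have "\<forall>\<^sub>F n in sequentially. c0 / 2 \<le> a i n \<and> \<rho> n \<le> 1 / (real i + 1)"
      by eventually_elim simp
    then show ?thesis
      by (rule eventually_happens'[OF sequentially_bot])
  qed
  then obtain f where f: "\<And>i. c0 / 2 \<le> a i (f i)" "\<And>i. \<rho> (f i) \<le> 1 / (real i + 1)"
    by metis
  \<comment> \<open>The bound holds for every \<open>j \<le> p\<close>, so being past the last
    chosen scale \<open>p\<close> takes care of all earlier choices at once.\<close>
  have "\<exists>q>p. \<forall>j\<le>p. \<forall>i\<ge>q. a i (f j) \<le> (1 / 4) ^ Suc m" for p m
  proof -
    have "\<forall>\<^sub>F i in sequentially. a i (f j) < (1 / 4) ^ Suc m" for j
      using dn by (rule order_tendstoD) simp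
    then have "\<forall>\<^sub>F i in sequentially. \<forall>j\<in>{..p}. a i (f j) < (1 / 4) ^ Suc m"
      by (intro eventually_ball_finite) auto
    then obtain q where q: "\<And>i. q \<le> i \<Longrightarrow> \<forall>j\<in>{..p}. a i (f j) < (1 / 4) ^ Suc m"
      by (auto simp: eventually_sequentially)
    show ?thesis
      using q by (intro exI[of _ "max q (Suc p)"]) (auto simp: less_imp_le)
  qed
  then obtain q where q: "\<And>p m. p < q p m" "\<And>p m j i. \<lbrakk>j \<le> p; q p m \<le> i\<rbrakk> \<Longrightarrow> a i (f j) \<le> (1 / 4) ^ Suc m"
    by metis
  define r where "r = rec_nat 0 (\<lambda>m p. q p m)"
  have r_Suc: "r (Suc m) = q (r m) m" for m by (simp add: r_def)
  have "strict_mono r"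
    by (rule strict_monoI_Suc) (simp add: r_Suc q(1))
  then have r_id: "m \<le> r m" and r_mono: "m \<le> m' \<Longrightarrow> r m \<le> r m'" for m m'
    by (auto simp: strict_mono_imp_increasing strict_mono_less_eq)
  have "a (r m') (f (r m)) \<le> (1 / 4) ^ m'" if "m < m'" for m m'
  proof (cases m')
    case (Suc m'')
    then show ?thesis
      using q(2)[of "r m" "r m''" m'' "r m'"] r_mono[of m m''] that by (simp add: r_Suc)
  qed (use that in simp)
  moreover have "\<rho> (f (r m)) \<le> 1 / (real m + 1)" for m
  proof -
    have "1 / (real (r m) + 1) \<le> 1 / (real m + 1)"
      using r_id[of m] by (intro divide_left_mono) auto
    then show ?thesis using f(2)[of "r m"] by linarith
  qed
  ultimately show ?thesis
    using that[of r "\<lambda>m. f (r m)"] r_id f(1) by blast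
qed

text \<open>The stack is independent of t; only the layer \<open>l0\<close> used in the estimate
  depends on it. With s = (1/2)^l0, that layer gains t s c0 / 4, the quadratic loss is at most half
  of this, and \<open>err\<close> collects what tends to zero as k grows.\<close>

lemma exists_stacked_potentials:
  fixes w :: "nat \<Rightarrow> 'a \<Rightarrow> real" and u :: "nat \<Rightarrow> 'a \<Rightarrow> complex" and lam :: "nat \<Rightarrow> real"
  assumes sa: "self_adjoint \<mu> H" and u_dom: "\<And>n. u n \<in> fst H" and u_norm: "\<And>n. l2.nrm \<mu> (u n) = 1"
    and quasi: "(\<lambda>n. l2.nrm \<mu> (snd H (u n) - fscale (complex_of_real (lam n)) (u n))) \<longlonglongrightarrow> 0"
    and w_meas: "\<And>i. w i \<in> borel_measurable \<mu>" and w: "\<And>i x. 0 \<le> w i x" "\<And>i x. w i x \<le> 1"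
    and c0: "0 < c0" and up: "\<And>i. \<exists>L\<ge>c0. (\<lambda>n. \<integral>x. w i x * (cmod (u n x))\<^sup>2 \<partial>\<mu>) \<longlonglongrightarrow> L"
    and dn: "\<And>n. (\<lambda>i. \<integral>x. w i x * (cmod (u n x))\<^sup>2 \<partial>\<mu>) \<longlonglongrightarrow> 0"
  obtains r :: "nat \<Rightarrow> nat" where "\<And>m. m \<le> r m"
    "\<And>t. 0 < t \<Longrightarrow> 0 < liminf (\<lambda>k. op_norm \<mu> (\<lambda>f x.
        evolution \<mu> (add_potential H (stacked (\<lambda>m. w (r m)) k)) t f x - evolution \<mu> H t f x))"
proof -
  define a where "a i n = (\<integral>x. w i x * (cmod (u n x))\<^sup>2 \<partial>\<mu>)" for i n
  define \<rho> where "\<rho> n = l2.nrm \<mu> (snd H (u n) - fscale (complex_of_real (lam n)) (u n))" for n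
  obtain r n where r_id: "\<And>m. m \<le> r m" and big: "\<And>m. c0 / 2 \<le> a (r m) (n m)"
    and \<rho>_n: "\<And>m. \<rho> (n m) \<le> 1 / (real m + 1)" and tail: "\<And>m m'. m < m' \<Longrightarrow> a (r m') (n m) \<le> (1 / 4) ^ m'"
    using exists_separated_scales[of c0 a \<rho>] c0 up dn quasi unfolding a_def \<rho>_def by blast
  define W where "W k = stacked (\<lambda>m. w (r m)) k" for k
  have W_meas: "W k \<in> borel_measurable \<mu>" for k
    unfolding W_def stacked_def[abs_def] using w_meas by measurable
  have W01: "0 \<le> W k x" "W k x \<le> 1" for k x
    unfolding W_def using w by (auto intro: stacked_bounds)
  then have W_abs: "\<bar>W k x\<bar> \<le> 1" for k x by simp
  have uL: "u j \<in> L2 \<mu>" and HuL: "snd H (u j) \<in> L2 \<mu>" for j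
    using self_adjointD(1,2)[OF sa] u_dom by auto
  have \<rho>0: "0 \<le> \<rho> j" for j
    unfolding \<rho>_def using uL HuL by (intro l2.nrm_nonneg) blast
  have u_int: "integrable \<mu> (\<lambda>x. (cmod (u j x))\<^sup>2)" and u_meas: "u j \<in> borel_measurable \<mu>" for j
    using uL[of j] by (auto simp: L2_iff)
  have u1: "(\<integral>x. (cmod (u j x))\<^sup>2 \<partial>\<mu>) = 1" for j
    using L2_nrm_sq[of \<mu> "u j"] u_norm by simp
  have int: "integrable \<mu> (\<lambda>x. g x * (cmod (u j x))\<^sup>2)"
    if "g \<in> borel_measurable \<mu>" "\<And>x. \<bar>g x\<bar> \<le> 1" for g :: "'a \<Rightarrow> real" and j
  proof (rule Bochner_Integration.integrable_bound[OF u_int[of j]])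
    show "(\<lambda>x. g x * (cmod (u j x))\<^sup>2) \<in> borel_measurable \<mu>"
      using that(1) u_meas by measurable
    show "AE x in \<mu>. norm (g x * (cmod (u j x))\<^sup>2) \<le> norm ((cmod (u j x))\<^sup>2)"
      using that(2) by (auto simp: abs_mult mult_left_le_one_le)
  qed
  have w_int: "integrable \<mu> (\<lambda>x. w i x * (cmod (u j x))\<^sup>2)" for i j
    using w w_meas by (intro int) auto
  let ?T = "\<lambda>t k. op_norm \<mu> (\<lambda>f x. evolution \<mu> (add_potential H (W k)) t f x - evolution \<mu> H t f x)"
  have "0 < liminf (\<lambda>k. ?T t k)"
    if t: "0 < t" for t
  proof -
    \<comment> \<open>The loss will be 4 t^2 s^2, to be kept below t s c0 / 8, that is 32 t s \<le>
      c0; 64 leaves room.\<close>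
    obtain l0 where l0: "(1 / 2) ^ l0 < c0 / (64 * t)"
      using real_arch_pow_inv[of "c0 / (64 * t)" "1 / 2"] c0 t by auto
    define s :: real where "s = (1 / 2) ^ l0"
    have s: "0 < s" "64 * t * s < c0"
      using l0 t by (auto simp: s_def field_simps)
    define err where "err k = 2 * t * (1 / (real k + 1)) + t\<^sup>2 * (4 * (1 / 4) ^ k + 2 * (1 / (real k + 1))\<^sup>2)" for k
    have main: "ennreal (t * s * c0 / 8 - err k)
        \<le> ?T t k"
      if k: "l0 \<le> k" for k
    proof -
      \<comment> \<open>The scale index of the layer with amplitude s / 2 in the k-th stack; the
        trial vector is the quasimode chosen for it. Layers with l < l0 have larger index 2 k - l,
        so \<open>tail\<close> makes them nearly invisible to it.\<close>
      define m where "m = 2 * k - l0"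
      define v where "v = u (n m)"
      define b where "b = l2.nrm \<mu> (\<lambda>x. complex_of_real (W k x) * v x)"
      define e where "e = \<rho> (n m)"
      have km: "k \<le> m" using k by (simp add: m_def)
      have e: "0 \<le> e" "e \<le> 1 / (real k + 1)"
      proof -
        have "1 / (real m + 1) \<le> 1 / (real k + 1)"
          using km by (intro divide_left_mono) auto
        then show "e \<le> 1 / (real k + 1)" using \<rho>_n[of m] by (simp add: e_def)
      qed (simp add: e_def \<rho>0)
      let ?I = "\<integral>x. W k x * (cmod (v x))\<^sup>2 \<partial>\<mu>"
      \<comment> \<open>One factor 1/2 is the amplitude (1/2)^(l0 + 1) against s, the other is the
        guaranteed mass c0 / 2.\<close>
      have low: "s * c0 / 4 \<le> ?I"
      proof -
        have "s * c0 / 4 \<le> (1 / 2) ^ Suc l0 * a (r m) (n m)"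
          using big[of m] s(1) by (simp add: s_def field_simps)
        also have "\<dots> = (\<integral>x. (1 / 2) ^ Suc l0 * (w (r m) x * (cmod (v x))\<^sup>2) \<partial>\<mu>)"
          by (simp add: a_def v_def)
        also have "\<dots> \<le> ?I"
        proof (rule integral_mono)
          show "integrable \<mu> (\<lambda>x. (1 / 2) ^ Suc l0 * (w (r m) x * (cmod (v x))\<^sup>2))"
            unfolding v_def using w_int by simp
          show "integrable \<mu> (\<lambda>x. W k x * (cmod (v x))\<^sup>2)"
            unfolding v_def using W_meas W_abs by (rule int)
          fix x
          have "(1 / 2) ^ Suc l0 * w (r m) x \<le> W k x"
            unfolding W_def m_def using w k by (intro stacked_split(1)) auto
          then show "(1 / 2) ^ Suc l0 * (w (r m) x * (cmod (v x))\<^sup>2) \<le> W k x * (cmod (v x))\<^sup>2"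
            unfolding mult.assoc[symmetric] by (rule mult_right_mono) simp
        qed
        finally show ?thesis .
      qed
      have b: "b\<^sup>2 \<le> 2 * s\<^sup>2 + 2 * (1 / 4) ^ k"
      proof -
        have "b\<^sup>2 = (\<integral>x. (W k x)\<^sup>2 * (cmod (v x))\<^sup>2 \<partial>\<mu>)"
          unfolding b_def L2_nrm_sq by (simp add: norm_mult power_mult_distrib)
        also have "\<dots> \<le> (\<integral>x. 2 * s\<^sup>2 * (cmod (v x))\<^sup>2
            + 2 * (\<Sum>l<l0. (1 / 2) ^ Suc l * (w (r (2 * k - l)) x * (cmod (v x))\<^sup>2)) \<partial>\<mu>)"
        proof (rule integral_mono)
          show "integrable \<mu> (\<lambda>x. (W k x)\<^sup>2 * (cmod (v x))\<^sup>2)"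
            unfolding v_def using W_meas W_abs
            by (intro int) (auto simp: power_le_one abs_square_le_1)
          show "integrable \<mu> (\<lambda>x. 2 * s\<^sup>2 * (cmod (v x))\<^sup>2
            + 2 * (\<Sum>l<l0. (1 / 2) ^ Suc l * (w (r (2 * k - l)) x * (cmod (v x))\<^sup>2)))"
            unfolding v_def using w_int u_int by (intro Bochner_Integration.integrable_add
              Bochner_Integration.integrable_mult_right Bochner_Integration.integrable_sum) auto
          fix x
          have "(W k x)\<^sup>2 \<le> 2 * s\<^sup>2 + 2 * (\<Sum>l<l0. (1 / 2) ^ Suc l * w (r (2 * k - l)) x)"
            unfolding W_def s_def using w k by (intro stacked_split(2)) auto
          then have "(W k x)\<^sup>2 * (cmod (v x))\<^sup>2
              \<le> (2 * s\<^sup>2 + 2 * (\<Sum>l<l0. (1 / 2) ^ Suc l * w (r (2 * k - l)) x)) * (cmod (v x))\<^sup>2"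
            by (rule mult_right_mono) simp
          then show "(W k x)\<^sup>2 * (cmod (v x))\<^sup>2 \<le> 2 * s\<^sup>2 * (cmod (v x))\<^sup>2
            + 2 * (\<Sum>l<l0. (1 / 2) ^ Suc l * (w (r (2 * k - l)) x * (cmod (v x))\<^sup>2))"
            by (simp add: distrib_right sum_distrib_right mult.assoc)
        qed
        also have "\<dots> = 2 * s\<^sup>2 + 2 * (\<Sum>l<l0. (1 / 2) ^ Suc l * a (r (2 * k - l)) (n m))"
          unfolding v_def a_def using w_int u_int u1
          by (subst Bochner_Integration.integral_add) (auto simp: Bochner_Integration.integral_sum)
        \<comment> \<open>For l < l0 \<le> k the index 2 k - l exceeds m, as \<open>tail\<close>
          requires, and is at least k, which gives a rate depending on k alone.\<close>
        also have "(\<Sum>l<l0. (1 / 2) ^ Suc l * a (r (2 * k - l)) (n m)) \<le> (\<Sum>l<l0. (1 / 2) ^ Suc l * (1 / 4) ^ k)"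
        proof (intro sum_mono mult_left_mono)
          fix l assume l: "l \<in> {..<l0}"
          have "a (r (2 * k - l)) (n m) \<le> (1 / 4) ^ (2 * k - l)"
            using l k by (intro tail) (auto simp: m_def)
          also have "\<dots> \<le> (1 / 4) ^ k"
            using l k by (intro power_decreasing) auto
          finally show "a (r (2 * k - l)) (n m) \<le> (1 / 4) ^ k" .
        qed simp
        also have "\<dots> \<le> 1 * (1 / 4) ^ k"
        proof -
          have "(\<Sum>l<l0. (1 / 2) ^ Suc l) \<le> (\<Sum>l\<in>{0..l0}. (1 / 2 :: real) ^ Suc l)"
            by (intro sum_mono2) auto
          then have "(\<Sum>l<l0. (1 / 2 :: real) ^ Suc l) \<le> 1"
            using geometric_half_le[of 0 l0] by simp
          then show ?thesis
            unfolding sum_distrib_right[symmetric] by (intro mult_right_mono) auto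
        qed
        finally show ?thesis by simp
      qed
      have "(b + e)\<^sup>2 \<le> 2 * b\<^sup>2 + 2 * e\<^sup>2"
        using sum_squares_bound[of b e] by (simp add: power2_sum)
      moreover have "e\<^sup>2 \<le> (1 / (real k + 1))\<^sup>2"
        using e by (intro power_mono)
      ultimately have "(b + e)\<^sup>2 \<le> 4 * s\<^sup>2 + (4 * (1 / 4) ^ k + 2 * (1 / (real k + 1))\<^sup>2)"
        using b by linarith
      then have 1: "t\<^sup>2 * (b + e)\<^sup>2 \<le> t\<^sup>2 * (4 * s\<^sup>2) + t\<^sup>2 * (4 * (1 / 4) ^ k + 2 * (1 / (real k + 1))\<^sup>2)"
        unfolding distrib_left[symmetric] by (rule mult_left_mono) simp
      have 2: "t\<^sup>2 * (4 * s\<^sup>2) \<le> t * s * c0 / 8"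
      proof -
        have "(t * s) * (64 * t * s) \<le> (t * s) * c0"
          using s t by (intro mult_left_mono) auto
        then have "64 * (t\<^sup>2 * s\<^sup>2) \<le> t * s * c0"
          by (simp add: power2_eq_square mult_ac)
        moreover have "0 \<le> t\<^sup>2 * s\<^sup>2" by simp
        ultimately show ?thesis by linarith
      qed
      have 3: "t * (s * c0 / 4) \<le> t * ?I"
        using low t by (intro mult_left_mono) auto
      have 4: "2 * t * e \<le> 2 * t * (1 / (real k + 1))"
        using e(2) t by (intro mult_left_mono) auto
      have "t * s * c0 / 8 - err k \<le> t * ?I - 2 * t * e - t\<^sup>2 * (b + e)\<^sup>2"
        using 1 2 3 4 by (simp add: err_def mult.assoc)
      then have "ennreal (t * s * c0 / 8 - err k)
          \<le> ennreal (t * ?I - 2 * t * e - t\<^sup>2 * (b + e)\<^sup>2)"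
        by (rule ennreal_leI)
      also have "\<dots> \<le> ?T t k"
        unfolding b_def e_def \<rho>_def v_def
        by (rule op_norm_evolution_ge[OF sa W_meas W_abs u_dom u_norm t])
      finally show ?thesis .
    qed
    have inv: "(\<lambda>k. 1 / (real k + 1)) \<longlonglongrightarrow> 0"
      using LIMSEQ_inverse_real_of_nat by (simp add: divide_inverse add.commute)
    have "err \<longlonglongrightarrow> 2 * t * 0 + t\<^sup>2 * (4 * 0 + 2 * 0\<^sup>2)"
      unfolding err_def by (intro tendsto_intros inv LIMSEQ_power_zero) simp
    then have "\<forall>\<^sub>F k in sequentially. err k < t * s * c0 / 16"
      by (rule order_tendstoD) (use t s c0 in simp)
    then have "\<forall>\<^sub>F k in sequentially. ennreal (t * s * c0 / 16)
        \<le> ?T t k"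
      using eventually_ge_at_top[of l0]
    proof eventually_elim
      case (elim k)
      then have "ennreal (t * s * c0 / 16) \<le> ennreal (t * s * c0 / 8 - err k)"
        by (intro ennreal_leI) linarith
      then show ?case using main[of k] elim(2) by (meson order_trans)
    qed
    then show ?thesis
      using t s c0 by (intro liminf_pos[of "t * s * c0 / 16"]) auto
  qed
  then show ?thesis
    using that[of r] r_id by (simp add: W_def)
qed

section \<open>From the manifold to the abstract construction\<close>

theorem theorem2p1:
  fixes A :: "('a::{t2_space, second_countable_topology}, 'n::finite) chart set"
    and g :: "('a, 'n) metric"
    and \<mu> \<nu> :: "'a measure"
    and V :: "'a \<Rightarrow> real"
    and lam :: "nat \<Rightarrow> real"
    and u :: "nat \<Rightarrow> 'a \<Rightarrow> complex"
  defines "H \<equiv> schroedinger A g \<mu> V"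
  assumes manifold: "riemannian_manifold A g"
    and volume: "riemannian_volume A g \<mu>"
    and V_cont: "continuous_on UNIV V"
    and V_nonneg: "\<forall>x. 0 \<le> V x"
    and H_sa: "self_adjoint \<mu> H"
    and u_dom: "\<forall>n. u n \<in> fst H"
    and u_norm: "\<forall>n. Lp_norm \<mu> 2 (u n) = 1"
    and quasimodes:
      "(\<lambda>n. Lp_norm \<mu> 2 (\<lambda>x. snd H (u n) x - complex_of_real (lam n) * u n x)) \<longlonglongrightarrow> 0"
    and nu_borel: "sets \<nu> = sets borel"
    and nu_finite: "finite_measure \<nu>"
    and weak_star: "\<forall>f :: 'a \<Rightarrow> real. continuous_on UNIV f \<and> vanishes_at_infinity f \<longrightarrow>
      (\<lambda>n. \<integral>x. f x * (cmod (u n x))\<^sup>2 \<partial>\<mu>) \<longlonglongrightarrow> (\<integral>x. f x \<partial>\<nu>)"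
    and not_ac: "\<not> absolutely_continuous \<mu> \<nu>"
  shows "\<exists>W :: nat \<Rightarrow> 'a \<Rightarrow> real.
    (\<forall>k. smooth_fun A (W k) \<and> bounded (range (W k)) \<and> Linf_norm \<mu> (W k) \<le> 1 \<and>
         self_adjoint \<mu> (add_potential H (W k))) \<and>
    (\<forall>p::real. p \<ge> 1 \<longrightarrow> (\<lambda>k. Lp_norm \<mu> p (W k)) \<longlonglongrightarrow> 0) \<and>
    (\<forall>t>0. liminf (\<lambda>k. op_norm \<mu> (\<lambda>f x.
        evolution \<mu> (add_potential H (W k)) t f x - evolution \<mu> H t f x)) > 0)"
proof -
  have A: "smooth_atlas A"
    using manifold by (simp add: riemannian_manifold_def)
  have mu_borel: "sets \<mu> = sets borel"
    using volume by (simp add: riemannian_volume_def)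
  obtain c K where c: "c \<in> A" and K: "compact K" "K \<subseteq> chart_image c"
    and null: "chart_inv c ` K \<in> null_sets \<mu>" and nu_pos: "0 < emeasure \<nu> (chart_inv c ` K)"
    using exists_compact_null_in_chart[OF A nu_borel nu_finite mu_borel not_ac] by blast
  have "K \<noteq> {}" using nu_pos by auto
  define N where "N = chart_inv c ` K"
  obtain G w where G: "\<And>i. G i \<in> sets \<mu>" "decseq G" "(\<Inter>i. G i) = N"
      "(\<lambda>i. emeasure \<mu> (G i)) \<longlonglongrightarrow> 0" "\<And>i. emeasure \<mu> (G i) < \<infinity>"
    and w: "\<And>i. smooth_fun A (w i)" "\<And>i. continuous_on UNIV (w i)" "\<And>i. vanishes_at_infinity (w i)"
      "\<And>i x. 0 \<le> w i x" "\<And>i x. w i x \<le> 1" "\<And>i x. x \<notin> G i \<Longrightarrow> w i x = 0"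
      "\<And>i x. x \<in> N \<Longrightarrow> exp (- 1 / 2) \<le> w i x"
    using exists_shrinking_bumps[OF manifold volume c K \<open>K \<noteq> {}\<close> null] unfolding N_def by metis
  interpret nu: finite_measure \<nu> by (rule nu_finite)
  have w_borel: "w i \<in> borel_measurable borel" for i
    using w(2) by (rule borel_measurable_continuous_onI)
  have w_mu: "w i \<in> borel_measurable \<mu>" and w_nu: "w i \<in> borel_measurable \<nu>" for i
    using w_borel[of i] mu_borel nu_borel by (simp_all cong: measurable_cong_sets)
  have uL: "u n \<in> L2 \<mu>" and HuL: "snd H (u n) \<in> L2 \<mu>" for n
    using self_adjointD(1,2)[OF H_sa] u_dom by auto
  have u_int: "integrable \<mu> (\<lambda>x. (cmod (u n x))\<^sup>2)" for n
    using uL[of n] by (simp add: L2_iff)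
  have u_nrm: "l2.nrm \<mu> (u n) = 1" for n
    using u_norm Lp_norm_2[OF uL[of n]] l2.nrm_nonneg[OF uL[of n]] by (simp add: ennreal_eq_1)
  have quasi: "(\<lambda>n. l2.nrm \<mu> (snd H (u n) - fscale (complex_of_real (lam n)) (u n))) \<longlonglongrightarrow> 0"
  proof -
    have dL: "snd H (u n) - fscale (complex_of_real (lam n)) (u n) \<in> L2 \<mu>" for n
      using uL HuL by blast
    have "Lp_norm \<mu> 2 (\<lambda>x. snd H (u n) x - complex_of_real (lam n) * u n x)
        = ennreal (l2.nrm \<mu> (snd H (u n) - fscale (complex_of_real (lam n)) (u n)))" for n
    proof -
      have "(\<lambda>x. snd H (u n) x - complex_of_real (lam n) * u n x) = snd H (u n) - fscale (complex_of_real (lam n)) (u n)"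
        by (simp add: fun_eq_iff)
      then show ?thesis using Lp_norm_2[OF dL] by simp
    qed
    then show ?thesis
      using quasimodes dL by (simp add: tendsto_ennreal_0_iff)
  qed
  \<comment> \<open>Every bump is at least exp (-1/2) on \<open>N\<close>, so this bounds the
    \<nu>-integrals of all bumps from below, uniformly in the scale.\<close>
  define c0 where "c0 = exp (- 1 / 2) * measure \<nu> N"
  have N_sets: "N \<in> sets \<nu>"
    using null mu_borel nu_borel by (auto simp: N_def)
  have c0: "0 < c0"
    using nu_pos by (simp add: c0_def N_def nu.emeasure_eq_measure)
  have up: "\<exists>L\<ge>c0. (\<lambda>n. \<integral>x. w i x * (cmod (u n x))\<^sup>2 \<partial>\<mu>) \<longlonglongrightarrow> L" for i
  proof (intro exI conjI)
    show "(\<lambda>n. \<integral>x. w i x * (cmod (u n x))\<^sup>2 \<partial>\<mu>) \<longlonglongrightarrow> (\<integral>x. w i x \<partial>\<nu>)"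
      using weak_star w(2,3) by blast
    have "c0 = (\<integral>x. exp (- 1 / 2) * indicator N x \<partial>\<nu>)"
      using N_sets by (simp add: c0_def)
    also have "\<dots> \<le> (\<integral>x. w i x \<partial>\<nu>)"
    proof (rule integral_mono)
      show "integrable \<nu> (\<lambda>x. exp (- 1 / 2) * indicator N x :: real)"
        using N_sets by (intro integrable_mult_right) (simp add: nu.emeasure_eq_measure)
      show "integrable \<nu> (w i)"
        using w(4,5) w_nu by (intro nu.integrable_const_bound[of _ 1]) auto
      show "exp (- 1 / 2) * indicator N x \<le> w i x" for x
        using w(4)[of i x] w(7)[of x i] by (auto split: split_indicator)
    qed
    finally show "c0 \<le> (\<integral>x. w i x \<partial>\<nu>)" .
  qed
  \<comment> \<open>Dominated by |u_n|^2. Off \<open>N\<close> each point leaves the decreasing sets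
    \<open>G i\<close> eventually, and \<open>N\<close> is \<mu>-null.\<close>
  have dn: "(\<lambda>i. \<integral>x. w i x * (cmod (u n x))\<^sup>2 \<partial>\<mu>) \<longlonglongrightarrow> 0" for n
  proof -
    have "(\<lambda>i. \<integral>x. w i x * (cmod (u n x))\<^sup>2 \<partial>\<mu>) \<longlonglongrightarrow> (\<integral>x. 0 \<partial>\<mu>)"
    proof (rule integral_dominated_convergence)
      show "integrable \<mu> (\<lambda>x. (cmod (u n x))\<^sup>2)" by (rule u_int)
      show "(\<lambda>x. w i x * (cmod (u n x))\<^sup>2) \<in> borel_measurable \<mu>" for i
        using w_mu borel_measurable_integrable[OF u_int] by (rule borel_measurable_times)
      show "AE x in \<mu>. norm (w i x * (cmod (u n x))\<^sup>2) \<le> (cmod (u n x))\<^sup>2" for i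
        using w(4,5) by (auto simp: abs_mult mult_left_le_one_le)
      have "AE x in \<mu>. x \<notin> N"
        using null AE_not_in by (auto simp: N_def)
      then show "AE x in \<mu>. (\<lambda>i. w i x * (cmod (u n x))\<^sup>2) \<longlonglongrightarrow> 0"
      proof eventually_elim
        fix x assume "x \<notin> N"
        then obtain i0 where i0: "x \<notin> G i0" using G(3) by blast
        have "\<forall>\<^sub>F i in sequentially. w i x * (cmod (u n x))\<^sup>2 = 0"
          using eventually_ge_at_top[of i0]
        proof eventually_elim
          fix i assume "i0 \<le> i"
          then have "x \<notin> G i" using i0 G(2) by (auto simp: decseq_def)
          then show "w i x * (cmod (u n x))\<^sup>2 = 0" by (simp add: w(6))
        qed
        then show "(\<lambda>i. w i x * (cmod (u n x))\<^sup>2) \<longlonglongrightarrow> 0"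
          by (rule tendsto_eventually)
      qed
    qed simp
    then show ?thesis by simp
  qed
  obtain r where r: "\<And>m. m \<le> r m" and lim: "\<And>t. 0 < t \<Longrightarrow> 0 < liminf (\<lambda>k. op_norm \<mu> (\<lambda>f x.
        evolution \<mu> (add_potential H (stacked (\<lambda>m. w (r m)) k)) t f x - evolution \<mu> H t f x))"
    using exists_stacked_potentials[OF H_sa _ u_nrm quasi w_mu w(4,5) c0 up dn] u_dom by blast
  define W where "W k = stacked (\<lambda>m. w (r m)) k" for k
  have W01: "0 \<le> W k x" "W k x \<le> 1" for k x
    unfolding W_def using w(4,5) by (auto intro: stacked_bounds)
  have W_meas: "W k \<in> borel_measurable \<mu>" for k
    unfolding W_def stacked_def[abs_def] using w_mu by measurable
  \<comment> \<open>Every layer of the k-th stack has scale r (2 k - l) \<ge> 2 k - l \<ge> k, so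
    its support lies in \<open>G k\<close>.\<close>
  have W_ind: "\<bar>W k x\<bar> \<le> indicator (G k) x" for k x
  proof (cases "x \<in> G k")
    case False
    have "w (r (2 * k - l)) x = 0" if "l \<le> k" for l
    proof -
      have "k \<le> r (2 * k - l)" using r[of "2 * k - l"] that by linarith
      then have "x \<notin> G (r (2 * k - l))" using False G(2) by (auto simp: decseq_def)
      then show ?thesis by (rule w(6))
    qed
    then show ?thesis by (simp add: W_def stacked_def)
  qed (use W01 in simp)
  have "smooth_fun A (W k)" for k
    unfolding W_def stacked_def[abs_def] by (intro smooth_fun_sum A w(1))
  moreover have "bounded (range (W k))" for k
    unfolding bounded_iff using W01 by (intro exI[of _ 1]) auto
  moreover have "Linf_norm \<mu> (W k) \<le> 1" for k
    unfolding Linf_norm_def using W01 W_meas by (intro esssup_I) auto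
  moreover have "self_adjoint \<mu> (add_potential H (W k))" for k
    using W01 by (intro self_adjoint_add_potential[OF H_sa W_meas, of _ 1]) auto
  moreover have "(\<lambda>k. Lp_norm \<mu> p (W k)) \<longlonglongrightarrow> 0" if "1 \<le> p" for p
    using that G(1,4,5) W_ind by (rule Lp_norm_tendsto_0)
  ultimately show ?thesis
    using lim by (intro exI[of _ W]) (simp add: W_def)
qed

end
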